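(* Let $\mathcal{N}\subseteq\mathcal{M}$ be a finite-index inclusion of von Neumann algebras and suppose $\mathcal{N}$ is a factor. Let $\Phi:\mathcal{M}\to\mathcal{M}$ be a relatively irreducible $\mathcal{N}$-$\mathcal{N}$-bimodule quantum channel. Then the eigenvalues of $\Phi$ of modulus $1$ form a finite cyclic group under multiplication of complex numbers (called the phase group of $\Phi$).
   Context: Inclusions of von Neumann algebras are unital. An $\mathcal{N}$-$\mathcal{N}$-bimodule quantum channel on $\mathcal{M}$ is a normal, unital, completely positive linear map $\Phi:\mathcal{M}\to\mathcal{M}$ with $\Phi(y_1xy_2)=y_1\Phi(x)y_2$ for all $x\in\mathcal{M}$, $y_1,y_2\in\mathcal{N}$. Relatively irreducible: whenever $p\in\mathcal{M}$ is a projection with $\Phi(p)\leq c\,p$ for some $c>0$, then $p\in\mathcal{N}$. Finite-index: there exist a (normal) conditional expectation $E_{\mathcal{N}}:\mathcal{M}\to\mathcal{N}$ and $\lambda>0$ such that $E_{\mathcal{N}}(x)\geq\lambda x$ for all $x\in\mathcal{M}^+$ (Pimsner-Popa inequality). *)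

theory Defs
  imports "HOL-Analysis.Analysis" "HOL-Algebra.Elementary_Groups"
begin

section \<open>Complex Hilbert spaces\<close>

class complex_vector = real_vector +
  fixes scaleC :: "complex \<Rightarrow> 'a \<Rightarrow> 'a"  (infixr \<open>*\<^sub>C\<close> 75)
  assumes scaleC_add_right: "c *\<^sub>C (x + y) = c *\<^sub>C x + c *\<^sub>C y"
    and scaleC_add_left: "(c + d) *\<^sub>C x = c *\<^sub>C x + d *\<^sub>C x"
    and scaleC_scaleC: "c *\<^sub>C d *\<^sub>C x = (c * d) *\<^sub>C x"
    and scaleR_scaleC: "r *\<^sub>R x = complex_of_real r *\<^sub>C x"

text \<open>
  The complex inner product is linear in its second argument. Definiteness, the norm
  and the topology are inherited from the real inner product, which is its real part.
\<close>

class chilbert_space = complex_vector + real_inner + complete_space +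
  fixes cinner :: "'a \<Rightarrow> 'a \<Rightarrow> complex"
  assumes cinner_commute: "cinner x y = cnj (cinner y x)"
    and cinner_add_right: "cinner x (y + z) = cinner x y + cinner x z"
    and cinner_scaleC_right: "cinner x (c *\<^sub>C y) = c * cinner x y"
    and inner_eq_Re_cinner: "inner x y = Re (cinner x y)"

subclass (in chilbert_space) banach ..

lemma norm_scaleC: "norm (c *\<^sub>C x) = cmod c * norm (x :: 'a::chilbert_space)"
proof -
  have "cinner (c *\<^sub>C x) (c *\<^sub>C x) = c * (cnj c * cinner x x)"
    by (metis cinner_commute cinner_scaleC_right complex_cnj_mult complex_cnj_cnj)
  also have "\<dots> = complex_of_real ((cmod c)\<^sup>2) * cinner x x"
    by (simp add: complex_norm_square del: of_real_power)
  finally have "inner (c *\<^sub>C x) (c *\<^sub>C x) = (cmod c)\<^sup>2 * inner x x"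
    by (simp add: inner_eq_Re_cinner del: of_real_power)
  then show ?thesis
    by (simp add: norm_eq_sqrt_inner real_sqrt_mult)
qed

lemma bounded_linear_scaleC: "bounded_linear (\<lambda>x :: 'a::chilbert_space. c *\<^sub>C x)"
proof (rule bounded_linear_intro)
  show "c *\<^sub>C r *\<^sub>R x = r *\<^sub>R c *\<^sub>C x" for r and x :: 'a
    by (simp add: scaleR_scaleC scaleC_scaleC mult.commute)
  show "norm (c *\<^sub>C x) \<le> norm x * cmod c" for x :: 'a
    by (simp add: norm_scaleC mult.commute)
qed (rule scaleC_add_right)

instantiation blinfun :: (real_normed_vector, chilbert_space) complex_vector
begin

lift_definition scaleC_blinfun :: "complex \<Rightarrow> 'a \<Rightarrow>\<^sub>L 'b \<Rightarrow> 'a \<Rightarrow>\<^sub>L 'b"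
  is "\<lambda>c f x. c *\<^sub>C f x"
  by (rule bounded_linear_compose[OF bounded_linear_scaleC])

instance
  by standard
    (transfer; simp add: fun_eq_iff scaleC_add_right scaleC_add_left scaleC_scaleC scaleR_scaleC)+

end

section \<open>Bounded operators\<close>

text \<open>
  Elements of \<open>'h \<Rightarrow>\<^sub>L 'h\<close> are only real-linear, so \<open>B(H)\<close> is the following set.
\<close>

definition bounded_ops :: "('h::chilbert_space \<Rightarrow>\<^sub>L 'h) set" where
  "bounded_ops = {T. \<forall>c \<xi>. blinfun_apply T (c *\<^sub>C \<xi>) = c *\<^sub>C blinfun_apply T \<xi>}"

definition is_adjoint :: "('h::chilbert_space \<Rightarrow>\<^sub>L 'h) \<Rightarrow> ('h \<Rightarrow>\<^sub>L 'h) \<Rightarrow> bool" where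
  "is_adjoint S T \<longleftrightarrow>
     (\<forall>\<xi> \<eta>. cinner (blinfun_apply S \<xi>) \<eta> = cinner \<xi> (blinfun_apply T \<eta>))"

definition self_adjoint :: "('h::chilbert_space \<Rightarrow>\<^sub>L 'h) \<Rightarrow> bool" where
  "self_adjoint T \<longleftrightarrow> is_adjoint T T"

definition projection_op :: "('h::chilbert_space \<Rightarrow>\<^sub>L 'h) \<Rightarrow> bool" where
  "projection_op p \<longleftrightarrow> self_adjoint p \<and> p o\<^sub>L p = p"

text \<open>
  \<open>\<real>\<^sub>\<ge>\<^sub>0\<close> is a set of complex numbers here: the value has to be real and nonnegative.
\<close>

definition positive_op :: "('h::chilbert_space \<Rightarrow>\<^sub>L 'h) \<Rightarrow> bool" where
  "positive_op T \<longleftrightarrow> (\<forall>\<xi>. cinner \<xi> (blinfun_apply T \<xi>) \<in> \<real>\<^sub>\<ge>\<^sub>0)"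

definition op_le :: "('h::chilbert_space \<Rightarrow>\<^sub>L 'h) \<Rightarrow> ('h \<Rightarrow>\<^sub>L 'h) \<Rightarrow> bool"  (infix \<open>\<le>\<^sub>o\<^sub>p\<close> 50) where
  "S \<le>\<^sub>o\<^sub>p T \<longleftrightarrow> positive_op (T - S)"

text \<open>Positivity of the matrix \<open>(T i j)\<close>, \<open>i, j < n\<close>, as an operator on \<open>H\<^sup>n\<close>.\<close>

definition positive_op_matrix ::
    "nat \<Rightarrow> (nat \<Rightarrow> nat \<Rightarrow> 'h::chilbert_space \<Rightarrow>\<^sub>L 'h) \<Rightarrow> bool" where
  "positive_op_matrix n T \<longleftrightarrow>
     (\<forall>\<xi> :: nat \<Rightarrow> 'h.
        (\<Sum>i<n. cinner (\<xi> i) (\<Sum>j<n. blinfun_apply (T i j) (\<xi> j))) \<in> \<real>\<^sub>\<ge>\<^sub>0)"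

section \<open>Von Neumann algebras\<close>

definition commutant :: "('h::chilbert_space \<Rightarrow>\<^sub>L 'h) set \<Rightarrow> ('h \<Rightarrow>\<^sub>L 'h) set" where
  "commutant S = {T \<in> bounded_ops. \<forall>x\<in>S. T o\<^sub>L x = x o\<^sub>L T}"

text \<open>
  A self-adjoint set of operators equal to its bicommutant. Such a set is automatically a
  complex subalgebra containing the identity of \<open>H\<close>, so inclusions are unital.
\<close>

definition von_neumann_algebra :: "('h::chilbert_space \<Rightarrow>\<^sub>L 'h) set \<Rightarrow> bool" where
  "von_neumann_algebra M \<longleftrightarrow>
     M \<subseteq> bounded_ops \<and> (\<forall>x\<in>M. \<exists>y\<in>M. is_adjoint y x) \<and> commutant (commutant M) = M"

text \<open>The zero algebra is not a factor.\<close>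

definition factor :: "('h::chilbert_space \<Rightarrow>\<^sub>L 'h) set \<Rightarrow> bool" where
  "factor N \<longleftrightarrow> von_neumann_algebra N \<and> (id_blinfun :: 'h \<Rightarrow>\<^sub>L 'h) \<noteq> 0 \<and>
     N \<inter> commutant N = range (\<lambda>c. c *\<^sub>C id_blinfun)"

section \<open>Maps between von Neumann algebras\<close>

text \<open>
  Maps are total functions on operators; only their restriction to the domain algebra
  matters.
\<close>

definition linear_map_on ::
    "('h::chilbert_space \<Rightarrow>\<^sub>L 'h) set \<Rightarrow> ('h \<Rightarrow>\<^sub>L 'h) set \<Rightarrow> (('h \<Rightarrow>\<^sub>L 'h) \<Rightarrow> ('h \<Rightarrow>\<^sub>L 'h)) \<Rightarrow> bool" where
  "linear_map_on M K \<Phi> \<longleftrightarrow>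
     (\<forall>x\<in>M. \<Phi> x \<in> K) \<and>
     (\<forall>x\<in>M. \<forall>y\<in>M. \<Phi> (x + y) = \<Phi> x + \<Phi> y) \<and>
     (\<forall>c. \<forall>x\<in>M. \<Phi> (c *\<^sub>C x) = c *\<^sub>C \<Phi> x)"

definition positive_map_on ::
    "('h::chilbert_space \<Rightarrow>\<^sub>L 'h) set \<Rightarrow> (('h \<Rightarrow>\<^sub>L 'h) \<Rightarrow> ('h \<Rightarrow>\<^sub>L 'h)) \<Rightarrow> bool" where
  "positive_map_on M \<Phi> \<longleftrightarrow> (\<forall>x\<in>M. positive_op x \<longrightarrow> positive_op (\<Phi> x))"

definition completely_positive_on ::
    "('h::chilbert_space \<Rightarrow>\<^sub>L 'h) set \<Rightarrow> (('h \<Rightarrow>\<^sub>L 'h) \<Rightarrow> ('h \<Rightarrow>\<^sub>L 'h)) \<Rightarrow> bool" where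
  "completely_positive_on M \<Phi> \<longleftrightarrow>
     (\<forall>n T. (\<forall>i<n. \<forall>j<n. T i j \<in> M) \<longrightarrow> positive_op_matrix n T \<longrightarrow>
            positive_op_matrix n (\<lambda>i j. \<Phi> (T i j)))"

definition is_op_sup ::
    "('h::chilbert_space \<Rightarrow>\<^sub>L 'h) set \<Rightarrow> ('h \<Rightarrow>\<^sub>L 'h) set \<Rightarrow> ('h \<Rightarrow>\<^sub>L 'h) \<Rightarrow> bool" where
  "is_op_sup K D s \<longleftrightarrow>
     s \<in> K \<and> self_adjoint s \<and> (\<forall>d\<in>D. d \<le>\<^sub>o\<^sub>p s) \<and>
     (\<forall>t\<in>K. self_adjoint t \<longrightarrow> (\<forall>d\<in>D. d \<le>\<^sub>o\<^sub>p t) \<longrightarrow> s \<le>\<^sub>o\<^sub>p t)"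

definition directed_ops :: "('h::chilbert_space \<Rightarrow>\<^sub>L 'h) set \<Rightarrow> bool" where
  "directed_ops D \<longleftrightarrow>
     D \<noteq> {} \<and> (\<forall>a\<in>D. \<forall>b\<in>D. \<exists>c\<in>D. a \<le>\<^sub>o\<^sub>p c \<and> b \<le>\<^sub>o\<^sub>p c)"

text \<open>
  Normality of a positive map from \<open>M\<close> to \<open>K\<close>: it preserves suprema of bounded
  upward directed families of self-adjoint elements.
\<close>

definition normal_map_on ::
    "('h::chilbert_space \<Rightarrow>\<^sub>L 'h) set \<Rightarrow> ('h \<Rightarrow>\<^sub>L 'h) set \<Rightarrow> (('h \<Rightarrow>\<^sub>L 'h) \<Rightarrow> ('h \<Rightarrow>\<^sub>L 'h)) \<Rightarrow> bool" where
  "normal_map_on M K \<Phi> \<longleftrightarrow>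
     (\<forall>D s. D \<subseteq> M \<longrightarrow> (\<forall>d\<in>D. self_adjoint d) \<longrightarrow> directed_ops D \<longrightarrow> is_op_sup M D s \<longrightarrow>
            is_op_sup K (\<Phi> ` D) (\<Phi> s))"

definition bimodule_map_on ::
    "('h::chilbert_space \<Rightarrow>\<^sub>L 'h) set \<Rightarrow> ('h \<Rightarrow>\<^sub>L 'h) set \<Rightarrow> (('h \<Rightarrow>\<^sub>L 'h) \<Rightarrow> ('h \<Rightarrow>\<^sub>L 'h)) \<Rightarrow> bool" where
  "bimodule_map_on N M \<Phi> \<longleftrightarrow>
     (\<forall>x\<in>M. \<forall>y1\<in>N. \<forall>y2\<in>N. \<Phi> (y1 o\<^sub>L x o\<^sub>L y2) = y1 o\<^sub>L \<Phi> x o\<^sub>L y2)"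

definition bimodule_quantum_channel ::
    "('h::chilbert_space \<Rightarrow>\<^sub>L 'h) set \<Rightarrow> ('h \<Rightarrow>\<^sub>L 'h) set \<Rightarrow> (('h \<Rightarrow>\<^sub>L 'h) \<Rightarrow> ('h \<Rightarrow>\<^sub>L 'h)) \<Rightarrow> bool" where
  "bimodule_quantum_channel N M \<Phi> \<longleftrightarrow>
     linear_map_on M M \<Phi> \<and> completely_positive_on M \<Phi> \<and> normal_map_on M M \<Phi> \<and>
     \<Phi> id_blinfun = id_blinfun \<and> bimodule_map_on N M \<Phi>"

definition relatively_irreducible ::
    "('h::chilbert_space \<Rightarrow>\<^sub>L 'h) set \<Rightarrow> ('h \<Rightarrow>\<^sub>L 'h) set \<Rightarrow> (('h \<Rightarrow>\<^sub>L 'h) \<Rightarrow> ('h \<Rightarrow>\<^sub>L 'h)) \<Rightarrow> bool" where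
  "relatively_irreducible N M \<Phi> \<longleftrightarrow>
     (\<forall>p\<in>M. projection_op p \<longrightarrow> (\<exists>c>0. \<Phi> p \<le>\<^sub>o\<^sub>p c *\<^sub>R p) \<longrightarrow> p \<in> N)"

definition conditional_expectation ::
    "('h::chilbert_space \<Rightarrow>\<^sub>L 'h) set \<Rightarrow> ('h \<Rightarrow>\<^sub>L 'h) set \<Rightarrow> (('h \<Rightarrow>\<^sub>L 'h) \<Rightarrow> ('h \<Rightarrow>\<^sub>L 'h)) \<Rightarrow> bool" where
  "conditional_expectation M N E \<longleftrightarrow>
     linear_map_on M N E \<and> positive_map_on M E \<and> (\<forall>y\<in>N. E y = y) \<and> bimodule_map_on N M E"

definition finite_index ::
    "('h::chilbert_space \<Rightarrow>\<^sub>L 'h) set \<Rightarrow> ('h \<Rightarrow>\<^sub>L 'h) set \<Rightarrow> bool" where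
  "finite_index N M \<longleftrightarrow>
     (\<exists>E \<delta>. conditional_expectation M N E \<and> normal_map_on M N E \<and> \<delta> > 0 \<and>
        (\<forall>x\<in>M. positive_op x \<longrightarrow> \<delta> *\<^sub>R x \<le>\<^sub>o\<^sub>p E x))"

section \<open>Peripheral eigenvalues\<close>

definition eigenvalue_on ::
    "('h::chilbert_space \<Rightarrow>\<^sub>L 'h) set \<Rightarrow> (('h \<Rightarrow>\<^sub>L 'h) \<Rightarrow> ('h \<Rightarrow>\<^sub>L 'h)) \<Rightarrow> complex \<Rightarrow> bool" where
  "eigenvalue_on M \<Phi> \<alpha> \<longleftrightarrow> (\<exists>x\<in>M. x \<noteq> 0 \<and> \<Phi> x = \<alpha> *\<^sub>C x)"

definition phase_group ::
    "('h::chilbert_space \<Rightarrow>\<^sub>L 'h) set \<Rightarrow> (('h \<Rightarrow>\<^sub>L 'h) \<Rightarrow> ('h \<Rightarrow>\<^sub>L 'h)) \<Rightarrow> complex monoid" where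
  "phase_group M \<Phi> =
     \<lparr>carrier = {\<alpha>. eigenvalue_on M \<Phi> \<alpha> \<and> cmod \<alpha> = 1}, monoid.mult = (*), one = 1\<rparr>"

end

theory Submission
  imports Defs "HOL-Algebra.Multiplicative_Group"
begin

text \<open>
  Let \<open>\<Phi> x = \<alpha> x\<close> with \<open>|\<alpha>| = 1\<close>. By the Schwarz inequality \<open>\<Phi>\<^sup>k (x\<^sup>* x)\<close> increases to some fixed point
  \<open>g\<close>. The support \<open>s\<close> of \<open>g - x\<^sup>* x\<close> satisfies \<open>\<Phi> s \<le> s\<close>, hence lies in \<open>N\<close>, while the domination
  \<open>E \<circ> \<Phi>\<^sup>k \<le> E / \<delta>\<close> forces \<open>s = E (\<Phi>\<^sup>k s)\<close> to vanish. So \<open>\<Phi> (x\<^sup>* x) = x\<^sup>* x\<close>, and \<open>x\<close> belongs to the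
  multiplicative domain of \<open>\<Phi>\<close>. Therefore the eigenspaces \<open>M\<^sub>\<alpha>\<close> multiply like a graded algebra, the fixed
  points form an algebra whose projections, and hence all of whose elements, lie in \<open>N\<close>, and since the
  factor \<open>N\<close> is prime, \<open>M\<^sub>\<alpha> N M\<^sub>\<beta> \<noteq> 0\<close>: the phases form a group.

  Averaging the Pimsner--Popa inequality over the twists by \<open>\<Phi>\<close> gives
  \<open>\<delta> \<parallel>\<Sum> y\<^sub>i v\<parallel>\<^sup>2 \<le> \<Sum> \<parallel>y\<^sub>i v\<parallel>\<^sup>2\<close> for \<open>y\<^sub>i\<close> in eigenspaces of distinct phases. If \<open>N\<close> has no minimal
  projection, one can arrange that all \<open>y\<^sub>i v\<close> coincide, which bounds the number of phases by \<open>1 / \<delta>\<close>. If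
  \<open>q\<close> is a minimal projection, \<open>q M\<^sub>\<alpha> q\<close> contains an isometry \<open>u\<close> of the range of \<open>q\<close>, and counting the
  coefficients of \<open>(\<Sum> u\<^sup>i)\<^sup>2\<close> bounds the order of \<open>\<alpha>\<close>.
\<close>

text \<open>Normality speaks only of suprema of directed families, so an operator passes through
  \<open>\<Phi>\<close> or \<open>E\<close> as the limit of an increasing sequence. This decides the
  form of the functional calculus: supports, absolute values and spectral projections are built from
  monotone limits of polynomials. The role of a faithful state invariant under \<open>\<Phi>\<close>
  is taken by the maps \<open>E \<circ> \<Phi>\<^sup>k\<close>: their domination by
  \<open>E / \<delta>\<close> is uniform in \<open>k\<close>, which permits an exchange of limits.
  The nonatomic argument cuts one projection into arbitrarily many orthogonal pieces, which is
  impossible in a matrix algebra; hence the separate treatment of atoms. There the sum of the first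
  \<open>n\<close> powers of \<open>u\<close> is itself harmless: its mean square over the twists
  grows like \<open>n\<close>, and the inequality allows \<open>n / \<delta>\<close>. Its square has
  n^2 terms spread over fewer than \<open>2 * n\<close> powers, so by Cauchy-Schwarz its mean square
  is at least n^3 / 2, while the inequality used twice allows n^2 / \<delta>^2.\<close>

lemma cnj_mult_unit: "cmod \<alpha> = 1 \<Longrightarrow> cnj \<alpha> * \<alpha> = 1"
  by (metis complex_norm_square mult.commute of_real_1 one_power2)

section \<open>Complex scalars and the complex inner product\<close>

lemma cinner_add_left: "cinner (x + y) z = cinner x z + cinner (y::'a::chilbert_space) z"
  by (metis cinner_add_right cinner_commute complex_cnj_add)

lemma cinner_scaleC_left: "cinner (c *\<^sub>C x) y = cnj c * cinner (x::'a::chilbert_space) y"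
  by (metis cinner_scaleC_right cinner_commute complex_cnj_mult)

lemma Re_cinner: "Re (cinner x y) = inner x (y::'a::chilbert_space)"
  by (simp add: inner_eq_Re_cinner)

lemma Im_cinner: "Im (cinner x y) = - inner x (\<i> *\<^sub>C (y::'a::chilbert_space))"
  by (simp add: inner_eq_Re_cinner cinner_scaleC_right)

text \<open>Up to sign, the imaginary part is the real inner product with
  \<open>\<i> *\<^sub>C y\<close>; complex identities thus reduce to real ones, where the inherited
  real structure applies.\<close>

lemma cinner_eq_iff_inner:
  "cinner x y = cinner z w \<longleftrightarrow> inner x y = inner z w \<and> inner x (\<i> *\<^sub>C y) = inner z (\<i> *\<^sub>C (w::'a::chilbert_space))"
  by (auto simp: complex_eq_iff Re_cinner Im_cinner)

lemma scaleC_one [simp]: "1 *\<^sub>C (x::'a::complex_vector) = x"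
  using scaleR_scaleC[of 1 x] by simp

lemma scaleC_zero_left [simp]: "0 *\<^sub>C (x::'a::complex_vector) = 0"
  using scaleR_scaleC[of 0 x] by simp

lemma scaleC_zero_right [simp]: "c *\<^sub>C (0::'a::complex_vector) = 0"
  using scaleC_scaleC[of c 0 "0::'a"] by simp

lemma scaleC_minus_right [simp]: "c *\<^sub>C (- x) = - (c *\<^sub>C (x::'a::complex_vector))"
  using scaleC_add_right[of c x "-x"] by (simp add: eq_neg_iff_add_eq_0 add.commute)

lemma scaleC_minus_left [simp]: "(- c) *\<^sub>C x = - (c *\<^sub>C (x::'a::complex_vector))"
  using scaleC_add_left[of c "-c" x] by (simp add: eq_neg_iff_add_eq_0 add.commute)

lemma scaleC_diff_right: "c *\<^sub>C (x - y) = c *\<^sub>C x - c *\<^sub>C (y::'a::complex_vector)"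
  using scaleC_add_right[of c x "-y"] by simp

lemma scaleC_sum_right: "c *\<^sub>C (\<Sum>i\<in>A. f i) = (\<Sum>i\<in>A. c *\<^sub>C (f i :: 'a::complex_vector))"
  by (induction A rule: infinite_finite_induct) (simp_all add: scaleC_add_right)

lemma scaleR_scaleC_commute: "r *\<^sub>R c *\<^sub>C (x::'a::complex_vector) = c *\<^sub>C r *\<^sub>R x"
  by (simp add: scaleR_scaleC scaleC_scaleC mult.commute)

lemma scaleC_eq_0_iff: "c *\<^sub>C (x::'a::complex_vector) = 0 \<longleftrightarrow> c = 0 \<or> x = 0"
proof
  assume 0: "c *\<^sub>C x = 0"
  show "c = 0 \<or> x = 0"
  proof (rule disjCI)
    assume "x \<noteq> 0"
    have "inverse c *\<^sub>C c *\<^sub>C x = 0" by (simp add: 0)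
    with \<open>x \<noteq> 0\<close> show "c = 0" by (simp add: scaleC_scaleC) (metis left_inverse scaleC_one)
  qed
qed auto

lemma cinner_sum_right: "cinner v (\<Sum>i\<in>J. f i) = (\<Sum>i\<in>J. cinner (v::'a::chilbert_space) (f i))"
  by (induction J rule: infinite_finite_induct)
     (use cinner_scaleC_right[of v 0 0] in \<open>auto simp: cinner_add_right\<close>)

lemma cinner_sum_left: "cinner (\<Sum>i\<in>J. f i) v = (\<Sum>i\<in>J. cinner (f i) (v::'a::chilbert_space))"
  by (subst cinner_commute, simp add: cinner_sum_right) (intro sum.cong refl, rule cinner_commute[symmetric])

lemma cinner_self: "cinner x x = complex_of_real ((norm (x::'a::chilbert_space))\<^sup>2)"
proof (rule complex_eqI)
  show "Re (cinner x x) = Re (complex_of_real ((norm x)\<^sup>2))"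
    by (simp add: Re_cinner power2_norm_eq_inner)
  show "Im (cinner x x) = Im (complex_of_real ((norm x)\<^sup>2))"
    by (metis Im_complex_of_real cinner_commute complex_cnj_cancel_iff cnj.simps(2) eq_neg_iff_add_eq_0 add_self_div_2 div_0 mult_2 mult_zero_right neg_equal_zero)
qed

lemma inner_i_swap: "inner (\<i> *\<^sub>C x) y = - inner x (\<i> *\<^sub>C (y::'a::chilbert_space))"
  by (simp add: inner_eq_Re_cinner cinner_scaleC_left cinner_scaleC_right)

lemmas op_apply = scaleC_blinfun.rep_eq blinfun.add_left blinfun.diff_left blinfun.minus_left
  blinfun.scaleR_left blinfun.zero_left blinfun_compose.rep_eq id_blinfun.rep_eq blinfun.sum_left

lemmas op_linear = blinfun.add_right blinfun.diff_right blinfun.minus_right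
  blinfun.scaleR_right blinfun.zero_right blinfun.sum_right

lemma op_scaleC: "T \<in> bounded_ops \<Longrightarrow> blinfun_apply T (c *\<^sub>C v) = c *\<^sub>C blinfun_apply T v"
  by (simp add: bounded_ops_def)

section \<open>Adjoints\<close>

lemma is_adjoint_sym: "is_adjoint S T \<Longrightarrow> is_adjoint T S"
  unfolding is_adjoint_def by (metis cinner_commute)

lemma is_adjoint_inner: "is_adjoint S T \<Longrightarrow> inner (blinfun_apply S v) w = inner v (blinfun_apply T w)"
  by (simp add: is_adjoint_def inner_eq_Re_cinner)

lemma is_adjoint_iff_inner:
  assumes "T \<in> bounded_ops"
  shows "is_adjoint S T \<longleftrightarrow> (\<forall>v w. inner (blinfun_apply S v) w = inner v (blinfun_apply T w))"
  unfolding is_adjoint_def cinner_eq_iff_inner using assms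
  by (metis op_scaleC)

lemma is_adjoint_unique:
  assumes "is_adjoint S T" "is_adjoint S' T"
  shows "S = S'"
proof (rule blinfun_eqI)
  fix v
  have "inner (blinfun_apply S v - blinfun_apply S' v) w = 0" for w
    using is_adjoint_inner[OF assms(1)] is_adjoint_inner[OF assms(2)] by (simp add: inner_diff_left)
  from this[of "blinfun_apply S v - blinfun_apply S' v"]
  show "blinfun_apply S v = blinfun_apply S' v" by simp
qed

text \<open>Adjoints are unique, and members of a von Neumann algebra have one by definition; where
  no adjoint exists the value is unspecified.\<close>

definition adj :: "('h::chilbert_space \<Rightarrow>\<^sub>L 'h) \<Rightarrow> ('h \<Rightarrow>\<^sub>L 'h)" where
  "adj T = (THE S. is_adjoint S T)"

lemma adj_eqI: "is_adjoint S T \<Longrightarrow> adj T = S"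
  unfolding adj_def using is_adjoint_unique by blast

lemma bounded_ops_adjoint:
  assumes "is_adjoint S T"
  shows "T \<in> bounded_ops"
proof -
  have "blinfun_apply T (c *\<^sub>C v) = c *\<^sub>C blinfun_apply T v" for c v
  proof -
    have "cinner w (blinfun_apply T (c *\<^sub>C v)) = cinner w (c *\<^sub>C blinfun_apply T v)" for w
      using assms unfolding is_adjoint_def by (metis cinner_scaleC_right)
    then have "inner w (blinfun_apply T (c *\<^sub>C v)) = inner w (c *\<^sub>C blinfun_apply T v)" for w
      by (simp add: inner_eq_Re_cinner)
    then have "inner w (blinfun_apply T (c *\<^sub>C v) - c *\<^sub>C blinfun_apply T v) = 0" for w
      by (simp add: inner_diff_right)
    from this[of "blinfun_apply T (c *\<^sub>C v) - c *\<^sub>C blinfun_apply T v"] show ?thesis by simp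
  qed
  then show ?thesis by (simp add: bounded_ops_def)
qed

lemma blinfun_assoc: "(S o\<^sub>L T) o\<^sub>L U = S o\<^sub>L (T o\<^sub>L U)"
  by (rule blinfun_eqI) (simp add: op_apply)

lemma is_adjoint_comp: "is_adjoint S T \<Longrightarrow> is_adjoint S' T' \<Longrightarrow> is_adjoint (S' o\<^sub>L S) (T o\<^sub>L T')"
  by (simp add: is_adjoint_def op_apply)

lemma is_adjoint_scaleC: "is_adjoint S T \<Longrightarrow> is_adjoint (cnj c *\<^sub>C S) (c *\<^sub>C T)"
  by (simp add: is_adjoint_def op_apply cinner_scaleC_left cinner_scaleC_right)

lemma is_adjoint_add: "is_adjoint S T \<Longrightarrow> is_adjoint S' T' \<Longrightarrow> is_adjoint (S + S') (T + T')"
  by (simp add: is_adjoint_def op_apply cinner_add_left cinner_add_right)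

lemma is_adjoint_zero: "is_adjoint 0 0"
  by (simp add: is_adjoint_iff_inner bounded_ops_def op_apply)

section \<open>Self-adjoint and positive operators\<close>

lemma sa_bounded: "self_adjoint T \<Longrightarrow> T \<in> bounded_ops"
  unfolding self_adjoint_def by (rule bounded_ops_adjoint)

lemma sa_adj: "self_adjoint T \<Longrightarrow> adj T = T"
  unfolding self_adjoint_def by (rule adj_eqI)

lemma sa_iff_inner:
  assumes "T \<in> bounded_ops"
  shows "self_adjoint T \<longleftrightarrow> (\<forall>v w. inner (blinfun_apply T v) w = inner v (blinfun_apply T w))"
  unfolding self_adjoint_def by (rule is_adjoint_iff_inner[OF assms])

lemma sa_inner: "self_adjoint T \<Longrightarrow> inner (blinfun_apply T v) w = inner v (blinfun_apply T w)"
  unfolding self_adjoint_def by (rule is_adjoint_inner)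

lemma sa_id [simp]: "self_adjoint id_blinfun"
  by (simp add: self_adjoint_def is_adjoint_def op_apply)

lemma sa_zero [simp]: "self_adjoint 0"
  by (simp add: self_adjoint_def is_adjoint_zero)

lemma sa_add: "self_adjoint S \<Longrightarrow> self_adjoint T \<Longrightarrow> self_adjoint (S + T)"
  unfolding self_adjoint_def by (rule is_adjoint_add)

lemma sa_scaleR: "self_adjoint T \<Longrightarrow> self_adjoint (r *\<^sub>R T)"
  unfolding self_adjoint_def scaleR_scaleC using is_adjoint_scaleC[of T T "complex_of_real r"] by simp

lemma sa_uminus: "self_adjoint T \<Longrightarrow> self_adjoint (- T)"
  using sa_scaleR[of T "-1"] by simp

lemma sa_diff: "self_adjoint S \<Longrightarrow> self_adjoint T \<Longrightarrow> self_adjoint (S - T)"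
  using sa_add[of S "-T"] sa_uminus[of T] by simp

lemma sa_comp: "self_adjoint S \<Longrightarrow> self_adjoint T \<Longrightarrow> S o\<^sub>L T = T o\<^sub>L S \<Longrightarrow> self_adjoint (S o\<^sub>L T)"
  unfolding self_adjoint_def using is_adjoint_comp[of S S T T] by simp

lemma sa_adj_comp: "is_adjoint S T \<Longrightarrow> self_adjoint (S o\<^sub>L T)"
  unfolding self_adjoint_def using is_adjoint_comp[of S T] is_adjoint_sym[of S T] is_adjoint_comp by blast

text \<open>Polarization: the form of the difference vanishes at \<open>v + w\<close>, and
  self-adjointness makes the two cross terms equal.\<close>

lemma sa_eqI:
  assumes "self_adjoint S" "self_adjoint T"
    and "\<And>v. inner v (blinfun_apply S v) = inner v (blinfun_apply T v)"
  shows "S = T"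
proof (rule blinfun_eqI)
  define D where "D = S - T"
  have D: "self_adjoint D" unfolding D_def using assms sa_diff by blast
  have 0: "inner v (blinfun_apply D v) = 0" for v
    using assms(3)[of v] by (simp add: D_def op_apply inner_diff_right)
  have "inner v (blinfun_apply D w) = 0" for v w
    using 0[of "v + w"] 0[of v] 0[of w] sa_inner[OF D, of w v]
    by (simp add: op_linear inner_add_left inner_add_right inner_commute)
  then have "blinfun_apply D w = 0" for w by (metis inner_eq_zero_iff)
  then show "blinfun_apply S w = blinfun_apply T w" for w by (simp add: D_def op_apply)
qed

lemma positive_op_inner: "positive_op T \<Longrightarrow> 0 \<le> inner v (blinfun_apply T v)"
  unfolding positive_op_def by (simp add: inner_eq_Re_cinner complex_nonneg_Reals_iff)

text \<open>A complex quadratic form with real values is Hermitian: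
  \<open>inner v (\<i> *\<^sub>C T v)\<close> vanishes identically, and polarizing it at
  \<open>v\<close> and \<open>\<i> *\<^sub>C w\<close> gives the symmetry of
  \<open>T\<close>.\<close>

lemma positive_op_sa:
  assumes "positive_op T" "T \<in> bounded_ops"
  shows "self_adjoint T"
proof -
  have i: "inner v (\<i> *\<^sub>C blinfun_apply T v) = 0" for v
    using assms(1) Im_cinner[of v "blinfun_apply T v"] unfolding positive_op_def
    by (simp add: complex_nonneg_Reals_iff)
  have "inner (blinfun_apply T v) w = inner v (blinfun_apply T w)" for v w
  proof -
    let ?w = "\<i> *\<^sub>C w"
    have a: "\<i> *\<^sub>C \<i> *\<^sub>C x = - x" for x :: 'a by (simp add: scaleC_scaleC)
    have b: "inner (\<i> *\<^sub>C x) (\<i> *\<^sub>C y) = inner x y" for x y :: 'a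
      by (simp add: inner_i_swap a)
    from i[of "v + ?w"] i[of v] i[of ?w]
    have "inner v (\<i> *\<^sub>C blinfun_apply T ?w) + inner ?w (\<i> *\<^sub>C blinfun_apply T v) = 0"
      by (simp add: op_linear scaleC_add_right inner_add_left inner_add_right)
    then show ?thesis
      by (simp add: op_scaleC[OF assms(2)] a b inner_commute)
  qed
  then show ?thesis using sa_iff_inner[OF assms(2)] by blast
qed

lemma positive_op_iff:
  assumes "self_adjoint T"
  shows "positive_op T \<longleftrightarrow> (\<forall>v. 0 \<le> inner v (blinfun_apply T v))"
proof -
  have "Im (cinner v (blinfun_apply T v)) = 0" for v
  proof -
    have "cinner v (blinfun_apply T v) = cnj (cinner v (blinfun_apply T v))"
      using assms unfolding self_adjoint_def is_adjoint_def by (metis cinner_commute)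
    then show ?thesis by (metis Reals_cnj_iff complex_is_Real_iff)
  qed
  then show ?thesis unfolding positive_op_def
    by (simp add: complex_nonneg_Reals_iff Re_cinner)
qed

lemma op_le_iff:
  assumes "self_adjoint S" "self_adjoint T"
  shows "S \<le>\<^sub>o\<^sub>p T \<longleftrightarrow> (\<forall>v. inner v (blinfun_apply S v) \<le> inner v (blinfun_apply T v))"
  unfolding op_le_def using positive_op_iff[OF sa_diff[OF assms(2,1)]]
  by (simp add: op_apply inner_diff_right)

lemma op_le_inner: "S \<le>\<^sub>o\<^sub>p T \<Longrightarrow> inner v (blinfun_apply S v) \<le> inner v (blinfun_apply T v)"
  unfolding op_le_def using positive_op_inner[of "T - S" v] by (simp add: op_apply inner_diff_right)

lemma op_le_antisym:
  assumes "self_adjoint S" "self_adjoint T" "S \<le>\<^sub>o\<^sub>p T" "T \<le>\<^sub>o\<^sub>p S"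
  shows "S = T"
  using sa_eqI[OF assms(1,2)] op_le_inner assms(3,4) by (meson order_antisym)

lemma inner_le_norm: "inner v (blinfun_apply T v) \<le> norm T * (norm v)\<^sup>2"
proof -
  have "inner v (blinfun_apply T v) \<le> norm v * norm (blinfun_apply T v)"
    using Cauchy_Schwarz_ineq2[of v "blinfun_apply T v"] by linarith
  also have "\<dots> \<le> norm v * (norm T * norm v)"
    by (intro mult_left_mono norm_blinfun) auto
  finally show ?thesis by (simp add: power2_eq_square mult_ac)
qed

text \<open>This is D^2 \<le> C D for 0 \<le> D \<le> C, obtained from positivity at the vector
  \<open>C *\<^sub>R v - D v\<close>. It turns convergence of quadratic forms into convergence of
  vectors.\<close>

lemma positive_op_norm_sq_le:
  assumes D: "self_adjoint D" and pos: "\<And>v. 0 \<le> inner v (blinfun_apply D v)"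
    and le: "\<And>v. inner v (blinfun_apply D v) \<le> C * (norm v)\<^sup>2" and C: "C > 0"
  shows "(norm (blinfun_apply D v))\<^sup>2 \<le> C * inner v (blinfun_apply D v)"
proof -
  let ?D = "blinfun_apply D"
  have 1: "inner (?D v) (?D (?D v)) \<le> C * inner (?D v) (?D v)"
    using le[of "?D v"] by (simp add: power2_norm_eq_inner)
  have "0 \<le> inner (C *\<^sub>R v - ?D v) (?D (C *\<^sub>R v - ?D v))" by (rule pos)
  also have "\<dots> = C * C * inner v (?D v) - 2 * C * inner (?D v) (?D v) + inner (?D v) (?D (?D v))"
    using sa_inner[OF D, of v "?D v"]
    by (simp add: op_linear inner_diff_left inner_diff_right algebra_simps inner_commute)
  finally have "C * inner (?D v) (?D v) \<le> C * (C * inner v (?D v))" using 1 by simp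
  then show ?thesis using C by (simp add: power2_norm_eq_inner)
qed

lemma positive_op_inner_zero:
  assumes D: "self_adjoint D" and pos: "\<And>v. 0 \<le> inner v (blinfun_apply D v)"
    and 0: "inner v (blinfun_apply D v) = 0"
  shows "blinfun_apply D v = 0"
proof -
  have "inner w (blinfun_apply D w) \<le> (norm D + 1) * (norm w)\<^sup>2" for w
    using inner_le_norm[of w D] by (simp add: distrib_right add_increasing2)
  from positive_op_norm_sq_le[OF D pos this, of v] 0 show ?thesis
    by (simp add: add_nonneg_pos)
qed

text \<open>The shift \<open>T = D + C\<close> lies between 0 and 2 C, so T^2 \<le> 2 C T, which
  rearranges to D^2 \<le> C^2.\<close>

lemma sa_norm_le:
  assumes D: "self_adjoint D" and lo: "\<And>v. - C * (norm v)\<^sup>2 \<le> inner v (blinfun_apply D v)"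
    and le: "\<And>v. inner v (blinfun_apply D v) \<le> C * (norm v)\<^sup>2" and C: "C > 0"
  shows "norm (blinfun_apply D v) \<le> C * norm v"
proof -
  define T where "T = D + C *\<^sub>R id_blinfun"
  let ?D = "blinfun_apply D"
  have T: "self_adjoint T" unfolding T_def by (intro sa_add sa_scaleR D sa_id)
  have Tv: "blinfun_apply T v = ?D v + C *\<^sub>R v" for v by (simp add: T_def op_apply)
  have Tq: "inner v (blinfun_apply T v) = inner v (?D v) + C * (norm v)\<^sup>2" for v
    by (simp add: Tv inner_add_right power2_norm_eq_inner)
  have "0 \<le> inner v (blinfun_apply T v)" "inner v (blinfun_apply T v) \<le> 2 * C * (norm v)\<^sup>2" for v
    unfolding Tq using lo[of v] le[of v] by (auto simp: algebra_simps)
  then have "(norm (blinfun_apply T v))\<^sup>2 \<le> (2 * C) * inner v (blinfun_apply T v)"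
    using positive_op_norm_sq_le[OF T] C by auto
  then have "inner (?D v) (?D v) \<le> C * C * inner v v"
    by (simp add: Tv power2_norm_eq_inner inner_add_left inner_add_right inner_commute algebra_simps)
  then have "(norm (?D v))\<^sup>2 \<le> (C * norm v)\<^sup>2"
    by (simp add: power2_norm_eq_inner power_mult_distrib) (simp add: power2_eq_square)
  then show ?thesis using C by (simp add: power2_le_iff_abs_le abs_mult)
qed

section \<open>Strong limits\<close>

definition strong_lim :: "(nat \<Rightarrow> 'a::real_normed_vector \<Rightarrow>\<^sub>L 'b::real_normed_vector) \<Rightarrow> ('a \<Rightarrow>\<^sub>L 'b) \<Rightarrow> bool" where
  "strong_lim T S \<longleftrightarrow> (\<forall>v. (\<lambda>n. blinfun_apply (T n) v) \<longlonglongrightarrow> blinfun_apply S v)"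

lemma strong_limD: "strong_lim T S \<Longrightarrow> (\<lambda>n. blinfun_apply (T n) v) \<longlonglongrightarrow> blinfun_apply S v"
  by (simp add: strong_lim_def)

lemma strong_lim_inner:
  "strong_lim T S \<Longrightarrow> (\<lambda>n. inner v (blinfun_apply (T n) w)) \<longlonglongrightarrow> inner v (blinfun_apply S w)"
  by (intro tendsto_intros strong_limD)

lemma strong_lim_diff: "strong_lim T S \<Longrightarrow> strong_lim T' S' \<Longrightarrow> strong_lim (\<lambda>n. T n - T' n) (S - S')"
  by (simp add: strong_lim_def op_apply tendsto_diff)

lemma strong_lim_const: "strong_lim (\<lambda>_. S) S"
  by (simp add: strong_lim_def)

lemma strong_lim_unique: "strong_lim T S \<Longrightarrow> strong_lim T S' \<Longrightarrow> S = S'"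
  by (rule blinfun_eqI) (meson strong_lim_def LIMSEQ_unique)

text \<open>The common bound \<open>C\<close> on the left factors makes \<open>S n\<close> applied
  to the vanishing error of \<open>T n\<close> vanish as well.\<close>

lemma strong_lim_comp:
  assumes "strong_lim S S'" "strong_lim T T'"
    and bd: "\<And>n v. norm (blinfun_apply (S n) v) \<le> C * norm v"
  shows "strong_lim (\<lambda>n. S n o\<^sub>L T n) (S' o\<^sub>L T')"
  unfolding strong_lim_def
proof
  fix v
  have 1: "(\<lambda>n. blinfun_apply (S n) (blinfun_apply T' v)) \<longlonglongrightarrow> blinfun_apply S' (blinfun_apply T' v)"
    by (rule strong_limD[OF assms(1)])
  have 2: "(\<lambda>n. C * norm (blinfun_apply (T n) v - blinfun_apply T' v)) \<longlonglongrightarrow> 0"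
    using strong_limD[OF assms(2), of v]
    by (intro tendsto_mult_right_zero tendsto_norm_zero) (simp add: LIM_zero)
  have "(\<lambda>n. blinfun_apply (S n) (blinfun_apply (T n) v - blinfun_apply T' v)) \<longlonglongrightarrow> 0"
    by (rule Lim_null_comparison[OF always_eventually 2]) (use bd in blast)
  from tendsto_add[OF this 1]
  show "(\<lambda>n. blinfun_apply (S n o\<^sub>L T n) v) \<longlonglongrightarrow> blinfun_apply (S' o\<^sub>L T') v"
    by (simp add: op_apply op_linear)
qed

lemma strong_lim_sa:
  assumes "strong_lim T S" "\<And>n. self_adjoint (T n)"
  shows "self_adjoint S"
proof -
  have "blinfun_apply S (c *\<^sub>C v) = c *\<^sub>C blinfun_apply S v" for c v
  proof (rule LIMSEQ_unique[OF strong_limD[OF assms(1)]])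
    have "(\<lambda>n. c *\<^sub>C blinfun_apply (T n) v) \<longlonglongrightarrow> c *\<^sub>C blinfun_apply S v"
      by (rule bounded_linear.tendsto[OF bounded_linear_scaleC strong_limD[OF assms(1)]])
    then show "(\<lambda>n. blinfun_apply (T n) (c *\<^sub>C v)) \<longlonglongrightarrow> c *\<^sub>C blinfun_apply S v"
      by (simp add: op_scaleC[OF sa_bounded[OF assms(2)]])
  qed
  then have S: "S \<in> bounded_ops" by (simp add: bounded_ops_def)
  show ?thesis unfolding sa_iff_inner[OF S]
  proof (intro allI)
    fix v w
    have "(\<lambda>n. inner w (blinfun_apply (T n) v)) \<longlonglongrightarrow> inner w (blinfun_apply S v)"
      by (rule strong_lim_inner[OF assms(1)])
    moreover have "(\<lambda>n. inner v (blinfun_apply (T n) w)) \<longlonglongrightarrow> inner v (blinfun_apply S w)"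
      by (rule strong_lim_inner[OF assms(1)])
    ultimately show "inner (blinfun_apply S v) w = inner v (blinfun_apply S w)"
      using sa_inner[OF assms(2)] LIMSEQ_unique by (metis (no_types, lifting) inner_commute ext)
  qed
qed

definition sa_incseq :: "(nat \<Rightarrow> 'h::chilbert_space \<Rightarrow>\<^sub>L 'h) \<Rightarrow> bool" where
  "sa_incseq T \<longleftrightarrow> (\<forall>n. self_adjoint (T n)) \<and> (\<forall>v. incseq (\<lambda>n. inner v (blinfun_apply (T n) v)))"

lemma sa_incseqI:
  "(\<And>n. self_adjoint (T n)) \<Longrightarrow>
   (\<And>n v. inner v (blinfun_apply (T n) v) \<le> inner v (blinfun_apply (T (Suc n)) v)) \<Longrightarrow> sa_incseq T"
  by (simp add: sa_incseq_def incseq_Suc_iff)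

lemma sa_incseq_le_lim:
  "sa_incseq T \<Longrightarrow> strong_lim T S \<Longrightarrow> inner v (blinfun_apply (T n) v) \<le> inner v (blinfun_apply S v)"
  unfolding sa_incseq_def using incseq_le[OF _ strong_lim_inner] by blast

lemma strong_lim_le:
  "strong_lim T S \<Longrightarrow> (\<And>n. inner v (blinfun_apply (T n) v) \<le> c) \<Longrightarrow> inner v (blinfun_apply S v) \<le> c"
  using LIMSEQ_le_const2[OF strong_lim_inner] by blast

text \<open>The forms are monotone and bounded, hence Cauchy; the squared norm of
  \<open>T n v - T m v\<close> is at most \<open>C\<close> times the increment of the form, so the
  vectors are Cauchy too.\<close>

lemma sa_incseq_convergent:
  assumes T: "sa_incseq T" and le: "\<And>n v. inner v (blinfun_apply (T n) v) \<le> c * (norm v)\<^sup>2"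
  obtains S where "strong_lim T S"
proof -
  let ?T = "\<lambda>n. blinfun_apply (T n)"
  have sa: "self_adjoint (T n)" for n using T by (simp add: sa_incseq_def)
  have inc: "m \<le> n \<Longrightarrow> inner v (?T m v) \<le> inner v (?T n v)" for m n v
    using T by (simp add: sa_incseq_def incseq_def)
  \<comment> \<open>Dominates every difference \<open>T n - T m\<close> with m \<le> n:
    \<open>c\<close> bounds \<open>T n\<close> from above, \<open>T 0\<close> bounds
    \<open>T m\<close> from below, and the 1 makes the constant positive.\<close>
  define C where "C = \<bar>c\<bar> + norm (T 0) + 1"
  have C: "C > 0" by (simp add: C_def add_nonneg_pos)
  have bd: "(norm (?T n v - ?T m v))\<^sup>2 \<le> C * (inner v (?T n v) - inner v (?T m v))" if "m \<le> n" for m n v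
  proof -
    have D: "self_adjoint (T n - T m)" using sa sa_diff by blast
    have "inner v (blinfun_apply (T n - T m) v) \<le> C * (norm v)\<^sup>2" for v
    proof -
      have "inner v (?T n v) \<le> c * (norm v)\<^sup>2" by (rule le)
      also have "\<dots> \<le> \<bar>c\<bar> * (norm v)\<^sup>2" by (simp add: mult_right_mono)
      finally have 1: "inner v (?T n v) \<le> \<bar>c\<bar> * (norm v)\<^sup>2" .
      have "- inner v (?T 0 v) \<le> norm (T 0) * (norm v)\<^sup>2"
        using inner_le_norm[of v "- T 0"] by (simp add: op_apply)
      then have 2: "- inner v (?T m v) \<le> norm (T 0) * (norm v)\<^sup>2" using inc[of 0 m v] by simp
      have "inner v (blinfun_apply (T n - T m) v) = inner v (?T n v) - inner v (?T m v)"
        by (simp add: op_apply inner_diff_right)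
      also have "\<dots> \<le> \<bar>c\<bar> * (norm v)\<^sup>2 + norm (T 0) * (norm v)\<^sup>2 + 1 * (norm v)\<^sup>2"
        using 1 2 by (simp add: add_increasing2)
      finally show ?thesis by (simp add: C_def distrib_right)
    qed
    moreover have "0 \<le> inner v (blinfun_apply (T n - T m) v)" for v
      using inc[OF that, of v] by (simp add: op_apply inner_diff_right)
    ultimately show ?thesis using positive_op_norm_sq_le[OF D _ _ C, of v]
      by (simp add: op_apply inner_diff_right)
  qed
  have "Cauchy (\<lambda>n. ?T n v)" for v
  proof (rule CauchyI')
    fix e :: real assume e: "0 < e"
    have "Bseq (\<lambda>n. inner v (?T n v))"
      using inc le by (intro decseq_bounded incseq_bounded[where B="c * (norm v)\<^sup>2"]) (auto simp: incseq_def)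
    then have "Cauchy (\<lambda>n. inner v (?T n v))"
      using inc by (intro convergent_Cauchy Bseq_mono_convergent) auto
    then obtain M where M: "\<And>m n. m \<ge> M \<Longrightarrow> n \<ge> M \<Longrightarrow> norm (inner v (?T m v) - inner v (?T n v)) < e\<^sup>2 / C"
      using CauchyD[of _ "e\<^sup>2 / C"] e C by (metis divide_pos_pos zero_less_power)
    show "\<exists>M. \<forall>m\<ge>M. \<forall>n>m. dist (?T m v) (?T n v) < e"
    proof (intro exI allI impI)
      fix m n assume mn: "M \<le> m" "m < n"
      have "inner v (?T n v) - inner v (?T m v) < e\<^sup>2 / C" using M[of n m] mn by auto
      then have "C * (inner v (?T n v) - inner v (?T m v)) < e\<^sup>2" using C by (simp add: field_simps)
      then have "(norm (?T n v - ?T m v))\<^sup>2 < e\<^sup>2" using bd[of m n v] mn by simp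
      then show "dist (?T m v) (?T n v) < e" using e
        by (simp add: dist_norm norm_minus_commute power2_less_imp_less)
    qed
  qed
  then have conv: "convergent (\<lambda>n. ?T n v)" for v by (simp add: Cauchy_convergent_iff)
  define f where "f v = lim (\<lambda>n. ?T n v)" for v
  have lim: "(\<lambda>n. ?T n v) \<longlonglongrightarrow> f v" for v
    unfolding f_def using conv convergent_LIMSEQ_iff by blast
  have nb: "norm (?T n v) \<le> (norm (T 0) + C) * norm v" for n v
  proof -
    have "(norm (?T n v - ?T 0 v))\<^sup>2 \<le> C * (C * (norm v)\<^sup>2)"
    proof -
      have "inner v (?T n v) - inner v (?T 0 v) \<le> C * (norm v)\<^sup>2"
        using le[of v n] inner_le_norm[of v "- T 0"] mult_right_mono[OF abs_ge_self[of c], of "(norm v)\<^sup>2"]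
        by (simp add: C_def op_apply distrib_right add_increasing2)
      with bd[of 0 n v] C show ?thesis by (meson le0 less_imp_le mult_left_mono order_trans)
    qed
    then have "(norm (?T n v - ?T 0 v))\<^sup>2 \<le> (C * norm v)\<^sup>2" by (simp add: power2_eq_square mult_ac)
    then have "norm (?T n v - ?T 0 v) \<le> C * norm v" using C by (simp add: power2_le_iff_abs_le abs_mult)
    moreover have "norm (?T 0 v) \<le> norm (T 0) * norm v" by (rule norm_blinfun)
    moreover have "norm (?T n v) \<le> norm (?T 0 v) + norm (?T n v - ?T 0 v)"
      using norm_triangle_sub by blast
    ultimately show ?thesis by (simp add: distrib_right)
  qed
  have "bounded_linear f"
  proof (rule bounded_linear_intro)
    show "f (x + y) = f x + f y" for x y
      using tendsto_add[OF lim[of x] lim[of y]] lim[of "x + y"] LIMSEQ_unique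
      by (simp add: op_linear) blast
    show "f (r *\<^sub>R x) = r *\<^sub>R f x" for r x
      using tendsto_scaleR[OF tendsto_const lim[of x], of r] lim[of "r *\<^sub>R x"] LIMSEQ_unique
      by (simp add: op_linear) blast
    show "norm (f x) \<le> norm x * (norm (T 0) + C)" for x
      by (rule LIMSEQ_le_const2[OF tendsto_norm[OF lim]]) (use nb in \<open>auto simp: mult.commute\<close>)
  qed
  then have "strong_lim T (Blinfun f)"
    by (simp add: strong_lim_def bounded_linear_Blinfun_apply lim)
  then show ?thesis by (rule that)
qed

section \<open>Commutants\<close>

lemma commutantD: "T \<in> commutant S \<Longrightarrow> x \<in> S \<Longrightarrow> blinfun_apply T (blinfun_apply x v) = blinfun_apply x (blinfun_apply T v)"
  by (auto simp: commutant_def dest!: bspec arg_cong[of _ _ "\<lambda>f. blinfun_apply f v"])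

lemma commutantI:
  assumes "T \<in> bounded_ops"
    and "\<And>x v. x \<in> S \<Longrightarrow> blinfun_apply T (blinfun_apply x v) = blinfun_apply x (blinfun_apply T v)"
  shows "T \<in> commutant S"
  using assms by (auto simp: commutant_def intro!: blinfun_eqI)

lemma commutant_bounded: "T \<in> commutant S \<Longrightarrow> T \<in> bounded_ops"
  by (simp add: commutant_def)

lemma bounded_opsI: "(\<And>c v. blinfun_apply T (c *\<^sub>C v) = c *\<^sub>C blinfun_apply T v) \<Longrightarrow> T \<in> bounded_ops"
  by (simp add: bounded_ops_def)

lemma bounded_id: "id_blinfun \<in> bounded_ops"
  and bounded_add: "S \<in> bounded_ops \<Longrightarrow> T \<in> bounded_ops \<Longrightarrow> S + T \<in> bounded_ops"
  and bounded_scaleC: "T \<in> bounded_ops \<Longrightarrow> c *\<^sub>C T \<in> bounded_ops"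
  and bounded_comp: "S \<in> bounded_ops \<Longrightarrow> T \<in> bounded_ops \<Longrightarrow> S o\<^sub>L T \<in> bounded_ops"
  by (rule bounded_opsI; simp add: op_apply op_scaleC scaleC_add_right scaleC_scaleC mult.commute)+

lemma comp_scaleC: "S \<in> bounded_ops \<Longrightarrow> S o\<^sub>L (c *\<^sub>C T) = c *\<^sub>C (S o\<^sub>L T)"
  by (auto intro!: blinfun_eqI simp: op_apply op_scaleC)

lemma scaleC_comp: "(c *\<^sub>C S) o\<^sub>L T = c *\<^sub>C (S o\<^sub>L T)"
  by (auto intro!: blinfun_eqI simp: op_apply)

section \<open>Algebras closed under monotone limits\<close>

text \<open>
  Besides von Neumann algebras, this covers the fixed points of a channel once they are known
  to be closed under products.
\<close>

locale monotone_algebra =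
  fixes W :: "('h::chilbert_space \<Rightarrow>\<^sub>L 'h) set"
  assumes id_closed: "id_blinfun \<in> W"
    and bounded: "x \<in> W \<Longrightarrow> x \<in> bounded_ops"
    and add_closed: "x \<in> W \<Longrightarrow> y \<in> W \<Longrightarrow> x + y \<in> W"
    and scaleR_closed: "x \<in> W \<Longrightarrow> r *\<^sub>R x \<in> W"
    and comp_closed: "x \<in> W \<Longrightarrow> y \<in> W \<Longrightarrow> x o\<^sub>L y \<in> W"
    and monotone_lim_closed: "sa_incseq T \<Longrightarrow> (\<And>n. T n \<in> W) \<Longrightarrow> strong_lim T x \<Longrightarrow> x \<in> W"
begin

lemma uminus_closed: "x \<in> W \<Longrightarrow> - x \<in> W"
  using scaleR_closed[of x "-1"] by simp

lemma diff_closed: "x \<in> W \<Longrightarrow> y \<in> W \<Longrightarrow> x - y \<in> W"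
  using add_closed[of x "-y"] uminus_closed[of y] by simp

lemma zero_closed: "0 \<in> W"
  using scaleR_closed[OF id_closed, of 0] by simp

end

lemma monotone_algebra_commutant: "monotone_algebra (commutant S)"
proof
  show "id_blinfun \<in> commutant S"
    by (rule commutantI) (auto simp: bounded_id op_apply)
next
  fix x y assume "x \<in> commutant S" "y \<in> commutant S"
  then show "x + y \<in> commutant S" "x o\<^sub>L y \<in> commutant S"
    by (auto intro!: commutantI bounded_add bounded_comp simp: commutant_bounded op_apply op_linear commutantD)
next
  fix x r assume x: "x \<in> commutant S"
  have "complex_of_real r *\<^sub>C x \<in> bounded_ops" using x bounded_scaleC commutant_bounded by blast
  then have "r *\<^sub>R x \<in> bounded_ops" by (simp add: scaleR_scaleC)
  then show "r *\<^sub>R x \<in> commutant S" using x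
    by (auto intro!: commutantI simp: op_apply op_linear commutantD)
next
  fix T x assume T: "sa_incseq T" "\<And>n. T n \<in> commutant S" "strong_lim T x"
  have "x \<in> bounded_ops" using T strong_lim_sa sa_bounded unfolding sa_incseq_def by blast
  moreover have "blinfun_apply x (blinfun_apply y v) = blinfun_apply y (blinfun_apply x v)" if "y \<in> S" for y v
  proof (rule LIMSEQ_unique[OF strong_limD[OF T(3)]])
    show "(\<lambda>n. blinfun_apply (T n) (blinfun_apply y v)) \<longlonglongrightarrow> blinfun_apply y (blinfun_apply x v)"
      unfolding commutantD[OF T(2) that]
      by (intro bounded_linear.tendsto[OF blinfun.bounded_linear_right] strong_limD T)
  qed
  ultimately show "x \<in> commutant S" by (auto intro: commutantI)
qed (rule commutant_bounded)

lemma commutant_scaleC: "x \<in> commutant S \<Longrightarrow> S \<subseteq> bounded_ops \<Longrightarrow> c *\<^sub>C x \<in> commutant S"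
  by (rule commutantI) (auto simp: bounded_scaleC commutant_bounded op_apply commutantD, metis op_scaleC subsetD)

lemma monotone_algebra_Int:
  assumes "monotone_algebra V" "monotone_algebra W"
  shows "monotone_algebra (V \<inter> W)"
proof -
  interpret V: monotone_algebra V by fact
  interpret W: monotone_algebra W by fact
  show ?thesis
    by standard (auto intro: V.id_closed V.bounded V.add_closed V.scaleR_closed V.comp_closed
      V.monotone_lim_closed W.id_closed W.add_closed W.scaleR_closed W.comp_closed
      W.monotone_lim_closed)
qed

section \<open>Powers and cones of positive operators\<close>

primrec op_power :: "('h::chilbert_space \<Rightarrow>\<^sub>L 'h) \<Rightarrow> nat \<Rightarrow> ('h \<Rightarrow>\<^sub>L 'h)" where
  "op_power b 0 = id_blinfun"
| "op_power b (Suc n) = b o\<^sub>L op_power b n"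

lemma op_power_add: "op_power b (m + n) = op_power b m o\<^sub>L op_power b n"
  by (induction m) (auto intro!: blinfun_eqI simp: op_apply)

lemma op_power_commute:
  assumes "x o\<^sub>L b = b o\<^sub>L x"
  shows "x o\<^sub>L op_power b n = op_power b n o\<^sub>L x"
proof (induction n)
  case 0 then show ?case by (auto intro!: blinfun_eqI simp: op_apply)
next
  case (Suc n)
  have "x o\<^sub>L (b o\<^sub>L op_power b n) = b o\<^sub>L (x o\<^sub>L op_power b n)"
    using assms by (simp add: blinfun_assoc[symmetric])
  also have "\<dots> = b o\<^sub>L op_power b n o\<^sub>L x" using Suc by (simp add: blinfun_assoc)
  finally show ?case by simp
qed

lemma op_power_add_two: "op_power b (n + 2) = b o\<^sub>L op_power b n o\<^sub>L b"
  by (metis add_2_eq_Suc' blinfun_assoc op_power.simps(2) op_power_commute)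

lemma op_power_sa: "self_adjoint b \<Longrightarrow> self_adjoint (op_power b n)"
  by (induction n) (auto intro!: sa_comp op_power_commute)

text \<open>Steps of two: the power n + 2 is the power n conjugated by the self-adjoint
  \<open>b\<close>.\<close>

lemma op_power_inner_nonneg:
  assumes "self_adjoint b" "\<And>v. 0 \<le> inner v (blinfun_apply b v)"
  shows "0 \<le> inner v (blinfun_apply (op_power b n) v)"
proof (induction n arbitrary: v rule: nat_induct2)
  case (step n)
  show ?case unfolding op_power_add_two using step[of "blinfun_apply b v"] sa_inner[OF assms(1)] by (simp add: op_apply)
qed (use assms in \<open>auto simp: op_apply\<close>)

text \<open>Polynomials in \<open>b\<close> with nonnegative coefficients. They are closed under
  products and positive for positive \<open>b\<close>, so positivity of a product can be read off
  from its coefficients.\<close>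

inductive_set power_cone :: "('h::chilbert_space \<Rightarrow>\<^sub>L 'h) \<Rightarrow> ('h \<Rightarrow>\<^sub>L 'h) set" for b where
  power: "op_power b n \<in> power_cone b"
| add: "x \<in> power_cone b \<Longrightarrow> y \<in> power_cone b \<Longrightarrow> x + y \<in> power_cone b"
| scale: "x \<in> power_cone b \<Longrightarrow> 0 \<le> r \<Longrightarrow> r *\<^sub>R x \<in> power_cone b"

lemma blinfun_comp_linear:
  "(S + T) o\<^sub>L U = (S o\<^sub>L U) + (T o\<^sub>L U)" "U o\<^sub>L (S + T) = (U o\<^sub>L S) + (U o\<^sub>L T)"
  "(S - T) o\<^sub>L U = (S o\<^sub>L U) - (T o\<^sub>L U)" "U o\<^sub>L (S - T) = (U o\<^sub>L S) - (U o\<^sub>L T)"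
  "(r *\<^sub>R S) o\<^sub>L U = r *\<^sub>R (S o\<^sub>L U)" "U o\<^sub>L (r *\<^sub>R S) = r *\<^sub>R (U o\<^sub>L S)"
  "(- S) o\<^sub>L U = - (S o\<^sub>L U)" "U o\<^sub>L (- S) = - (U o\<^sub>L S)"
  "id_blinfun o\<^sub>L V = V" "V o\<^sub>L id_blinfun = V"
  "0 o\<^sub>L U = 0" "U o\<^sub>L 0 = 0"
  by (auto intro!: blinfun_eqI simp: op_apply op_linear)

lemma power_cone_commute:
  assumes "y \<in> power_cone b" "x o\<^sub>L b = b o\<^sub>L x"
  shows "x o\<^sub>L y = y o\<^sub>L x"
  using assms(1) by induction (auto simp: op_power_commute[OF assms(2)] blinfun_comp_linear)

lemma power_cone_comp:
  assumes "x \<in> power_cone b" "y \<in> power_cone b"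
  shows "x o\<^sub>L y \<in> power_cone b"
  using assms(1)
proof induction
  case (power n)
  from assms(2) show ?case
    by induction (auto simp: op_power_add[symmetric] blinfun_comp_linear intro: power_cone.intros)
qed (auto simp: blinfun_comp_linear intro: power_cone.intros)

lemma power_cone_commute_self:
  assumes "x \<in> power_cone b" "y \<in> power_cone b"
  shows "x o\<^sub>L y = y o\<^sub>L x"
proof -
  have "b o\<^sub>L x = x o\<^sub>L b" using power_cone_commute[OF assms(1), of b] by simp
  then show ?thesis using power_cone_commute[OF assms(2), of x] by simp
qed

lemma power_cone_sa: "x \<in> power_cone b \<Longrightarrow> self_adjoint b \<Longrightarrow> self_adjoint x"
  by (induction rule: power_cone.induct) (auto intro: op_power_sa sa_add sa_scaleR)

lemma power_cone_inner_nonneg: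
  assumes "x \<in> power_cone b" "self_adjoint b" "\<And>v. 0 \<le> inner v (blinfun_apply b v)"
  shows "0 \<le> inner v (blinfun_apply x v)"
  using assms(1)
  by induction (auto simp: op_power_inner_nonneg[OF assms(2,3)] op_apply inner_add_right)

lemma (in monotone_algebra) power_closed: "b \<in> W \<Longrightarrow> op_power b n \<in> W"
  by (induction n) (auto intro: id_closed comp_closed)

lemma (in monotone_algebra) power_cone_closed: "x \<in> power_cone b \<Longrightarrow> b \<in> W \<Longrightarrow> x \<in> W"
  by (induction rule: power_cone.induct) (auto intro: power_closed add_closed scaleR_closed)

section \<open>Spectral projections as monotone limits\<close>

lemma projection_op_sa: "projection_op p \<Longrightarrow> self_adjoint p"
  and projection_op_idem: "projection_op p \<Longrightarrow> blinfun_apply p (blinfun_apply p v) = blinfun_apply p v"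
  by (auto simp: projection_op_def dest: arg_cong[of _ _ "\<lambda>f. blinfun_apply f v"])

lemma projection_op_inner: "projection_op p \<Longrightarrow> inner v (blinfun_apply p v) = (norm (blinfun_apply p v))\<^sup>2"
  using sa_inner[OF projection_op_sa, of p v "blinfun_apply p v"]
  by (simp add: power2_norm_eq_inner projection_op_idem)

lemma projection_op_compl: "projection_op p \<Longrightarrow> projection_op (id_blinfun - p)"
  by (auto simp: projection_op_def blinfun_comp_linear intro: sa_diff)

text \<open>The typical case is \<open>b = 1 - a / c\<close> with \<open>a\<close> positive: the
  fixed vectors of \<open>b\<close> form the kernel of \<open>a\<close>, the powers of
  \<open>b\<close> decrease to the kernel projection, and the complements \<open>T\<close> increase
  to the support of \<open>a\<close>.\<close>

locale contraction_power =
  fixes b :: "'h::chilbert_space \<Rightarrow>\<^sub>L 'h"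
  assumes sa: "self_adjoint b"
    and nonneg: "\<And>v. 0 \<le> inner v (blinfun_apply b v)"
    and le_one: "\<And>v. inner v (blinfun_apply b v) \<le> (norm v)\<^sup>2"
begin

definition T where "T n = id_blinfun - op_power b n"

lemma norm_le: "norm (blinfun_apply b v) \<le> norm v"
proof -
  have "norm (blinfun_apply b v) \<le> 1 * norm v"
    by (rule sa_norm_le[OF sa]) (use nonneg le_one in \<open>auto intro: order_trans[OF _ nonneg]\<close>)
  then show ?thesis by simp
qed

lemma norm_power_le: "norm (blinfun_apply (op_power b n) v) \<le> norm v"
  by (induction n) (auto simp: op_apply intro: order_trans[OF norm_le])

text \<open>Conjugation by \<open>b\<close> passes from n to n + 2; the two starting cases are b
  \<le> 1 and b^2 \<le> b.\<close>

lemma step_nonneg: "0 \<le> inner v (blinfun_apply (op_power b n) v) - inner v (blinfun_apply (op_power b (Suc n)) v)"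
proof (induction n arbitrary: v rule: nat_induct2)
  case 0 then show ?case using le_one by (simp add: op_apply power2_norm_eq_inner)
next
  case 1
  have "(norm (blinfun_apply b v))\<^sup>2 \<le> 1 * inner v (blinfun_apply b v)"
    by (rule positive_op_norm_sq_le[OF sa nonneg]) (use le_one in auto)
  then show ?case using sa_inner[OF sa] by (simp add: op_apply power2_norm_eq_inner)
next
  case (step n)
  have "op_power b (Suc (n + 2)) = b o\<^sub>L op_power b (Suc n) o\<^sub>L b"
    by (metis add_Suc op_power_add_two)
  then show ?case unfolding op_power_add_two
    using step[of "blinfun_apply b v"] sa_inner[OF sa] by (simp add: op_apply del: op_power.simps)
qed

lemma T_sa: "self_adjoint (T n)"
  unfolding T_def by (intro sa_diff sa_id op_power_sa sa)

lemma T_incseq: "sa_incseq T"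
  by (rule sa_incseqI[OF T_sa])
     (use step_nonneg in \<open>simp add: T_def op_apply inner_diff_right\<close>)

lemma T_le: "inner v (blinfun_apply (T n) v) \<le> 1 * (norm v)\<^sup>2"
  using op_power_inner_nonneg[OF sa nonneg, of v n] by (simp add: T_def op_apply inner_diff_right power2_norm_eq_inner)

text \<open>Telescoping writes 1 - b^n as a sum of n terms b^k (1 - b), each at most 1 - b. For
  \<open>b = 1 - a / c\<close> it says that each approximant of the support of \<open>a\<close> is
  below a multiple of \<open>a\<close>.\<close>

lemma T_bound: "inner v (blinfun_apply (T n) v) \<le> n * inner v (v - blinfun_apply b v)"
proof (induction n)
  case 0 then show ?case by (simp add: T_def op_apply)
next
  case (Suc n)
  let ?w = "v - blinfun_apply b v"
  have "inner v (blinfun_apply (op_power b n) ?w) \<le> inner v ?w"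
  proof (induction n)
    case (Suc n)
    have "inner v (blinfun_apply (op_power b n) ?w) - inner v (blinfun_apply (op_power b (Suc n)) ?w)
        = inner ?w (blinfun_apply (op_power b n) ?w)"
    proof -
      have "blinfun_apply (op_power b (Suc n)) ?w = blinfun_apply b (blinfun_apply (op_power b n) ?w)"
        by (simp add: op_apply)
      then show ?thesis using sa_inner[OF sa, of v "blinfun_apply (op_power b n) ?w"]
        by (simp add: inner_diff_left)
    qed
    with Suc op_power_inner_nonneg[OF sa nonneg, of ?w n] show ?case by linarith
  qed (simp add: op_apply)
  moreover have "blinfun_apply (op_power b n) ?w = blinfun_apply (T (Suc n)) v - blinfun_apply (T n) v"
    using arg_cong[OF op_power_commute[of b b n], of "\<lambda>f. blinfun_apply f v"]
    by (simp add: T_def op_apply op_linear)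
  ultimately have "inner v (blinfun_apply (T (Suc n)) v) - inner v (blinfun_apply (T n) v) \<le> inner v ?w"
    by (simp add: inner_diff_right)
  with Suc.IH show ?case by (simp add: distrib_right)
qed

lemma limit:
  obtains p where "projection_op p" "strong_lim (op_power b) p" "strong_lim T (id_blinfun - p)"
    "b o\<^sub>L p = p" "\<And>v. blinfun_apply b v = v \<Longrightarrow> blinfun_apply p v = v"
proof -
  obtain s where s: "strong_lim T s" using sa_incseq_convergent[OF T_incseq T_le] .
  define p where "p = id_blinfun - s"
  have lim: "strong_lim (op_power b) p"
    using strong_lim_diff[OF strong_lim_const[of id_blinfun] s] by (simp add: T_def p_def)
  have "strong_lim (\<lambda>n. op_power b n o\<^sub>L op_power b n) (p o\<^sub>L p)"
    by (rule strong_lim_comp[OF lim lim, of 1]) (simp add: norm_power_le)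
  \<comment> \<open>The squares are the subsequence of even powers and have the same limit, which
    makes \<open>p\<close> idempotent.\<close>
  moreover have "strong_lim (\<lambda>n. op_power b n o\<^sub>L op_power b n) p"
    unfolding strong_lim_def op_power_add[symmetric]
  proof
    fix v
    have "strict_mono (\<lambda>n::nat. n + n)" by (simp add: strict_mono_def)
    from LIMSEQ_subseq_LIMSEQ[OF strong_limD[OF lim, of v] this]
    show "(\<lambda>n. blinfun_apply (op_power b (n + n)) v) \<longlonglongrightarrow> blinfun_apply p v" by (simp add: o_def)
  qed
  ultimately have pp: "p o\<^sub>L p = p" by (rule strong_lim_unique)
  have psa: "self_adjoint p" using strong_lim_sa[OF lim] op_power_sa[OF sa] by blast
  have "blinfun_apply b (blinfun_apply p v) = blinfun_apply p v" for v
  proof (rule LIMSEQ_unique)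
    show "(\<lambda>n. blinfun_apply b (blinfun_apply (op_power b n) v)) \<longlonglongrightarrow> blinfun_apply b (blinfun_apply p v)"
      by (intro bounded_linear.tendsto[OF blinfun.bounded_linear_right] strong_limD lim)
    show "(\<lambda>n. blinfun_apply b (blinfun_apply (op_power b n) v)) \<longlonglongrightarrow> blinfun_apply p v"
      using LIMSEQ_Suc[OF strong_limD[OF lim, of v]] by (simp add: op_apply)
  qed
  then have bp: "b o\<^sub>L p = p" by (auto intro!: blinfun_eqI simp: op_apply)
  have fixed: "blinfun_apply p v = v" if "blinfun_apply b v = v" for v
  proof -
    have "blinfun_apply (op_power b n) v = v" for n
      using that by (induction n) (auto simp: op_apply)
    then have "(\<lambda>n. v) \<longlonglongrightarrow> blinfun_apply p v" using strong_limD[OF lim, of v] by simp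
    then show ?thesis using LIMSEQ_unique tendsto_const by blast
  qed
  have "projection_op p" using psa pp by (simp add: projection_op_def)
  moreover have "strong_lim T (id_blinfun - p)" using s by (simp add: p_def)
  ultimately show ?thesis using that lim bp fixed by blast
qed

end

context monotone_algebra
begin

text \<open>The powers of \<open>b\<close> decrease, whereas closure is available for increasing
  sequences; hence the passage to the complements.\<close>

lemma contraction_power_limit_closed:
  assumes "contraction_power b" "b \<in> W" "strong_lim (op_power b) p"
  shows "p \<in> W"
proof -
  interpret contraction_power b by fact
  have "strong_lim T (id_blinfun - p)"
    using strong_lim_diff[OF strong_lim_const[of id_blinfun] assms(3)] by (simp add: T_def[abs_def])
  then have "id_blinfun - p \<in> W"
    by (rule monotone_lim_closed[OF T_incseq, rotated]) (auto simp: T_def intro: diff_closed id_closed power_closed assms(2))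
  from diff_closed[OF id_closed this] show ?thesis by simp
qed

lemma contraction_power_of_positive:
  assumes "self_adjoint a" "\<And>v. 0 \<le> inner v (blinfun_apply a v)" "norm a \<le> c" "c > 0"
  shows "contraction_power (id_blinfun - (1/c) *\<^sub>R a)"
proof
  show "self_adjoint (id_blinfun - (1/c) *\<^sub>R a)" by (intro sa_diff sa_id sa_scaleR assms)
  fix v
  have "inner v (blinfun_apply a v) \<le> c * (norm v)\<^sup>2"
    using inner_le_norm[of v a] mult_right_mono[OF assms(3), of "(norm v)\<^sup>2"] by simp
  then show "0 \<le> inner v (blinfun_apply (id_blinfun - (1/c) *\<^sub>R a) v)" using assms(4)
    by (simp add: op_apply inner_diff_right power2_norm_eq_inner divide_le_eq mult.commute)
  show "inner v (blinfun_apply (id_blinfun - (1/c) *\<^sub>R a) v) \<le> (norm v)\<^sup>2" using assms(2)[of v] assms(4)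
    by (simp add: op_apply inner_diff_right power2_norm_eq_inner)
qed

lemma kernel_projection:
  assumes a: "a \<in> W" "self_adjoint a" "\<And>v. 0 \<le> inner v (blinfun_apply a v)"
  obtains p where "p \<in> W" "projection_op p" "a o\<^sub>L p = 0" "\<And>v. blinfun_apply a v = 0 \<Longrightarrow> blinfun_apply p v = v"
proof -
  define c where "c = norm a + 1"
  have c: "norm a \<le> c" "c > 0" by (auto simp: c_def add_nonneg_pos)
  define b where "b = id_blinfun - (1/c) *\<^sub>R a"
  interpret contraction_power b unfolding b_def by (rule contraction_power_of_positive[OF a(2,3) c])
  obtain p where p: "projection_op p" "strong_lim (op_power b) p"
      "b o\<^sub>L p = p" "\<And>v. blinfun_apply b v = v \<Longrightarrow> blinfun_apply p v = v"
    using limit by metis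
  have "b \<in> W" unfolding b_def using a by (intro diff_closed id_closed scaleR_closed)
  then have "p \<in> W" using contraction_power_limit_closed p(2) contraction_power_axioms by blast
  moreover have "a o\<^sub>L p = 0"
    using p(3) c by (simp add: b_def blinfun_comp_linear)
  moreover have "blinfun_apply p v = v" if "blinfun_apply a v = 0" for v
    using that p(4)[of v] by (simp add: b_def op_apply)
  ultimately show ?thesis using p(1) that by blast
qed

text \<open>
  \<open>1 - |a|\<close> is the limit of \<open>y\<^sub>0 = 0\<close>, \<open>y\<^sub>n\<^sub>+\<^sub>1 = (y\<^sub>n\<^sup>2 + b) / 2\<close> with \<open>b = 1 - a\<^sup>2\<close>; it increases since the
  differences are polynomials in \<open>b\<close> with nonnegative coefficients.
\<close>

lemma absolute_value:
  assumes a: "a \<in> W" "self_adjoint a" "\<And>v. norm (blinfun_apply a v) \<le> norm v"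
  obtains r where "r \<in> W" "self_adjoint r" "\<And>v. 0 \<le> inner v (blinfun_apply r v)"
    "r o\<^sub>L r = a o\<^sub>L a" "r o\<^sub>L a = a o\<^sub>L r"
proof -
  define b where "b = id_blinfun - (a o\<^sub>L a)"
  have bW: "b \<in> W" unfolding b_def using a by (intro diff_closed id_closed comp_closed)
  have bsa: "self_adjoint b" unfolding b_def using a by (intro sa_diff sa_id sa_comp) auto
  have aa: "inner v (blinfun_apply a (blinfun_apply a v)) = (norm (blinfun_apply a v))\<^sup>2" for v
    using sa_inner[OF a(2)] by (simp add: power2_norm_eq_inner)
  have bpos: "0 \<le> inner v (blinfun_apply b v)" and ble: "inner v (blinfun_apply b v) \<le> (norm v)\<^sup>2" for v
    using power_mono[OF a(3)[of v], of 2]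
    by (auto simp: b_def op_apply inner_diff_right aa power2_norm_eq_inner[symmetric])
  have ab: "a o\<^sub>L b = b o\<^sub>L a" by (simp add: b_def blinfun_comp_linear blinfun_assoc)
  define y where "y = rec_nat 0 (\<lambda>_ y. (1/2) *\<^sub>R ((y o\<^sub>L y) + b))"
  have y0: "y 0 = 0" and yS: "y (Suc n) = (1/2) *\<^sub>R ((y n o\<^sub>L y n) + b)" for n by (auto simp: y_def)
  have bcone: "b \<in> power_cone b" using power_cone.power[of b 1] by (simp add: blinfun_comp_linear)
  have ycone: "y n \<in> power_cone b" for n
  proof (induction n)
    case 0 show ?case using power_cone.scale[OF bcone, of 0] by (simp add: y0)
  qed (auto simp: yS intro!: power_cone.scale power_cone.add power_cone_comp bcone)
  have ydiff: "y (Suc n) - y n \<in> power_cone b" for n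
  proof (induction n)
    case 0 show ?case using power_cone.scale[OF bcone, of "1/2"] by (simp add: y0 yS blinfun_comp_linear)
  next
    case (Suc n)
    have "y (Suc (Suc n)) - y (Suc n) = (1/2) *\<^sub>R ((y (Suc n) - y n) o\<^sub>L (y (Suc n) + y n))"
    proof -
      have "y (Suc (Suc n)) - y (Suc n) = (1/2) *\<^sub>R ((y (Suc n) o\<^sub>L y (Suc n)) + b) - (1/2) *\<^sub>R ((y n o\<^sub>L y n) + b)"
        using yS[of "Suc n"] yS[of n] by metis
      also have "\<dots> = (1/2) *\<^sub>R ((y (Suc n) o\<^sub>L y (Suc n)) - (y n o\<^sub>L y n))"
        by (simp flip: scaleR_diff_right)
      also have "\<dots> = (1/2) *\<^sub>R ((y (Suc n) - y n) o\<^sub>L (y (Suc n) + y n))"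
        using power_cone_commute_self[OF ycone[of n] ycone[of "Suc n"]]
        by (simp add: blinfun_comp_linear(1-4) del: yS)
      finally show ?thesis .
    qed
    then show ?case using Suc ycone by (auto intro!: power_cone.scale power_cone_comp power_cone.add)
  qed
  have ysa: "self_adjoint (y n)" for n using power_cone_sa[OF ycone bsa] .
  have ypos: "0 \<le> inner v (blinfun_apply (y n) v)" for n v
    using power_cone_inner_nonneg[OF ycone bsa bpos] .
  have yle: "inner v (blinfun_apply (y n) v) \<le> 1 * (norm v)\<^sup>2" for n v
  proof (induction n arbitrary: v)
    case (Suc n)
    have "(norm (blinfun_apply (y n) v))\<^sup>2 \<le> 1 * inner v (blinfun_apply (y n) v)"
      by (rule positive_op_norm_sq_le[OF ysa ypos Suc]) simp
    also have "\<dots> \<le> (norm v)\<^sup>2" using Suc by simp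
    finally have "inner v (blinfun_apply (y n) (blinfun_apply (y n) v)) \<le> (norm v)\<^sup>2"
      using sa_inner[OF ysa] by (simp add: power2_norm_eq_inner)
    with ble[of v] show ?case by (simp add: yS op_apply inner_add_right)
  qed (simp add: y0 op_apply)
  have yinc: "sa_incseq y"
    by (rule sa_incseqI[OF ysa])
       (use power_cone_inner_nonneg[OF ydiff bsa bpos] in \<open>simp add: op_apply inner_diff_right\<close>)
  obtain z where z: "strong_lim y z" using sa_incseq_convergent[OF yinc yle] .
  have zW: "z \<in> W" by (rule monotone_lim_closed[OF yinc _ z]) (rule power_cone_closed[OF ycone bW])
  have ynorm: "norm (blinfun_apply (y n) v) \<le> 1 * norm v" for n v
  proof (rule sa_norm_le[OF ysa _ yle])
    show "- 1 * (norm w)\<^sup>2 \<le> inner w (blinfun_apply (y n) w)" for w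
      using ypos[of w n] zero_le_power2[of "norm w"] by linarith
  qed simp
  have zz1: "strong_lim (\<lambda>n. y n o\<^sub>L y n) (z o\<^sub>L z)" by (rule strong_lim_comp[OF z z ynorm])
  \<comment> \<open>The recursion solved for the square: \<open>y n\<close> squared is
    \<open>2 *\<^sub>R y (Suc n) - b\<close>. In the limit this turns the square of 1 - z into 1 -
    b, the square of \<open>a\<close>.\<close>
  have zz2: "strong_lim (\<lambda>n. y n o\<^sub>L y n) (2 *\<^sub>R z - b)"
    unfolding strong_lim_def
  proof
    fix v
    have "(\<lambda>n. 2 *\<^sub>R blinfun_apply (y (Suc n)) v - blinfun_apply b v) \<longlonglongrightarrow> 2 *\<^sub>R blinfun_apply z v - blinfun_apply b v"
      by (rule tendsto_diff[OF tendsto_scaleR[OF tendsto_const LIMSEQ_Suc[OF strong_limD[OF z]]] tendsto_const])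
    then show "(\<lambda>n. blinfun_apply (y n o\<^sub>L y n) v) \<longlonglongrightarrow> blinfun_apply (2 *\<^sub>R z - b) v"
      by (simp add: yS op_apply)
  qed
  have zz: "z o\<^sub>L z = 2 *\<^sub>R z - b" using zz1 zz2 by (rule strong_lim_unique)
  have az: "a o\<^sub>L z = z o\<^sub>L a"
  proof (rule blinfun_eqI)
    fix v
    have "(\<lambda>n. blinfun_apply a (blinfun_apply (y n) v)) \<longlonglongrightarrow> blinfun_apply a (blinfun_apply z v)"
      by (intro bounded_linear.tendsto[OF blinfun.bounded_linear_right] strong_limD z)
    moreover have "blinfun_apply a (blinfun_apply (y n) v) = blinfun_apply (y n) (blinfun_apply a v)" for n
      using arg_cong[OF power_cone_commute[OF ycone ab, of n], of "\<lambda>f. blinfun_apply f v"] by (simp add: op_apply)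
    ultimately show "blinfun_apply (a o\<^sub>L z) v = blinfun_apply (z o\<^sub>L a) v"
      using strong_limD[OF z, of "blinfun_apply a v"] LIMSEQ_unique by (auto simp: op_apply)
  qed
  have zsa: "self_adjoint z" using strong_lim_sa[OF z ysa] .
  show ?thesis
  proof (rule that[of "id_blinfun - z"])
    show "id_blinfun - z \<in> W" using zW by (intro diff_closed id_closed)
    show "self_adjoint (id_blinfun - z)" using zsa by (intro sa_diff sa_id)
    show "0 \<le> inner v (blinfun_apply (id_blinfun - z) v)" for v
      using strong_lim_le[OF z, of v "1 * (norm v)\<^sup>2"] yle
      by (simp add: op_apply inner_diff_right power2_norm_eq_inner)
    show "(id_blinfun - z) o\<^sub>L (id_blinfun - z) = a o\<^sub>L a"
      by (simp add: blinfun_comp_linear zz b_def scaleR_2)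
    show "(id_blinfun - z) o\<^sub>L a = a o\<^sub>L (id_blinfun - z)"
      using az by (simp add: blinfun_comp_linear)
  qed
qed

text \<open>Let \<open>d\<close> be the rescaled \<open>a\<close> and \<open>r\<close> its absolute
  value; \<open>p\<close> projects onto the kernel of \<open>r - d\<close>. Since (r - d)(r + d) =
  0, the range of \<open>r + d\<close> lies there, so d p = r p is positive and d (1 - p) = - r (1 -
  p) is negative.\<close>

lemma positive_part_projection:
  assumes a: "a \<in> W" "self_adjoint a"
  obtains p where "p \<in> W" "projection_op p" "p o\<^sub>L a = a o\<^sub>L p"
    "\<And>v. 0 \<le> inner v (blinfun_apply (a o\<^sub>L p) v)"
    "\<And>v. inner v (blinfun_apply (a o\<^sub>L (id_blinfun - p)) v) \<le> 0"
proof -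
  define c where "c = norm a + 1"
  have c: "c > 0" by (auto simp: c_def add_nonneg_pos)
  define d where "d = (1/c) *\<^sub>R a"
  have ad: "a = c *\<^sub>R d" using c by (simp add: d_def)
  have d: "d \<in> W" "self_adjoint d" using a by (auto simp: d_def intro: scaleR_closed sa_scaleR)
  have "norm (blinfun_apply d v) \<le> norm v" for v
  proof -
    have "norm (blinfun_apply a v) \<le> c * norm v"
      using norm_blinfun[of a v] by (simp add: c_def distrib_right add_increasing2)
    then show ?thesis using c by (simp add: d_def op_apply divide_le_eq mult.commute)
  qed
  then obtain r where r: "r \<in> W" "self_adjoint r" "\<And>v. 0 \<le> inner v (blinfun_apply r v)"
      "r o\<^sub>L r = d o\<^sub>L d" "r o\<^sub>L d = d o\<^sub>L r"
    using absolute_value[OF d] by blast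
  define k where "k = r - d"
  have ksa: "self_adjoint k" unfolding k_def using r d sa_diff by blast
  \<comment> \<open>The square has the same kernel as \<open>k\<close>, and its positivity is
    immediate.\<close>
  have kk: "k o\<^sub>L k \<in> W" "self_adjoint (k o\<^sub>L k)" using r d ksa
    by (auto simp: k_def intro!: comp_closed diff_closed sa_comp)
  have "0 \<le> inner v (blinfun_apply (k o\<^sub>L k) v)" for v
    using sa_inner[OF ksa, of v "blinfun_apply k v"] by (metis blinfun_apply_blinfun_compose inner_ge_zero)
  from kernel_projection[OF kk this] obtain p where p: "p \<in> W" "projection_op p"
      "k o\<^sub>L k o\<^sub>L p = 0" "\<And>v. blinfun_apply (k o\<^sub>L k) v = 0 \<Longrightarrow> blinfun_apply p v = v" by blast
  have psa: "self_adjoint p" using p(2) projection_op_sa by blast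
  have kp: "k o\<^sub>L p = 0"
  proof (rule blinfun_eqI)
    fix v
    have "inner (blinfun_apply k (blinfun_apply p v)) (blinfun_apply k (blinfun_apply p v)) = 0"
      using arg_cong[OF p(3), of "\<lambda>f. blinfun_apply f v"] sa_inner[OF ksa, of "blinfun_apply p v"]
      by (simp add: op_apply)
    then show "blinfun_apply (k o\<^sub>L p) v = blinfun_apply 0 v" by (simp add: op_apply)
  qed
  have "k o\<^sub>L (r + d) = 0" using r by (simp add: k_def blinfun_comp_linear)
  then have "blinfun_apply p (blinfun_apply (r + d) v) = blinfun_apply (r + d) v" for v
    by (intro p(4)) (metis blinfun_apply_blinfun_compose blinfun.zero_left blinfun.zero_right)
  then have pq: "p o\<^sub>L (r + d) = r + d" by (auto intro!: blinfun_eqI simp: op_apply)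
  have flip: "S o\<^sub>L T = U \<Longrightarrow> self_adjoint S \<Longrightarrow> self_adjoint T \<Longrightarrow> self_adjoint U \<Longrightarrow> T o\<^sub>L S = U" for S T U :: "'h \<Rightarrow>\<^sub>L 'h"
    unfolding self_adjoint_def using is_adjoint_comp[of S S T T] is_adjoint_unique is_adjoint_sym by blast
  have qp: "(r + d) o\<^sub>L p = r + d" using flip[OF pq psa] r d sa_add by blast
  have pk: "p o\<^sub>L k = 0" using flip[OF kp ksa psa] by simp
  \<comment> \<open>The four products of \<open>p\<close> with \<open>r\<close> and \<open>d\<close>
    all equal half of \<open>r + d\<close>; each is found by doubling, as \<open>r + d\<close> is
    fixed by \<open>p\<close> and \<open>k\<close> is killed by it on either side.\<close>
  have half: "X = (1/2) *\<^sub>R Y" if "X + X = Y" for X Y :: "'h \<Rightarrow>\<^sub>L 'h"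
    unfolding that[symmetric] by simp
  have sumk: "(r + d) + k = r + r" and diffk: "(r + d) - k = d + d" by (simp_all add: k_def)
  have dp: "d o\<^sub>L p = (1/2) *\<^sub>R (r + d)"
  proof (rule half)
    have "(d o\<^sub>L p) + (d o\<^sub>L p) = ((r + d) - k) o\<^sub>L p" unfolding diffk by (simp only: blinfun_comp_linear(1))
    also have "\<dots> = r + d" by (simp only: blinfun_comp_linear(3) qp kp add_0_right diff_zero)
    finally show "(d o\<^sub>L p) + (d o\<^sub>L p) = r + d" .
  qed
  have rp: "r o\<^sub>L p = (1/2) *\<^sub>R (r + d)"
  proof (rule half)
    have "(r o\<^sub>L p) + (r o\<^sub>L p) = ((r + d) + k) o\<^sub>L p" unfolding sumk by (simp only: blinfun_comp_linear(1))
    also have "\<dots> = r + d" by (subst blinfun_comp_linear(1)) (simp only: qp kp add_0_right)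
    finally show "(r o\<^sub>L p) + (r o\<^sub>L p) = r + d" .
  qed
  have pd: "p o\<^sub>L d = (1/2) *\<^sub>R (r + d)"
  proof (rule half)
    have "(p o\<^sub>L d) + (p o\<^sub>L d) = p o\<^sub>L ((r + d) - k)" unfolding diffk by (simp only: blinfun_comp_linear(2))
    also have "\<dots> = r + d" by (simp only: blinfun_comp_linear(4) pq pk add_0_right diff_zero)
    finally show "(p o\<^sub>L d) + (p o\<^sub>L d) = r + d" .
  qed
  have pr: "p o\<^sub>L r = (1/2) *\<^sub>R (r + d)"
  proof (rule half)
    have "(p o\<^sub>L r) + (p o\<^sub>L r) = p o\<^sub>L ((r + d) + k)" unfolding sumk by (simp only: blinfun_comp_linear(2))
    also have "\<dots> = r + d" by (subst blinfun_comp_linear(2)) (simp only: pq pk add_0_right)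
    finally show "(p o\<^sub>L r) + (p o\<^sub>L r) = r + d" .
  qed
  have conj: "0 \<le> inner v (blinfun_apply (r o\<^sub>L q) v)" if "projection_op q" "q o\<^sub>L r = r o\<^sub>L q" for q v
  proof -
    have "r o\<^sub>L q = q o\<^sub>L r o\<^sub>L q" using that
      by (metis blinfun_assoc projection_op_def)
    then show ?thesis using r(3)[of "blinfun_apply q v"] sa_inner[OF projection_op_sa[OF that(1)]]
      by (simp add: op_apply)
  qed
  show ?thesis
  proof (rule that[of p])
    show "p o\<^sub>L a = a o\<^sub>L p" by (simp add: ad blinfun_comp_linear pd dp)
    have 1: "a o\<^sub>L p = c *\<^sub>R (r o\<^sub>L p)" by (simp add: ad blinfun_comp_linear rp dp)
    have "d o\<^sub>L (id_blinfun - p) = - (r o\<^sub>L (id_blinfun - p))"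
    proof -
      have "d - H = - (r - H)" if "r + d = H + H" for H using that by (simp add: algebra_simps)
      then show ?thesis unfolding blinfun_comp_linear(4,10) rp dp by (simp flip: scaleR_left_distrib)
    qed
    then have 2: "a o\<^sub>L (id_blinfun - p) = - (c *\<^sub>R (r o\<^sub>L (id_blinfun - p)))"
      by (simp add: ad blinfun_comp_linear(5))
    show "0 \<le> inner v (blinfun_apply (a o\<^sub>L p) v)" for v
      using conj[OF p(2) trans[OF pr rp[symmetric]], of v] c unfolding 1
      by (simp only: blinfun.scaleR_left inner_scaleR_right) simp
    have "(id_blinfun - p) o\<^sub>L r = r o\<^sub>L (id_blinfun - p)" by (simp add: blinfun_comp_linear pr rp)
    from conj[OF projection_op_compl[OF p(2)] this] c
    show "inner v (blinfun_apply (a o\<^sub>L (id_blinfun - p)) v) \<le> 0" for v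
      unfolding 2
      by (simp only: blinfun.minus_left blinfun.scaleR_left inner_minus_right inner_scaleR_right) simp
  qed (use p(1,2) in auto)
qed

end

section \<open>Orthogonal projections\<close>

text \<open>Midpoints stay in \<open>V\<close>, so by the parallelogram identity a minimizing
  sequence for the distance to \<open>V\<close> is Cauchy; its limit attains the distance, which
  gives orthogonality.\<close>

lemma orthogonal_decomposition:
  fixes V :: "'a::{real_inner, complete_space} set"
  assumes V: "subspace V" "closed V"
  shows "\<exists>p\<in>V. \<forall>w\<in>V. inner (v - p) w = 0"
proof -
  define d where "d = (INF u\<in>V. (norm (v - u))\<^sup>2)"
  have bdd: "bdd_below ((\<lambda>u. (norm (v - u))\<^sup>2) ` V)" by (rule bdd_belowI[of _ 0]) auto
  have ne: "V \<noteq> {}" using subspace_0[OF V(1)] by blast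
  have d_le: "d \<le> (norm (v - u))\<^sup>2" if "u \<in> V" for u
    unfolding d_def by (rule cINF_lower[OF bdd that])
  have "\<exists>u\<in>V. (norm (v - u))\<^sup>2 < d + 1 / Suc n" for n
  proof -
    have "Inf ((\<lambda>u. (norm (v - u))\<^sup>2) ` V) < d + 1 / Suc n" by (simp add: d_def)
    then show ?thesis using cInf_lessD[of "(\<lambda>u. (norm (v - u))\<^sup>2) ` V"] ne by auto
  qed
  then obtain u where u: "\<And>n. u n \<in> V" "\<And>n. (norm (v - u n))\<^sup>2 < d + 1 / Suc n" by metis
  have par: "(norm (x - y))\<^sup>2 \<le> 2 * ((norm (v - x))\<^sup>2 - d) + 2 * ((norm (v - y))\<^sup>2 - d)" if "x \<in> V" "y \<in> V" for x y
  proof -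
    have "(1/2) *\<^sub>R (x + y) \<in> V" using V(1) that by (intro subspace_scale subspace_add)
    from d_le[OF this]
    have "4 * d \<le> (norm ((v - x) + (v - y)))\<^sup>2"
    proof -
      have "(v - x) + (v - y) = 2 *\<^sub>R (v - (1/2) *\<^sub>R (x + y))"
        by (simp add: scaleR_2 algebra_simps)
      then have "(norm ((v - x) + (v - y)))\<^sup>2 = 4 * (norm (v - (1/2) *\<^sub>R (x + y)))\<^sup>2"
        by (simp add: power_mult_distrib)
      then show ?thesis using \<open>d \<le> _\<close> by simp
    qed
    moreover have "(norm ((v - x) + (v - y)))\<^sup>2 + (norm (x - y))\<^sup>2 = 2 * (norm (v - x))\<^sup>2 + 2 * (norm (v - y))\<^sup>2"
      unfolding power2_norm_eq_inner by (simp add: inner_simps inner_commute)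
    ultimately show ?thesis by simp
  qed
  have "Cauchy u"
  proof (rule CauchyI')
    fix e :: real assume e: "0 < e"
    obtain M where M: "4 / e\<^sup>2 < real (Suc M)"
      by (meson reals_Archimedean2 le_less_trans less_imp_le of_nat_Suc le_SucI lessI less_trans of_nat_less_iff)
    show "\<exists>M. \<forall>m\<ge>M. \<forall>n>m. dist (u m) (u n) < e"
    proof (intro exI allI impI)
      fix m n assume mn: "M \<le> m" "m < n"
      have "(norm (u m - u n))\<^sup>2 < 2 * (1 / Suc m) + 2 * (1 / Suc n)"
        using par[OF u(1)[of m] u(1)[of n]] u(2)[of m] u(2)[of n] by simp
      also have "\<dots> \<le> 2 * (1 / Suc M) + 2 * (1 / Suc M)"
        using mn by (intro add_mono mult_left_mono divide_left_mono) auto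
      also have "\<dots> = 4 / Suc M" by simp
      also have "\<dots> < e\<^sup>2" using M e by (simp add: field_simps)
      finally show "dist (u m) (u n) < e" using e by (simp add: dist_norm power2_less_imp_less)
    qed
  qed
  then obtain p where p: "u \<longlonglongrightarrow> p" using Cauchy_convergent_iff convergent_def by blast
  have pV: "p \<in> V" using closed_sequentially[OF V(2) _ p] u(1) by blast
  have "(norm (v - p))\<^sup>2 \<le> d"
  proof (rule LIMSEQ_le)
    show "(\<lambda>n. (norm (v - u n))\<^sup>2) \<longlonglongrightarrow> (norm (v - p))\<^sup>2" by (intro tendsto_intros p)
    show "(\<lambda>n. d + 1 / Suc n) \<longlonglongrightarrow> d"
      using tendsto_add[OF tendsto_const LIMSEQ_inverse_real_of_nat, of d] by (simp add: inverse_eq_divide)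
  qed (use u(2) less_imp_le in blast)
  have "inner (v - p) w = 0" if w: "w \<in> V" for w
  proof (rule ccontr)
    assume nz: "inner (v - p) w \<noteq> 0"
    then have w0: "w \<noteq> 0" by auto
    \<comment> \<open>Moving \<open>p\<close> by this multiple of \<open>w\<close> would shorten the
      distance.\<close>
    define t where "t = inner (v - p) w / inner w w"
    have "p + t *\<^sub>R w \<in> V" using V(1) pV w by (intro subspace_scale subspace_add)
    then have "(norm (v - p))\<^sup>2 \<le> (norm (v - (p + t *\<^sub>R w)))\<^sup>2"
      using d_le \<open>(norm (v - p))\<^sup>2 \<le> d\<close> order_trans by blast
    also have "v - (p + t *\<^sub>R w) = (v - p) - t *\<^sub>R w" by simp
    also have "(norm ((v - p) - t *\<^sub>R w))\<^sup>2 = (norm (v - p))\<^sup>2 - 2 * t * inner (v - p) w + t * (t * inner w w)"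
      unfolding power2_norm_eq_inner by (simp add: inner_diff_left inner_diff_right inner_commute algebra_simps)
    also have "t * inner w w = inner (v - p) w" using w0 by (simp add: t_def)
    finally have "t * inner (v - p) w \<le> 0" by simp
    moreover have "t * inner (v - p) w > 0"
    proof -
      have "t * inner (v - p) w = (inner (v - p) w)\<^sup>2 / inner w w" by (simp add: t_def power2_eq_square)
      also have "\<dots> > 0" using nz w0 by (intro divide_pos_pos) auto
      finally show ?thesis .
    qed
    ultimately show False by simp
  qed
  with pV show ?thesis by blast
qed

text \<open>The foot of the perpendicular is unique, so additivity and homogeneity follow by
  checking that the expected value is a foot. Stability of \<open>V\<close> under complex scalars
  gives complex homogeneity.\<close>

lemma projection_onto_subspace:
  fixes V :: "'h::chilbert_space set"
  assumes V: "subspace V" "closed V" "\<And>c v. v \<in> V \<Longrightarrow> c *\<^sub>C v \<in> V"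
  obtains P where "projection_op P" "\<And>v. blinfun_apply P v \<in> V" "\<And>v. v \<in> V \<Longrightarrow> blinfun_apply P v = v"
proof -
  obtain P where P: "\<And>v. P v \<in> V" "\<And>v w. w \<in> V \<Longrightarrow> inner (v - P v) w = 0"
    using orthogonal_decomposition[OF V(1,2)] by metis
  have uniq: "P v = p" if "p \<in> V" "\<And>w. w \<in> V \<Longrightarrow> inner (v - p) w = 0" for v p
  proof -
    have d: "P v - p \<in> V" using P that V(1) subspace_diff by blast
    have "inner (P v - p) (P v - p) = inner (v - p) (P v - p) - inner (v - P v) (P v - p)"
      by (simp add: inner_diff_left)
    also have "\<dots> = 0" using P(2)[OF d] that(2)[OF d] by simp
    finally show ?thesis by simp
  qed
  have scale: "P (c *\<^sub>C v) = c *\<^sub>C P v" for c v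
  proof (rule uniq)
    show "c *\<^sub>C P v \<in> V" using P V by blast
    fix w assume "w \<in> V"
    then have "cnj c *\<^sub>C w \<in> V" using V by blast
    from P(2)[OF this] show "inner (c *\<^sub>C v - c *\<^sub>C P v) w = 0"
      by (simp add: scaleC_diff_right[symmetric] inner_eq_Re_cinner cinner_scaleC_left cinner_scaleC_right)
  qed
  have "bounded_linear P"
  proof (rule bounded_linear_intro)
    show "P (x + y) = P x + P y" for x y
    proof (rule uniq)
      show "P x + P y \<in> V" using P V subspace_add by blast
      fix w assume "w \<in> V"
      from P(2)[OF this, of x] P(2)[OF this, of y] show "inner (x + y - (P x + P y)) w = 0"
        by (simp add: inner_simps)
    qed
    show "P (r *\<^sub>R x) = r *\<^sub>R P x" for r x by (simp add: scaleR_scaleC scale)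
    show "norm (P x) \<le> norm x * 1" for x
    proof -
      have "(norm x)\<^sup>2 = (norm (P x))\<^sup>2 + (norm (x - P x))\<^sup>2"
        using P(2)[OF P(1), of x x] unfolding power2_norm_eq_inner by (simp add: inner_simps inner_commute)
      then have "(norm (P x))\<^sup>2 \<le> (norm x)\<^sup>2" by simp
      then show ?thesis using power2_le_imp_le norm_ge_zero by (metis mult.right_neutral)
    qed
  qed
  then have app: "blinfun_apply (Blinfun P) = P" by (rule bounded_linear_Blinfun_apply)
  have fix_: "P v = v" if "v \<in> V" for v using that by (intro uniq) auto
  have "Blinfun P \<in> bounded_ops" by (rule bounded_opsI) (simp add: app scale)
  then have "self_adjoint (Blinfun P)"
  proof (subst sa_iff_inner, assumption, intro allI)
    fix v w
    have "inner v (P w) = inner (P v) (P w)" "inner w (P v) = inner (P w) (P v)"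
      using P(2)[OF P(1), of v w] P(2)[OF P(1), of w v] by (simp_all add: inner_diff_left)
    then show "inner (blinfun_apply (Blinfun P) v) w = inner v (blinfun_apply (Blinfun P) w)"
      unfolding app by (metis inner_commute)
  qed
  moreover have "Blinfun P o\<^sub>L Blinfun P = Blinfun P"
    by (rule blinfun_eqI) (simp add: app fix_ P)
  ultimately show ?thesis using that[of "Blinfun P"] P(1) fix_ by (auto simp: projection_op_def app)
qed

section \<open>Von Neumann algebras and factors\<close>

lemma commutant_subset_bounded: "commutant S \<subseteq> bounded_ops"
  by (auto simp: commutant_def)

locale von_neumann = monotone_algebra M for M :: "('h::chilbert_space \<Rightarrow>\<^sub>L 'h) set" +
  assumes von_neumann: "von_neumann_algebra M"
begin

lemma bicommutant: "commutant (commutant M) = M"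
  using von_neumann by (simp add: von_neumann_algebra_def)

lemma scaleC_closed: "x \<in> M \<Longrightarrow> c *\<^sub>C x \<in> M"
  using commutant_scaleC[of x "commutant M" c] commutant_subset_bounded bicommutant by auto

lemma adjoint: "x \<in> M \<Longrightarrow> is_adjoint (adj x) x" and adj_closed: "x \<in> M \<Longrightarrow> adj x \<in> M"
proof -
  assume "x \<in> M"
  then obtain y where "y \<in> M" "is_adjoint y x"
    using von_neumann by (auto simp: von_neumann_algebra_def)
  with adj_eqI[of y x] show "is_adjoint (adj x) x" "adj x \<in> M" by auto
qed

lemma sa_add_adj: "x \<in> M \<Longrightarrow> self_adjoint (x + adj x)"
  using is_adjoint_add[OF adjoint is_adjoint_sym[OF adjoint], of x x]
  by (simp add: self_adjoint_def add.commute)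

lemma sa_i_diff_adj:
  assumes "x \<in> M"
  shows "self_adjoint (\<i> *\<^sub>C (x - adj x))"
proof -
  have "is_adjoint (cnj \<i> *\<^sub>C (adj x + (- 1) *\<^sub>C x)) (\<i> *\<^sub>C (x + (- 1) *\<^sub>C adj x))"
    using is_adjoint_scaleC[OF is_adjoint_sym[OF adjoint[OF assms]], of "-1"]
    by (intro is_adjoint_scaleC is_adjoint_add adjoint assms) simp
  then show ?thesis by (simp add: self_adjoint_def scaleC_add_right scaleC_diff_right)
qed

lemma adj_adj: "x \<in> M \<Longrightarrow> adj (adj x) = x"
  by (rule adj_eqI[OF is_adjoint_sym[OF adjoint]])

lemma inner_adj: "x \<in> M \<Longrightarrow> inner (blinfun_apply (adj x) v) w = inner v (blinfun_apply x w)"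
  by (rule is_adjoint_inner[OF adjoint])

lemma adj_comp_self_closed: "x \<in> M \<Longrightarrow> adj x o\<^sub>L x \<in> M"
  by (intro comp_closed adj_closed)

lemma inner_adj_comp_self: "x \<in> M \<Longrightarrow> inner v (blinfun_apply (adj x o\<^sub>L x) v) = (norm (blinfun_apply x v))\<^sup>2"
  using inner_adj[of x "blinfun_apply x v" v] by (simp add: power2_norm_eq_inner inner_commute)

lemma adj_comp_self_sa: "x \<in> M \<Longrightarrow> self_adjoint (adj x o\<^sub>L x)"
  by (intro sa_adj_comp adjoint)

lemma adj_comp: "x \<in> M \<Longrightarrow> y \<in> M \<Longrightarrow> adj (x o\<^sub>L y) = adj y o\<^sub>L adj x"
  by (intro adj_eqI is_adjoint_comp adjoint)

lemma adj_scaleC: "x \<in> M \<Longrightarrow> adj (c *\<^sub>C x) = cnj c *\<^sub>C adj x"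
  by (intro adj_eqI is_adjoint_scaleC adjoint)

lemma adj_add: "x \<in> M \<Longrightarrow> y \<in> M \<Longrightarrow> adj (x + y) = adj x + adj y"
  by (intro adj_eqI is_adjoint_add adjoint)

lemma sum_closed: "(\<And>i. i \<in> A \<Longrightarrow> f i \<in> M) \<Longrightarrow> (\<Sum>i\<in>A. f i) \<in> M"
  by (induction A rule: infinite_finite_induct) (auto simp: zero_closed add_closed)

lemma adj_zero: "adj 0 = 0"
  by (rule adj_eqI[OF is_adjoint_zero])

lemma adj_sum: "(\<And>i. i \<in> A \<Longrightarrow> f i \<in> M) \<Longrightarrow> adj (\<Sum>i\<in>A. f i) = (\<Sum>i\<in>A. adj (f i))"
  by (induction A rule: infinite_finite_induct) (auto simp: adj_zero adj_add sum_closed)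

lemma adj_comp_self_eq_0: "x \<in> M \<Longrightarrow> adj x o\<^sub>L x = 0 \<Longrightarrow> x = 0"
  by (rule blinfun_eqI) (use inner_adj_comp_self[of x] in \<open>simp add: op_apply\<close>)

lemma adj_eq_0: "x \<in> M \<Longrightarrow> adj x = 0 \<longleftrightarrow> x = 0"
  by (metis adj_adj adj_eqI is_adjoint_zero)

lemma comp_adj_self_eq_0: "x \<in> M \<Longrightarrow> x o\<^sub>L adj x = 0 \<Longrightarrow> x = 0"
  using adj_comp_self_eq_0[of "adj x"] by (simp add: adj_closed adj_adj adj_eq_0)

lemma positive_sa: "x \<in> M \<Longrightarrow> positive_op x \<Longrightarrow> self_adjoint x"
  by (rule positive_op_sa[OF _ bounded])

lemma strong_lim_closed:
  assumes "\<And>n. T n \<in> M" "strong_lim T x" "x \<in> bounded_ops"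
  shows "x \<in> M"
proof -
  have "blinfun_apply x (blinfun_apply y v) = blinfun_apply y (blinfun_apply x v)" if "y \<in> commutant M" for y v
  proof (rule LIMSEQ_unique[OF strong_limD[OF assms(2)]])
    have "blinfun_apply (T n) (blinfun_apply y v) = blinfun_apply y (blinfun_apply (T n) v)" for n
      using commutantD[OF that assms(1)] by simp
    then show "(\<lambda>n. blinfun_apply (T n) (blinfun_apply y v)) \<longlonglongrightarrow> blinfun_apply y (blinfun_apply x v)"
      using bounded_linear.tendsto[OF blinfun.bounded_linear_right strong_limD[OF assms(2)], of y v] by simp
  qed
  then have "x \<in> commutant (commutant M)" using assms(3) by (auto intro: commutantI)
  then show ?thesis by (simp add: bicommutant)
qed

end

lemma von_neumann_algebra_locale: "von_neumann_algebra M \<Longrightarrow> von_neumann M"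
  using monotone_algebra_commutant[of "commutant M"]
  by (auto simp: von_neumann_def von_neumann_axioms_def von_neumann_algebra_def)

lemma subspace_closure:
  fixes S :: "'a::real_normed_vector set"
  assumes "subspace S"
  shows "subspace (closure S)"
  unfolding subspace_def
proof (intro conjI ballI allI)
  show "0 \<in> closure S" using subspace_0[OF assms] closure_subset by blast
next
  fix x y assume "x \<in> closure S" "y \<in> closure S"
  then obtain f g where "\<And>n. f n \<in> S" "f \<longlonglongrightarrow> x" "\<And>n. g n \<in> S" "g \<longlonglongrightarrow> y"
    unfolding closure_sequential by blast
  then show "x + y \<in> closure S"
    unfolding closure_sequential
    using subspace_add[OF assms] by (intro exI[of _ "\<lambda>n. f n + g n"]) (auto intro: tendsto_add)
next
  fix c :: real and x assume "x \<in> closure S"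
  then obtain f where "\<And>n. f n \<in> S" "f \<longlonglongrightarrow> x"
    unfolding closure_sequential by blast
  then show "c *\<^sub>R x \<in> closure S"
    unfolding closure_sequential
    using subspace_scale[OF assms] by (intro exI[of _ "\<lambda>n. c *\<^sub>R f n"]) (auto intro: tendsto_scaleR)
qed

lemma closure_span_invariant:
  fixes T :: "'h::real_normed_vector \<Rightarrow>\<^sub>L 'h"
  assumes "\<And>v. v \<in> S \<Longrightarrow> blinfun_apply T v \<in> S" "v \<in> closure (span S)"
  shows "blinfun_apply T v \<in> closure (span S)"
proof -
  have lin: "linear (blinfun_apply T)" using blinfun.bounded_linear_right bounded_linear.linear by blast
  have "blinfun_apply T ` span S \<subseteq> span S"
    using linear_span_image[OF lin, of S] span_mono[of "blinfun_apply T ` S" S] assms(1) by auto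
  then have "blinfun_apply T ` closure (span S) \<subseteq> closure (span S)"
    using closure_bounded_linear_image_subset[OF blinfun.bounded_linear_right, of T "span S"]
      closure_mono by blast
  with assms(2) show ?thesis by blast
qed

text \<open>
  The projection onto the closed span of the vectors \<open>n a\<^sup>* v\<close> commutes with \<open>N\<close> and with its commutant.
\<close>

lemma factor_prime:
  assumes N: "factor N" and a: "a \<in> N" and b: "b \<in> N"
    and 0: "\<And>n. n \<in> N \<Longrightarrow> a o\<^sub>L n o\<^sub>L b = 0"
  shows "a = 0 \<or> b = 0"
proof -
  have "von_neumann_algebra N" using N by (simp add: factor_def)
  then interpret von_neumann N by (rule von_neumann_algebra_locale)
  define S where "S = {blinfun_apply n (blinfun_apply (adj a) v) |n v. n \<in> N}"
  define V where "V = closure (span S)"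
  have S_N: "blinfun_apply t v \<in> S" if t: "t \<in> N" and "v \<in> S" for t v
  proof -
    obtain n w where "v = blinfun_apply n (blinfun_apply (adj a) w)" "n \<in> N" using \<open>v \<in> S\<close> by (auto simp: S_def)
    then show ?thesis using comp_closed[OF t, of n] by (auto simp: S_def intro!: exI[of _ "t o\<^sub>L n"] exI[of _ w])
  qed
  have S_N': "blinfun_apply t v \<in> S" if t: "t \<in> commutant N" and v: "v \<in> S" for t v
  proof -
    obtain n w where "v = blinfun_apply n (blinfun_apply (adj a) w)" "n \<in> N" using v by (auto simp: S_def)
    then show ?thesis using commutantD[OF t, of n] commutantD[OF t, of "adj a"] adj_closed[OF a]
      by (auto simp: S_def intro!: exI[of _ n] exI[of _ "blinfun_apply t w"])
  qed
  have Vt: "blinfun_apply t v \<in> V" if "t \<in> N \<union> commutant N" "v \<in> V" for t v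
    using that S_N S_N' closure_span_invariant[of S t v] unfolding V_def by blast
  have V: "subspace V" "closed V" unfolding V_def by (auto intro: subspace_closure)
  have VC: "c *\<^sub>C v \<in> V" if "v \<in> V" for c v
    using Vt[of "c *\<^sub>C id_blinfun" v] that scaleC_closed[OF id_closed, of c] by (simp add: op_apply)
  obtain P where P: "projection_op P" "\<And>v. blinfun_apply P v \<in> V" "\<And>v. v \<in> V \<Longrightarrow> blinfun_apply P v = v"
    using projection_onto_subspace[OF V VC] by metis
  have Psa: "self_adjoint P" using P(1) projection_op_sa by blast
  \<comment> \<open>Moving \<open>n\<close> and \<open>adj a\<close> across the inner product shows
    that such a \<open>w\<close> is orthogonal to all of \<open>V\<close>; the converse appears
    below as \<open>aw\<close>.\<close>
  have P0: "blinfun_apply P w = 0" if "\<And>n. n \<in> N \<Longrightarrow> blinfun_apply a (blinfun_apply n w) = 0" for w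
  proof -
    have "inner w s = 0" if sS: "s \<in> S" for s
    proof -
      obtain n v where s: "s = blinfun_apply n (blinfun_apply (adj a) v)" and n: "n \<in> N" using sS by (auto simp: S_def)
      have "inner w s = inner (blinfun_apply (adj n) w) (blinfun_apply (adj a) v)"
        unfolding s using inner_adj[OF n] by simp
      also have "\<dots> = inner (blinfun_apply a (blinfun_apply (adj n) w)) v"
        using inner_adj[OF a, of v "blinfun_apply (adj n) w"] by (metis inner_commute)
      also have "\<dots> = 0" using \<open>\<And>n. n \<in> N \<Longrightarrow> blinfun_apply a (blinfun_apply n w) = 0\<close> adj_closed[OF n] by simp
      finally show ?thesis .
    qed
    then have "span S \<subseteq> {s. inner w s = 0}"
      by (intro span_minimal) (auto simp: subspace_def inner_simps)
    moreover have "closed {s. inner w s = 0}" by (intro closed_Collect_eq continuous_intros)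
    ultimately have "V \<subseteq> {s. inner w s = 0}" unfolding V_def by (rule closure_minimal)
    then have "inner w (blinfun_apply P w) = 0" using P(2) by blast
    then show ?thesis using projection_op_inner[OF P(1), of w] by simp
  qed
  \<comment> \<open>The vectors killed by every a n are stable under \<open>N\<close> and its
    commutant as well. So \<open>t\<close> preserves \<open>V\<close> and its orthogonal complement,
    hence commutes with \<open>P\<close>.\<close>
  have Pc: "blinfun_apply P (blinfun_apply t v) = blinfun_apply t (blinfun_apply P v)" if t: "t \<in> N \<union> commutant N" for t v
  proof -
    define w where "w = v - blinfun_apply P v"
    have Pw: "blinfun_apply P w = 0" by (simp add: w_def op_linear P)
    have aw: "blinfun_apply a (blinfun_apply n w) = 0" if n: "n \<in> N" for n
    proof -
      have "inner (blinfun_apply a (blinfun_apply n w)) u = 0" for u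
      proof -
        have "blinfun_apply (adj n) (blinfun_apply (adj a) u) \<in> V" unfolding V_def S_def
          using adj_closed[OF n] by (intro subsetD[OF closure_subset] span_base) auto
        then have Pm: "blinfun_apply P (blinfun_apply (adj n) (blinfun_apply (adj a) u)) = blinfun_apply (adj n) (blinfun_apply (adj a) u)"
          by (rule P(3))
        have "inner (blinfun_apply a (blinfun_apply n w)) u = inner w (blinfun_apply (adj n) (blinfun_apply (adj a) u))"
          using inner_adj[OF a, of u] inner_adj[OF n, of "blinfun_apply (adj a) u" w] by (simp add: inner_commute)
        also have "\<dots> = 0" using sa_inner[OF Psa, of w] Pw by (subst Pm[symmetric]) (metis inner_zero_left)
        finally show ?thesis .
      qed
      from this[of "blinfun_apply a (blinfun_apply n w)"] show ?thesis by simp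
    qed
    have "blinfun_apply a (blinfun_apply n (blinfun_apply t w)) = 0" if n: "n \<in> N" for n
      using t
    proof
      assume "t \<in> N" then show ?thesis using aw[OF comp_closed[OF n, of t]] by simp
    next
      assume "t \<in> commutant N"
      then show ?thesis using commutantD[of t N n w] commutantD[of t N a "blinfun_apply n w"] a n aw[OF n] op_linear by metis
    qed
    then have "blinfun_apply P (blinfun_apply t w) = 0" by (rule P0)
    moreover have "blinfun_apply P (blinfun_apply t (blinfun_apply P v)) = blinfun_apply t (blinfun_apply P v)"
      using Vt[OF t P(2)] P(3) by blast
    ultimately show ?thesis by (simp add: w_def op_linear)
  qed
  have "P \<in> commutant (commutant N)" "P \<in> commutant N"
    using sa_bounded[OF Psa] Pc by (auto intro!: commutantI)
  then have "P \<in> N \<inter> commutant N" by (simp add: bicommutant)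
  then obtain c where c: "P = c *\<^sub>C id_blinfun" using N by (auto simp: factor_def)
  have ida: "blinfun_apply (adj a) v \<in> V" for v unfolding V_def S_def
    using id_closed by (intro subsetD[OF closure_subset] span_base) (auto intro!: exI[of _ id_blinfun] simp: op_apply)
  \<comment> \<open>\<open>P\<close> fixes the range of \<open>adj a\<close> and kills the range of
    \<open>b\<close>; being a scalar, it forces one of the two to be zero.\<close>
  show ?thesis
  proof (cases "c = 0")
    case True
    then have "blinfun_apply (adj a) v = 0" for v using P(3)[OF ida, of v] c by simp
    then have "adj a = 0" by (auto intro!: blinfun_eqI)
    then show ?thesis using adj_eq_0[OF a] by simp
  next
    case False
    have "blinfun_apply P (blinfun_apply b v) = 0" for v
    proof (rule P0)
      fix n assume "n \<in> N"
      from arg_cong[OF 0[OF this], of "\<lambda>f. blinfun_apply f v"]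
      show "blinfun_apply a (blinfun_apply n (blinfun_apply b v)) = 0" by (simp add: op_apply)
    qed
    then have "blinfun_apply b v = 0" for v using False by (simp add: c op_apply scaleC_eq_0_iff)
    then show ?thesis by (auto intro!: blinfun_eqI)
  qed
qed

section \<open>Normal positive maps\<close>

locale normal_positive_map = M: von_neumann M + K: von_neumann K
  for M K :: "('h::chilbert_space \<Rightarrow>\<^sub>L 'h) set" and \<Psi> :: "('h \<Rightarrow>\<^sub>L 'h) \<Rightarrow> ('h \<Rightarrow>\<^sub>L 'h)" +
  assumes linear: "linear_map_on M K \<Psi>"
    and positive: "positive_map_on M \<Psi>"
    and normal: "normal_map_on M K \<Psi>"
begin

lemma map_closed: "x \<in> M \<Longrightarrow> \<Psi> x \<in> K"
  and map_add: "x \<in> M \<Longrightarrow> y \<in> M \<Longrightarrow> \<Psi> (x + y) = \<Psi> x + \<Psi> y"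
  and map_scaleC: "x \<in> M \<Longrightarrow> \<Psi> (c *\<^sub>C x) = c *\<^sub>C \<Psi> x"
  using linear by (auto simp: linear_map_on_def)

lemma map_scaleR: "x \<in> M \<Longrightarrow> \<Psi> (r *\<^sub>R x) = r *\<^sub>R \<Psi> x"
  by (simp add: scaleR_scaleC map_scaleC)

lemma map_diff: "x \<in> M \<Longrightarrow> y \<in> M \<Longrightarrow> \<Psi> (x - y) = \<Psi> x - \<Psi> y"
  using map_add[of x "-1 *\<^sub>R y"] map_scaleR[of y "-1"] M.scaleR_closed[of y "-1"] by simp

lemma map_zero: "\<Psi> 0 = 0"
  using map_scaleR[OF M.zero_closed, of 0] by simp

lemma map_sum: "(\<And>i. i \<in> A \<Longrightarrow> f i \<in> M) \<Longrightarrow> \<Psi> (\<Sum>i\<in>A. f i) = (\<Sum>i\<in>A. \<Psi> (f i))"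
  by (induction A rule: infinite_finite_induct) (auto simp: map_zero map_add M.sum_closed)

lemma map_nonneg:
  assumes "x \<in> M" "self_adjoint x" "\<And>v. 0 \<le> inner v (blinfun_apply x v)"
  shows "self_adjoint (\<Psi> x)" "0 \<le> inner v (blinfun_apply (\<Psi> x) v)"
proof -
  have "positive_op (\<Psi> x)" using assms positive positive_op_iff by (auto simp: positive_map_on_def)
  then show "self_adjoint (\<Psi> x)" "0 \<le> inner v (blinfun_apply (\<Psi> x) v)"
    using K.positive_sa map_closed assms(1) positive_op_inner by auto
qed

text \<open>\<open>x\<close> is the difference of the positive elements
  \<open>norm x *\<^sub>R id_blinfun\<close> and
  \<open>norm x *\<^sub>R id_blinfun - x\<close>.\<close>

lemma map_sa:
  assumes "x \<in> M" "self_adjoint x"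
  shows "self_adjoint (\<Psi> x)"
proof -
  have I: "norm x *\<^sub>R id_blinfun \<in> M" by (intro M.scaleR_closed M.id_closed)
  have Isa: "self_adjoint (norm x *\<^sub>R id_blinfun)" by (intro sa_scaleR sa_id)
  have 1: "self_adjoint (\<Psi> (norm x *\<^sub>R id_blinfun))"
    by (rule map_nonneg[OF I Isa]) (simp add: op_apply)
  have 2: "self_adjoint (\<Psi> (norm x *\<^sub>R id_blinfun - x))"
    by (rule map_nonneg[OF M.diff_closed[OF I assms(1)] sa_diff[OF Isa assms(2)]])
       (use inner_le_norm[of _ x] in \<open>simp add: op_apply inner_diff_right power2_norm_eq_inner\<close>)
  have "\<Psi> x = \<Psi> (norm x *\<^sub>R id_blinfun) - \<Psi> (norm x *\<^sub>R id_blinfun - x)"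
    by (simp add: map_diff I assms)
  with sa_diff[OF 1 2] show ?thesis by simp
qed

lemma map_mono:
  assumes "x \<in> M" "self_adjoint x" "y \<in> M" "self_adjoint y"
    and "\<And>v. inner v (blinfun_apply x v) \<le> inner v (blinfun_apply y v)"
  shows "inner v (blinfun_apply (\<Psi> x) v) \<le> inner v (blinfun_apply (\<Psi> y) v)"
proof -
  have "0 \<le> inner v (blinfun_apply (\<Psi> (y - x)) v)"
    by (rule map_nonneg(2)[OF M.diff_closed[OF assms(3,1)] sa_diff[OF assms(4,2)]])
       (use assms(5) in \<open>simp add: op_apply inner_diff_right\<close>)
  then show ?thesis using assms by (simp add: map_diff op_apply inner_diff_right)
qed

text \<open>\<open>h\<close> is twice the real part of \<open>x\<close> and \<open>k\<close> minus
  twice the imaginary part; both have self-adjoint images.\<close>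

lemma map_adj:
  assumes x: "x \<in> M"
  shows "\<Psi> (adj x) = adj (\<Psi> x)"
proof -
  note ax = M.adj_closed[OF x]
  define h where "h = x + adj x"
  define k where "k = \<i> *\<^sub>C (x - adj x)"
  have hM: "h \<in> M" "k \<in> M" using x ax by (auto simp: h_def k_def intro: M.add_closed M.diff_closed M.scaleC_closed)
  have hs: "self_adjoint h" "self_adjoint k"
    using x by (simp_all add: h_def k_def M.sa_add_adj M.sa_i_diff_adj)
  have \<Psi>h: "\<Psi> h = \<Psi> x + \<Psi> (adj x)" using x ax by (simp add: h_def map_add)
  have \<Psi>k: "\<Psi> k = \<i> *\<^sub>C (\<Psi> x - \<Psi> (adj x))"
    using x ax by (simp add: k_def map_scaleC map_diff M.diff_closed)
  have \<Psi>x: "2 *\<^sub>R \<Psi> x = \<Psi> h + (- \<i>) *\<^sub>C \<Psi> k"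
    unfolding \<Psi>h \<Psi>k by (simp add: scaleC_scaleC scaleC_diff_right scaleR_2)
  have \<Psi>ax: "2 *\<^sub>R \<Psi> (adj x) = \<Psi> h + \<i> *\<^sub>C \<Psi> k"
    unfolding \<Psi>h \<Psi>k by (simp add: scaleC_scaleC scaleC_diff_right scaleR_2)
  have "is_adjoint (\<Psi> h) (\<Psi> h)" "is_adjoint (\<Psi> k) (\<Psi> k)"
    using map_sa hM hs by (auto simp: self_adjoint_def)
  from is_adjoint_add[OF this(1) is_adjoint_scaleC[OF this(2), of "-\<i>"]]
  have "is_adjoint (2 *\<^sub>R \<Psi> (adj x)) (2 *\<^sub>R \<Psi> x)" by (simp add: \<Psi>x \<Psi>ax)
  from is_adjoint_scaleC[OF this, of "1/2"] have "is_adjoint (\<Psi> (adj x)) (\<Psi> x)"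
    by (simp add: scaleR_scaleC scaleC_scaleC)
  then show ?thesis using adj_eqI by metis
qed

text \<open>Normality provides only the supremum of the images. Being increasing and bounded they
  converge strongly, and their limit \<open>L\<close> belongs to \<open>K\<close>, so it is an
  admissible upper bound and must be that supremum.\<close>

lemma map_strong_lim:
  assumes T: "sa_incseq T" "\<And>n. T n \<in> M" "strong_lim T x"
  shows "sa_incseq (\<lambda>n. \<Psi> (T n))" "strong_lim (\<lambda>n. \<Psi> (T n)) (\<Psi> x)"
proof -
  have Tsa: "self_adjoint (T n)" for n using T(1) by (simp add: sa_incseq_def)
  have xsa: "self_adjoint x" using strong_lim_sa[OF T(3)] Tsa by blast
  have xM: "x \<in> M" by (rule M.monotone_lim_closed[OF T])
  have inc: "m \<le> n \<Longrightarrow> inner v (blinfun_apply (T m) v) \<le> inner v (blinfun_apply (T n) v)" for m n v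
    using T(1) by (simp add: sa_incseq_def incseq_def)
  have dir: "directed_ops (range T)"
    unfolding directed_ops_def
  proof (intro conjI ballI)
    fix a b assume "a \<in> range T" "b \<in> range T"
    then obtain m n where "a = T m" "b = T n" by blast
    then show "\<exists>c\<in>range T. a \<le>\<^sub>o\<^sub>p c \<and> b \<le>\<^sub>o\<^sub>p c"
      using inc by (intro bexI[of _ "T (max m n)"]) (auto simp: op_le_iff Tsa)
  qed auto
  have "is_op_sup M (range T) x"
    unfolding is_op_sup_def
  proof (intro conjI ballI impI)
    show "d \<le>\<^sub>o\<^sub>p x" if "d \<in> range T" for d
      using that sa_incseq_le_lim[OF T(1,3)] xsa Tsa by (auto simp: op_le_iff)
    show "x \<le>\<^sub>o\<^sub>p t" if "self_adjoint t" "\<forall>d\<in>range T. d \<le>\<^sub>o\<^sub>p t" for t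
      using that xsa strong_lim_le[OF T(3)] by (auto simp: op_le_iff Tsa)
  qed (use xM xsa in auto)
  then have sup: "is_op_sup K (\<Psi> ` range T) (\<Psi> x)"
    using normal[unfolded normal_map_on_def, rule_format, OF _ _ dir] T(2) Tsa by blast
  show inc': "sa_incseq (\<lambda>n. \<Psi> (T n))"
    by (rule sa_incseqI[OF map_sa[OF T(2) Tsa]], rule map_mono[OF T(2) Tsa T(2) Tsa]) (rule inc, simp)
  have \<Psi>sa: "self_adjoint (\<Psi> (T n))" for n using map_sa T(2) Tsa by blast
  have \<Psi>xsa: "self_adjoint (\<Psi> x)" using map_sa xM xsa by blast
  have le: "inner v (blinfun_apply (\<Psi> (T n)) v) \<le> inner v (blinfun_apply (\<Psi> x) v)" for n v
    by (rule map_mono[OF T(2) Tsa xM xsa]) (rule sa_incseq_le_lim[OF T(1,3)])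
  have "inner v (blinfun_apply (\<Psi> (T n)) v) \<le> norm (\<Psi> x) * (norm v)\<^sup>2" for n v
    using le inner_le_norm order_trans by blast
  from sa_incseq_convergent[OF inc' this] obtain L where L: "strong_lim (\<lambda>n. \<Psi> (T n)) L" by blast
  have Lsa: "self_adjoint L" using strong_lim_sa[OF L] \<Psi>sa by blast
  have LK: "L \<in> K" using K.monotone_lim_closed[OF inc' _ L] map_closed T(2) by blast
  have 1: "L \<le>\<^sub>o\<^sub>p \<Psi> x" using op_le_iff[OF Lsa \<Psi>xsa] strong_lim_le[OF L] le by blast
  have "\<forall>d\<in>\<Psi> ` range T. d \<le>\<^sub>o\<^sub>p L"
    using sa_incseq_le_lim[OF inc' L] op_le_iff[OF \<Psi>sa Lsa] by blast
  then have 2: "\<Psi> x \<le>\<^sub>o\<^sub>p L" using sup LK Lsa unfolding is_op_sup_def by blast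
  have "L = \<Psi> x" by (rule op_le_antisym[OF Lsa \<Psi>xsa 1 2])
  with L show "strong_lim (\<lambda>n. \<Psi> (T n)) (\<Psi> x)" by simp
qed

end

section \<open>Irreducible bimodule channels\<close>

locale irreducible_channel = M: von_neumann M + N: von_neumann N
  for M N :: "('h::chilbert_space \<Rightarrow>\<^sub>L 'h) set" +
  fixes \<Phi> E :: "('h \<Rightarrow>\<^sub>L 'h) \<Rightarrow> ('h \<Rightarrow>\<^sub>L 'h)" and \<delta> :: real
  assumes sub: "N \<subseteq> M"
    and fac: "factor N"
    and channel: "bimodule_quantum_channel N M \<Phi>"
    and irreducible: "relatively_irreducible N M \<Phi>"
    and expectation: "conditional_expectation M N E"
    and expectation_normal: "normal_map_on M N E"
    and \<delta>: "\<delta> > 0"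
    and pimsner_popa: "x \<in> M \<Longrightarrow> positive_op x \<Longrightarrow> \<delta> *\<^sub>R x \<le>\<^sub>o\<^sub>p E x"
begin

sublocale E: normal_positive_map M N E
  using expectation expectation_normal by unfold_locales (auto simp: conditional_expectation_def)

lemma cp: "completely_positive_on M \<Phi>"
  using channel by (simp add: bimodule_quantum_channel_def)

sublocale Phi: normal_positive_map M M \<Phi>
proof
  show "linear_map_on M M \<Phi>" "normal_map_on M M \<Phi>"
    using channel by (auto simp: bimodule_quantum_channel_def)
  show "positive_map_on M \<Phi>"
    unfolding positive_map_on_def
  proof (intro ballI impI)
    fix x assume x: "x \<in> M" "positive_op x"
    have "positive_op_matrix 1 (\<lambda>_ _. x)"
      using x(2) by (simp add: positive_op_matrix_def positive_op_def)
    then have p: "positive_op_matrix 1 (\<lambda>_ _. \<Phi> x)"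
      using cp[unfolded completely_positive_on_def, rule_format, of 1 "\<lambda>_ _. x"] x(1) by simp
    show "positive_op (\<Phi> x)"
      unfolding positive_op_def
    proof
      fix v
      show "cinner v (blinfun_apply (\<Phi> x) v) \<in> \<real>\<^sub>\<ge>\<^sub>0"
        using p[unfolded positive_op_matrix_def, rule_format, of "\<lambda>_. v"] by simp
    qed
  qed
qed

section \<open>The Schwarz inequality and the multiplicative domain\<close>

lemma Phi_id: "\<Phi> id_blinfun = id_blinfun"
  using channel by (simp add: bimodule_quantum_channel_def)

lemma Phi_N: "y \<in> N \<Longrightarrow> \<Phi> y = y"
  using channel M.id_closed N.id_closed Phi_id
  unfolding bimodule_quantum_channel_def bimodule_map_on_def
  by (metis blinfun_comp_linear(9,10))

lemma E_N: "y \<in> N \<Longrightarrow> E y = y"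
  using expectation by (simp add: conditional_expectation_def)

lemma pimsner_popa_inner:
  assumes "x \<in> M" "self_adjoint x" "\<And>v. 0 \<le> inner v (blinfun_apply x v)"
  shows "\<delta> * inner v (blinfun_apply x v) \<le> inner v (blinfun_apply (E x) v)"
proof -
  have "positive_op x" using assms(3) positive_op_iff[OF assms(2)] by blast
  from op_le_inner[OF pimsner_popa[OF assms(1) this], of v] show ?thesis by (simp add: op_apply)
qed

text \<open>The matrix with rows (1, x) and (x*, x* x) is the adjoint of the row (1, x) times that
  row, hence positive. Its image under \<open>\<Phi>\<close> is tested at the pair
  \<open>(- \<Phi> x v, v)\<close>, which completes the square.\<close>

lemma schwarz:
  assumes x: "x \<in> M"
  shows "(norm (blinfun_apply (\<Phi> x) v))\<^sup>2 \<le> inner v (blinfun_apply (\<Phi> (adj x o\<^sub>L x)) v)"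
proof -
  define T where "T i j = (if i = (0::nat) then if j = (0::nat) then id_blinfun else x
                           else if j = 0 then adj x else adj x o\<^sub>L x)" for i j
  have TM: "T i j \<in> M" for i j
    using x M.id_closed M.adj_closed M.adj_comp_self_closed by (simp add: T_def)
  have ax: "cinner u (blinfun_apply (adj x) w) = cinner (blinfun_apply x u) w" for u w
    using is_adjoint_sym[OF M.adjoint[OF x]] by (simp add: is_adjoint_def)
  have "positive_op_matrix 2 T"
    unfolding positive_op_matrix_def
  proof
    fix \<xi> :: "nat \<Rightarrow> 'h"
    let ?w = "\<xi> 0 + blinfun_apply x (\<xi> 1)"
    have "(\<Sum>i<2. cinner (\<xi> i) (\<Sum>j<2. blinfun_apply (T i j) (\<xi> j))) = cinner ?w ?w"
      by (simp add: numeral_2_eq_2 T_def op_apply ax cinner_add_left cinner_add_right)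
    then show "(\<Sum>i<2. cinner (\<xi> i) (\<Sum>j<2. blinfun_apply (T i j) (\<xi> j))) \<in> \<real>\<^sub>\<ge>\<^sub>0"
      by (simp only: cinner_self) simp
  qed
  then have "positive_op_matrix 2 (\<lambda>i j. \<Phi> (T i j))"
    using cp[unfolded completely_positive_on_def, rule_format, of 2 T] TM by simp
  then have "(\<Sum>i<2. cinner (\<xi> i) (\<Sum>j<2. blinfun_apply (\<Phi> (T i j)) (\<xi> j))) \<in> \<real>\<^sub>\<ge>\<^sub>0" for \<xi>
    unfolding positive_op_matrix_def by blast
  from this[of "\<lambda>i. if i = 0 then - blinfun_apply (\<Phi> x) v else v"]
  have "cinner v (blinfun_apply (adj (\<Phi> x)) (- blinfun_apply (\<Phi> x) v) + blinfun_apply (\<Phi> (adj x o\<^sub>L x)) v) \<in> \<real>\<^sub>\<ge>\<^sub>0"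
    using cinner_scaleC_right[of "- blinfun_apply (\<Phi> x) v" 0 0]
    by (simp add: numeral_2_eq_2 T_def op_apply Phi_id Phi.map_adj[OF x])
  then have "0 \<le> inner v (blinfun_apply (adj (\<Phi> x)) (- blinfun_apply (\<Phi> x) v) + blinfun_apply (\<Phi> (adj x o\<^sub>L x)) v)"
    by (simp add: complex_nonneg_Reals_iff Re_cinner)
  then show ?thesis
    using M.inner_adj_comp_self[OF Phi.map_closed[OF x], of v]
    by (simp add: inner_add_right inner_diff_right op_linear op_apply)
qed

text \<open>\<open>D\<close> is an operator-valued sesquilinear form, positive on the diagonal by
  \<open>schwarz\<close>. As \<open>D x x = 0\<close>, the diagonal value at
  \<open>t *\<^sub>R x + y\<close> is affine in t and nonnegative for all real t, so its slope
  vanishes.\<close>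

lemma multiplicative_domain:
  assumes x: "x \<in> M" and y: "y \<in> M" and eq: "\<Phi> (adj x o\<^sub>L x) = adj (\<Phi> x) o\<^sub>L \<Phi> x"
  shows "\<Phi> (y o\<^sub>L x) = \<Phi> y o\<^sub>L \<Phi> x"
proof -
  define D where "D y z = \<Phi> (adj y o\<^sub>L z) - (adj (\<Phi> y) o\<^sub>L \<Phi> z)" for y z
  have Dpos: "0 \<le> inner v (blinfun_apply (D z z) v)" if "z \<in> M" for z v
    using schwarz[OF that, of v] M.inner_adj_comp_self[OF Phi.map_closed[OF that], of v]
    by (simp add: D_def blinfun.diff_left inner_diff_right del: blinfun_apply_blinfun_compose)
  note cl = M.adj_closed M.comp_closed M.scaleR_closed M.scaleC_closed M.add_closed Phi.map_closed
  have Dadj: "is_adjoint (D z y) (D y z)" if z: "y \<in> M" "z \<in> M" for y z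
  proof -
    have "adj (\<Phi> (adj y o\<^sub>L z)) = \<Phi> (adj z o\<^sub>L y)"
      using z by (simp add: Phi.map_adj[symmetric] cl M.adj_comp M.adj_adj)
    then have 1: "is_adjoint (\<Phi> (adj z o\<^sub>L y)) (\<Phi> (adj y o\<^sub>L z))"
      using M.adjoint[of "\<Phi> (adj y o\<^sub>L z)"] z cl by simp
    have "adj (adj (\<Phi> y) o\<^sub>L \<Phi> z) = adj (\<Phi> z) o\<^sub>L \<Phi> y"
      using z by (simp add: cl M.adj_comp M.adj_adj)
    then have 2: "is_adjoint (adj (\<Phi> z) o\<^sub>L \<Phi> y) (adj (\<Phi> y) o\<^sub>L \<Phi> z)"
      using M.adjoint[of "adj (\<Phi> y) o\<^sub>L \<Phi> z"] z cl by simp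
    show ?thesis using is_adjoint_add[OF 1 is_adjoint_scaleC[OF 2, of "-1"]] by (simp add: D_def)
  qed
  have D0: "D x x = 0" by (simp add: D_def eq)
  have anti: "D x y + D y x = 0" if y: "y \<in> M" for y
  proof (rule sa_eqI)
    show "self_adjoint (D x y + D y x)"
      unfolding self_adjoint_def using is_adjoint_add[OF Dadj[OF x y] Dadj[OF y x]] by (simp add: add.commute)
    fix v
    have "0 \<le> t * inner v (blinfun_apply (D x y + D y x) v) + inner v (blinfun_apply (D y y) v)" for t
    proof -
      have adjz: "adj (t *\<^sub>R x + y) = t *\<^sub>R adj x + adj y" "adj (t *\<^sub>R \<Phi> x + \<Phi> y) = t *\<^sub>R adj (\<Phi> x) + adj (\<Phi> y)"
        using x y by (simp_all add: M.adj_add cl scaleR_scaleC M.adj_scaleC)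
      have "D (t *\<^sub>R x + y) (t *\<^sub>R x + y) = t *\<^sub>R t *\<^sub>R D x x + t *\<^sub>R (D x y + D y x) + D y y"
        using x y unfolding D_def
        by (simp add: Phi.map_add Phi.map_scaleR cl adjz)
           (simp add: blinfun_comp_linear Phi.map_add Phi.map_scaleR cl algebra_simps)
      then show ?thesis using Dpos[of "t *\<^sub>R x + y" v] x y cl
        by (simp add: D0 op_apply inner_add_right)
    qed
    then have "inner v (blinfun_apply (D x y + D y x) v) = 0" (is "?g = 0")
    proof -
      let ?c = "inner v (blinfun_apply (D y y) v)"
      assume *: "\<And>t. 0 \<le> t * ?g + ?c"
      show ?thesis
      proof (rule ccontr)
        assume "?g \<noteq> 0"
        then have "(- (?c + 1) / ?g) * ?g + ?c = - 1" by simp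
        with *[of "- (?c + 1) / ?g"] show False by simp
      qed
    qed
    then show "inner v (blinfun_apply (D x y + D y x) v) = inner v (blinfun_apply 0 v)"
      by (simp add: op_apply)
  qed simp
  have D_0: "D y x = 0" if y: "y \<in> M" for y
  proof -
    \<comment> \<open>Passing to \<open>\<i> *\<^sub>C y\<close> reverses the relative sign of the
      two cross terms; together with \<open>anti\<close> each of them vanishes.\<close>
    have "D x (\<i> *\<^sub>C y) = \<i> *\<^sub>C D x y" "D (\<i> *\<^sub>C y) x = (-\<i>) *\<^sub>C D y x"
      using x y unfolding D_def
      by (simp_all add: Phi.map_scaleC M.adj_scaleC cl comp_scaleC[OF M.bounded] scaleC_comp blinfun_comp_linear(7) scaleC_diff_right Phi.map_scaleC[of _ "-\<i>", simplified])
    with anti[OF M.scaleC_closed[OF y, of \<i>]] have "\<i> *\<^sub>C (D x y - D y x) = 0"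
      by (simp add: scaleC_diff_right)
    then have "D x y = D y x" by (simp add: scaleC_eq_0_iff)
    with anti[OF y] have "2 *\<^sub>R D y x = 0" by (simp add: scaleR_2)
    then show ?thesis by simp
  qed
  show ?thesis
    using D_0[OF M.adj_closed[OF y]] by (simp add: D_def M.adj_adj y Phi.map_adj M.adj_closed Phi.map_closed)
qed

section \<open>Iterates of the channel and excessive elements\<close>

lemma pow_closed: "x \<in> M \<Longrightarrow> (\<Phi> ^^ k) x \<in> M"
  by (induction k) (auto intro: Phi.map_closed)

lemma pow_diff: "x \<in> M \<Longrightarrow> y \<in> M \<Longrightarrow> (\<Phi> ^^ k) (x - y) = (\<Phi> ^^ k) x - (\<Phi> ^^ k) y"
  by (induction k) (auto simp: Phi.map_diff pow_closed)

lemma pow_scaleR: "x \<in> M \<Longrightarrow> (\<Phi> ^^ k) (r *\<^sub>R x) = r *\<^sub>R (\<Phi> ^^ k) x"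
  by (induction k) (auto simp: Phi.map_scaleR pow_closed)

lemma pow_fixed: "\<Phi> x = x \<Longrightarrow> (\<Phi> ^^ k) x = x"
  by (induction k) auto

lemma pow_sa: "x \<in> M \<Longrightarrow> self_adjoint x \<Longrightarrow> self_adjoint ((\<Phi> ^^ k) x)"
  by (induction k) (auto simp: Phi.map_sa pow_closed)

lemma pow_mono:
  assumes "x \<in> M" "self_adjoint x" "y \<in> M" "self_adjoint y"
    and "\<And>v. inner v (blinfun_apply x v) \<le> inner v (blinfun_apply y v)"
  shows "inner v (blinfun_apply ((\<Phi> ^^ k) x) v) \<le> inner v (blinfun_apply ((\<Phi> ^^ k) y) v)"
proof (induction k arbitrary: v)
  case (Suc k)
  show ?case
    using Phi.map_mono[OF pow_closed[OF assms(1)] pow_sa[OF assms(1,2)] pow_closed[OF assms(3)] pow_sa[OF assms(3,4)] Suc]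
    by simp
qed (use assms in simp)

text \<open>
  \<open>E \<circ> \<Phi>\<^sup>k\<close> is again a conditional expectation, and all conditional expectations are dominated by \<open>E / \<delta>\<close>.
\<close>

lemma E_pow_le:
  assumes "x \<in> M" "self_adjoint x" "\<And>v. 0 \<le> inner v (blinfun_apply x v)"
  shows "inner v (blinfun_apply (E ((\<Phi> ^^ k) x)) v) \<le> (1 / \<delta>) * inner v (blinfun_apply (E x) v)"
proof -
  have Ex: "E x \<in> N" "E x \<in> M" using E.map_closed assms(1) sub by auto
  have Esa: "self_adjoint (E x)" using E.map_sa assms by blast
  have dx: "\<delta> *\<^sub>R x \<in> M" "self_adjoint (\<delta> *\<^sub>R x)" using assms by (auto intro: M.scaleR_closed sa_scaleR)
  have "inner v (blinfun_apply ((\<Phi> ^^ k) (\<delta> *\<^sub>R x)) v) \<le> inner v (blinfun_apply ((\<Phi> ^^ k) (E x)) v)" for v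
    by (rule pow_mono[OF dx Ex(2) Esa]) (use pimsner_popa_inner[OF assms] in \<open>simp add: op_apply\<close>)
  then have "inner v (blinfun_apply ((\<Phi> ^^ k) (\<delta> *\<^sub>R x)) v) \<le> inner v (blinfun_apply (E x) v)" for v
    by (simp add: pow_fixed Phi_N Ex)
  from E.map_mono[OF pow_closed[OF dx(1)] pow_sa[OF dx] Ex(2) Esa this, of v]
  have "\<delta> * inner v (blinfun_apply (E ((\<Phi> ^^ k) x)) v) \<le> inner v (blinfun_apply (E x) v)"
    by (simp add: pow_scaleR E.map_scaleR assms pow_closed E_N Ex op_apply)
  then show ?thesis using \<delta> by (simp add: field_simps)
qed

text \<open>By the kernel condition \<open>\<Phi> p\<close> equals its compression by
  \<open>p\<close>; since \<open>\<Phi> p\<close> is at most 1, it is at most \<open>p\<close>, and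
  irreducibility applies with c = 1.\<close>

lemma sub_invariant_projection_in_N:
  assumes p: "p \<in> M" "projection_op p"
    and 0: "\<And>v. blinfun_apply p v = 0 \<Longrightarrow> blinfun_apply (\<Phi> p) v = 0"
  shows "p \<in> N"
proof -
  have psa: "self_adjoint p" using p projection_op_sa by blast
  have \<Phi>sa: "self_adjoint (\<Phi> p)" using Phi.map_sa p psa by blast
  have le: "inner v (blinfun_apply (\<Phi> p) v) \<le> (norm v)\<^sup>2" for v
  proof -
    have "inner v (blinfun_apply p v) \<le> inner v (blinfun_apply id_blinfun v)" for v
      using projection_op_inner[OF p(2), of v] projection_op_inner[OF projection_op_compl[OF p(2)], of v]
      by (simp add: op_apply inner_diff_right) (metis diff_ge_0_iff_ge zero_le_power2)
    from Phi.map_mono[OF p(1) psa M.id_closed sa_id this, of v]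
    show ?thesis by (simp add: Phi_id op_apply power2_norm_eq_inner)
  qed
  have "inner v (blinfun_apply (\<Phi> p) v) \<le> inner v (blinfun_apply p v)" for v
  proof -
    let ?w = "blinfun_apply p v"
    have "blinfun_apply (\<Phi> p) (v - ?w) = 0" by (rule 0) (simp add: op_linear projection_op_idem p)
    then have eq: "blinfun_apply (\<Phi> p) v = blinfun_apply (\<Phi> p) ?w" by (simp add: op_linear)
    have "inner v (blinfun_apply (\<Phi> p) v) = inner (blinfun_apply (\<Phi> p) v) ?w"
      unfolding sa_inner[OF \<Phi>sa, of v] by (simp only: eq)
    also have "\<dots> = inner ?w (blinfun_apply (\<Phi> p) ?w)" by (simp only: eq inner_commute)
    also have "\<dots> \<le> (norm ?w)\<^sup>2" by (rule le)
    finally show ?thesis by (simp add: projection_op_inner p)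
  qed
  then have "\<Phi> p \<le>\<^sub>o\<^sub>p 1 *\<^sub>R p" by (simp add: op_le_iff \<Phi>sa psa)
  then show ?thesis using irreducible p unfolding relatively_irreducible_def
    using zero_less_one by blast
qed

text \<open>
  The support \<open>s\<close> of an excessive \<open>S\<close> lies in \<open>N\<close> by irreducibility, so \<open>E (\<Phi>\<^sup>k s) = s\<close>; but
  if \<open>\<Phi>\<^sup>k S\<close> decreases to \<open>0\<close>, then \<open>E (\<Phi>\<^sup>k s)\<close> tends to \<open>0\<close>.
\<close>

lemma excessive_potential_eq_0:
  assumes S: "S \<in> M" "self_adjoint S" "\<And>v. 0 \<le> inner v (blinfun_apply S v)"
    and exc: "\<And>v. inner v (blinfun_apply (\<Phi> S) v) \<le> inner v (blinfun_apply S v)"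
    and lim: "\<And>v. (\<lambda>k. inner v (blinfun_apply (E ((\<Phi> ^^ k) S)) v)) \<longlonglongrightarrow> 0"
  shows "S = 0"
proof -
  define c where "c = norm S + 1"
  have c: "norm S \<le> c" "c > 0" by (auto simp: c_def add_nonneg_pos)
  define b where "b = id_blinfun - (1/c) *\<^sub>R S"
  interpret b: contraction_power b unfolding b_def by (rule M.contraction_power_of_positive[OF S(2,3) c])
  obtain p where p: "projection_op p" "strong_lim (op_power b) p" "strong_lim b.T (id_blinfun - p)"
      "b o\<^sub>L p = p" "\<And>v. blinfun_apply b v = v \<Longrightarrow> blinfun_apply p v = v"
    using b.limit by metis
  have bM: "b \<in> M" unfolding b_def using S by (intro M.diff_closed M.id_closed M.scaleR_closed)
  have pM: "p \<in> M" using M.contraction_power_limit_closed[OF b.contraction_power_axioms bM p(2)] .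
  define s where "s = id_blinfun - p"
  have s: "s \<in> M" "projection_op s" using pM p(1) by (auto simp: s_def intro: M.diff_closed M.id_closed projection_op_compl)
  have ssa: "self_adjoint s" using projection_op_sa s(2) .
  have TM: "b.T n \<in> M" for n unfolding b.T_def using bM by (intro M.diff_closed M.id_closed M.power_closed)
  have Ts: "strong_lim b.T s" using p(3) by (simp add: s_def)
  \<comment> \<open>\<open>T_bound\<close> with 1 - b = S / c. Through it the hypotheses on
    \<open>S\<close> reach the approximants of its support \<open>s\<close>.\<close>
  have Tle: "inner v (blinfun_apply (b.T n) v) \<le> inner v (blinfun_apply ((n / c) *\<^sub>R S) v)" for n v
    using b.T_bound[of v n] by (simp add: b_def op_apply)
  have nS: "(n / c) *\<^sub>R S \<in> M" "self_adjoint ((n / c) *\<^sub>R S)" for n :: nat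
    using S by (auto intro: M.scaleR_closed sa_scaleR)
  have "s \<in> N"
  proof (rule sub_invariant_projection_in_N[OF s])
    fix v assume "blinfun_apply s v = 0"
    then have "blinfun_apply p v = v" by (simp add: s_def op_apply)
    then have "blinfun_apply b v = v" using arg_cong[OF p(4), of "\<lambda>f. blinfun_apply f v"] by (simp add: op_apply)
    then have Sv: "blinfun_apply S v = 0" using c by (simp add: b_def op_apply)
    have "inner v (blinfun_apply (\<Phi> (b.T n)) v) \<le> 0" for n
    proof -
      have "inner v (blinfun_apply (\<Phi> (b.T n)) v) \<le> inner v (blinfun_apply (\<Phi> ((n / c) *\<^sub>R S)) v)"
        by (rule Phi.map_mono[OF TM b.T_sa nS Tle])
      also have "\<dots> = (n / c) * inner v (blinfun_apply (\<Phi> S) v)" by (simp add: Phi.map_scaleR S op_apply)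
      also have "\<dots> \<le> (n / c) * inner v (blinfun_apply S v)" using exc c by (intro mult_left_mono) auto
      finally show ?thesis by (simp add: Sv)
    qed
    then have le0: "inner v (blinfun_apply (\<Phi> s) v) \<le> 0"
      using strong_lim_le[OF Phi.map_strong_lim(2)[OF b.T_incseq TM Ts]] by blast
    have spos: "0 \<le> inner v (blinfun_apply s v)" for v by (simp add: projection_op_inner s)
    show "blinfun_apply (\<Phi> s) v = 0"
      using positive_op_inner_zero[OF Phi.map_nonneg[OF s(1) ssa spos]] le0 Phi.map_nonneg(2)[OF s(1) ssa spos, of v]
      by (meson order_antisym)
  qed
  \<comment> \<open>Split \<open>s\<close> into \<open>b.T n\<close> and a remainder. The first part
    is controlled by \<open>S\<close>, the remainder by \<open>E_pow_le\<close> uniformly in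
    \<open>k\<close>; so \<open>k\<close> can go to infinity for fixed \<open>n\<close>, and
    \<open>n\<close> afterwards.\<close>
  have main: "inner v (blinfun_apply s v) \<le> (n / c) * inner v (blinfun_apply (E ((\<Phi> ^^ k) S)) v)
      + (1 / \<delta>) * (inner v (blinfun_apply (E s) v) - inner v (blinfun_apply (E (b.T n)) v))" for n k v
  proof -
    have d: "s - b.T n \<in> M" "self_adjoint (s - b.T n)" using s TM ssa b.T_sa by (auto intro: M.diff_closed sa_diff)
    have dpos: "0 \<le> inner v (blinfun_apply (s - b.T n) v)" for v
      using sa_incseq_le_lim[OF b.T_incseq Ts, of v n] by (simp add: op_apply inner_diff_right)
    have "s = E ((\<Phi> ^^ k) s)" by (simp add: pow_fixed Phi_N E_N \<open>s \<in> N\<close>)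
    also have "\<dots> = E ((\<Phi> ^^ k) (b.T n)) + E ((\<Phi> ^^ k) (s - b.T n))"
      by (simp add: pow_diff E.map_diff pow_closed s TM)
    finally have "inner v (blinfun_apply s v) =
        inner v (blinfun_apply (E ((\<Phi> ^^ k) (b.T n))) v) + inner v (blinfun_apply (E ((\<Phi> ^^ k) (s - b.T n))) v)"
      by (metis blinfun.add_left inner_add_right)
    also have "inner v (blinfun_apply (E ((\<Phi> ^^ k) (b.T n))) v) \<le> inner v (blinfun_apply (E ((\<Phi> ^^ k) ((n / c) *\<^sub>R S))) v)"
      by (intro E.map_mono pow_mono pow_closed pow_sa TM b.T_sa nS Tle)
    also have "\<dots> = (n / c) * inner v (blinfun_apply (E ((\<Phi> ^^ k) S)) v)"
      by (simp add: pow_scaleR E.map_scaleR pow_closed S op_apply)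
    finally show ?thesis
      using E_pow_le[OF d dpos, of v k] by (simp add: E.map_diff s TM op_apply inner_diff_right)
  qed
  have main2: "inner v (blinfun_apply s v)
      \<le> (1 / \<delta>) * (inner v (blinfun_apply (E s) v) - inner v (blinfun_apply (E (b.T n)) v))" for n v
  proof (rule LIMSEQ_le_const)
    show "(\<lambda>k. (n / c) * inner v (blinfun_apply (E ((\<Phi> ^^ k) S)) v) + (1 / \<delta>) * (inner v (blinfun_apply (E s) v) - inner v (blinfun_apply (E (b.T n)) v)))
      \<longlonglongrightarrow> (1 / \<delta>) * (inner v (blinfun_apply (E s) v) - inner v (blinfun_apply (E (b.T n)) v))"
      using tendsto_add[OF tendsto_mult[OF tendsto_const lim[of v], of "n / c"] tendsto_const] by simp
  qed (use main in blast)
  have "inner v (blinfun_apply s v) \<le> 0" for v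
  proof (rule LIMSEQ_le_const)
    show "(\<lambda>n. (1 / \<delta>) * (inner v (blinfun_apply (E s) v) - inner v (blinfun_apply (E (b.T n)) v))) \<longlonglongrightarrow> 0"
      using tendsto_mult[OF tendsto_const tendsto_diff[OF tendsto_const
          strong_lim_inner[OF E.map_strong_lim(2)[OF b.T_incseq TM Ts]]], of "1 / \<delta>" "inner v (blinfun_apply (E s) v)" v v]
      by simp
  qed (use main2 in blast)
  then have "blinfun_apply s v = 0" for v using projection_op_inner[OF s(2), of v] by (metis norm_eq_zero power2_less_eq_zero_iff)
  then have "p = id_blinfun" by (auto intro!: blinfun_eqI simp: s_def op_apply)
  then have "b = id_blinfun" using p(4) by (simp add: blinfun_comp_linear)
  then show ?thesis using c by (simp add: b_def)
qed

lemma peripheral_schwarz_eq: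
  assumes x: "x \<in> M" and eig: "\<Phi> x = \<alpha> *\<^sub>C x" and \<alpha>: "cmod \<alpha> = 1"
  shows "\<Phi> (adj x o\<^sub>L x) = adj x o\<^sub>L x"
proof -
  define c where "c = adj x o\<^sub>L x"
  have c: "c \<in> M" "self_adjoint c" using x by (auto simp: c_def intro: M.adj_comp_self_closed M.adj_comp_self_sa)
  have c_le: "inner v (blinfun_apply c v) \<le> inner v (blinfun_apply (\<Phi> c) v)" for v
    using schwarz[OF x, of v] M.inner_adj_comp_self[OF x, of v]
    by (simp add: c_def eig scaleC_blinfun.rep_eq norm_scaleC \<alpha> del: blinfun_apply_blinfun_compose)
  define h where "h k = (\<Phi> ^^ k) c" for k
  have hM: "h k \<in> M" and hsa: "self_adjoint (h k)" for k
    using pow_closed pow_sa c by (auto simp: h_def)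
  have hinc: "sa_incseq h"
  proof (rule sa_incseqI[OF hsa])
    fix k v
    have "inner v (blinfun_apply ((\<Phi> ^^ k) c) v) \<le> inner v (blinfun_apply ((\<Phi> ^^ k) (\<Phi> c)) v)"
      by (rule pow_mono[OF c Phi.map_closed[OF c(1)] Phi.map_sa[OF c] c_le])
    then show "inner v (blinfun_apply (h k) v) \<le> inner v (blinfun_apply (h (Suc k)) v)"
      by (simp add: h_def funpow_swap1)
  qed
  have hle: "inner v (blinfun_apply (h k) v) \<le> norm c * (norm v)\<^sup>2" for k v
  proof -
    \<comment> \<open>A scalar dominating \<open>c\<close> lies in \<open>N\<close> and is therefore
      fixed by \<open>\<Phi>\<close>, so it dominates all iterates.\<close>
    have I: "norm c *\<^sub>R id_blinfun \<in> N" by (intro N.scaleR_closed N.id_closed)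
    have "inner v (blinfun_apply (h k) v) \<le> inner v (blinfun_apply ((\<Phi> ^^ k) (norm c *\<^sub>R id_blinfun)) v)"
      unfolding h_def
      by (rule pow_mono[OF c subsetD[OF sub I] sa_scaleR[OF sa_id]])
         (use inner_le_norm[of _ c] in \<open>simp add: op_apply power2_norm_eq_inner\<close>)
    then show ?thesis by (simp add: pow_fixed Phi_N[OF I] op_apply power2_norm_eq_inner)
  qed
  obtain g where g: "strong_lim h g" using sa_incseq_convergent[OF hinc hle] .
  have gM: "g \<in> M" using M.monotone_lim_closed[OF hinc hM g] .
  have gsa: "self_adjoint g" using strong_lim_sa[OF g hsa] .
  have "strong_lim (\<lambda>k. h (Suc k)) (\<Phi> g)"
    using Phi.map_strong_lim(2)[OF hinc hM g] by (simp add: h_def)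
  moreover have "strong_lim (\<lambda>k. h (Suc k)) g"
    using g unfolding strong_lim_def by (auto intro: LIMSEQ_Suc)
  ultimately have \<Phi>g: "\<Phi> g = g" by (rule strong_lim_unique)
  have "g - c = 0"
  proof (rule excessive_potential_eq_0)
    show "g - c \<in> M" "self_adjoint (g - c)" using gM gsa c by (auto intro: M.diff_closed sa_diff)
    show "0 \<le> inner v (blinfun_apply (g - c) v)" for v
      using sa_incseq_le_lim[OF hinc g, of v 0] by (simp add: h_def op_apply inner_diff_right)
    show "inner v (blinfun_apply (\<Phi> (g - c)) v) \<le> inner v (blinfun_apply (g - c) v)" for v
      using c_le[of v] by (simp add: Phi.map_diff gM c \<Phi>g op_apply inner_diff_right)
    \<comment> \<open>As \<open>g\<close> is fixed, the expression is the form of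
      \<open>E g - E (h k)\<close>, and normality of \<open>E\<close> applies along the increasing
      \<open>h\<close>.\<close>
    show "(\<lambda>k. inner v (blinfun_apply (E ((\<Phi> ^^ k) (g - c))) v)) \<longlonglongrightarrow> 0" for v
      using tendsto_diff[OF tendsto_const strong_lim_inner[OF E.map_strong_lim(2)[OF hinc hM g]],
          of "inner v (blinfun_apply (E g) v)" v v]
      by (simp add: pow_diff gM c pow_fixed \<Phi>g E.map_diff pow_closed op_apply inner_diff_right h_def)
  qed
  then show ?thesis using \<Phi>g by (simp add: c_def)
qed

end

section \<open>Eigenspaces\<close>

context irreducible_channel
begin

definition eigenspace :: "complex \<Rightarrow> ('h \<Rightarrow>\<^sub>L 'h) set" where
  "eigenspace \<alpha> = {x \<in> M. \<Phi> x = \<alpha> *\<^sub>C x}"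

lemma eigenspace_closed: "x \<in> eigenspace \<alpha> \<Longrightarrow> x \<in> M"
  and eigenspace_eq: "x \<in> eigenspace \<alpha> \<Longrightarrow> \<Phi> x = \<alpha> *\<^sub>C x"
  by (auto simp: eigenspace_def)

lemma eigenspace_scaleC: "x \<in> eigenspace \<alpha> \<Longrightarrow> c *\<^sub>C x \<in> eigenspace \<alpha>"
  by (auto simp: eigenspace_def M.scaleC_closed Phi.map_scaleC scaleC_scaleC mult.commute)

lemma Phi_comp_eigen:
  assumes x: "x \<in> eigenspace \<alpha>" and \<alpha>: "cmod \<alpha> = 1" and z: "z \<in> M"
  shows "\<Phi> (z o\<^sub>L x) = \<Phi> z o\<^sub>L \<Phi> x"
proof (rule multiplicative_domain[OF eigenspace_closed[OF x] z])
  have xM: "x \<in> M" using eigenspace_closed[OF x] .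
  have "cnj \<alpha> * \<alpha> = 1" using \<alpha> by (rule cnj_mult_unit)
  then have "adj (\<Phi> x) o\<^sub>L \<Phi> x = adj x o\<^sub>L x"
    using xM by (simp add: eigenspace_eq[OF x] M.adj_scaleC scaleC_comp comp_scaleC[OF M.bounded] M.adj_closed scaleC_scaleC)
  then show "\<Phi> (adj x o\<^sub>L x) = adj (\<Phi> x) o\<^sub>L \<Phi> x"
    using peripheral_schwarz_eq[OF xM eigenspace_eq[OF x] \<alpha>] by simp
qed

lemma eigenspace_comp:
  assumes x: "x \<in> eigenspace \<alpha>" and y: "y \<in> eigenspace \<beta>" and \<beta>: "cmod \<beta> = 1"
  shows "x o\<^sub>L y \<in> eigenspace (\<alpha> * \<beta>)"
  using Phi_comp_eigen[OF y \<beta> eigenspace_closed[OF x]] x y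
  by (auto simp: eigenspace_def M.comp_closed scaleC_comp comp_scaleC[OF M.bounded] scaleC_scaleC mult.commute)

lemma eigenspace_adj: "x \<in> eigenspace \<alpha> \<Longrightarrow> adj x \<in> eigenspace (cnj \<alpha>)"
  by (auto simp: eigenspace_def M.adj_closed Phi.map_adj M.adj_scaleC)

lemma N_subset_eigenspace: "y \<in> N \<Longrightarrow> y \<in> eigenspace 1"
  using sub Phi_N by (auto simp: eigenspace_def)

section \<open>Identification of the fixed points with \<open>N\<close>\<close>

lemma monotone_algebra_fixed: "monotone_algebra (eigenspace 1)"
proof
  show "id_blinfun \<in> eigenspace 1" using N_subset_eigenspace N.id_closed by blast
  show "x \<in> bounded_ops" if "x \<in> eigenspace 1" for x
    using M.bounded eigenspace_closed that by blast
  show "x + y \<in> eigenspace 1" if "x \<in> eigenspace 1" "y \<in> eigenspace 1" for x y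
    using that by (auto simp: eigenspace_def M.add_closed Phi.map_add)
  show "r *\<^sub>R x \<in> eigenspace 1" if "x \<in> eigenspace 1" for x r
    using that by (auto simp: eigenspace_def M.scaleR_closed Phi.map_scaleR)
  show "x o\<^sub>L y \<in> eigenspace 1" if "x \<in> eigenspace 1" "y \<in> eigenspace 1" for x y
    using eigenspace_comp[OF that] by simp
  fix T x assume T: "sa_incseq T" "\<And>n. T n \<in> eigenspace 1" "strong_lim T x"
  have TM: "T n \<in> M" and \<Phi>T: "\<Phi> (T n) = T n" for n using T(2) by (auto simp: eigenspace_def)
  have "strong_lim T (\<Phi> x)" using Phi.map_strong_lim(2)[OF T(1) TM T(3)] by (simp add: \<Phi>T)
  then have "\<Phi> x = x" using T(3) strong_lim_unique by blast
  then show "x \<in> eigenspace 1" using M.monotone_lim_closed[OF T(1) TM T(3)] by (simp add: eigenspace_def)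
qed

lemma fixed_projection_in_N:
  assumes "p \<in> eigenspace 1" "projection_op p"
  shows "p \<in> N"
  by (rule sub_invariant_projection_in_N) (use assms in \<open>auto simp: eigenspace_def\<close>)

text \<open>On the range of \<open>p\<close> the form of \<open>a\<close> lies between 0 and C, on
  the complement between -C and 0. Subtracting the midpoints C/2 and -C/2, that is \<open>d\<close>,
  leaves at most C/2 in absolute value; there are no cross terms because \<open>p\<close> commutes
  with \<open>a\<close>.\<close>

lemma fixed_halving:
  assumes a: "a \<in> eigenspace 1" "self_adjoint a" and C: "\<And>v. \<bar>inner v (blinfun_apply a v)\<bar> \<le> C * (norm v)\<^sup>2"
  shows "\<exists>d\<in>N. self_adjoint d \<and> (\<forall>v. \<bar>inner v (blinfun_apply (a - d) v)\<bar> \<le> (C / 2) * (norm v)\<^sup>2)"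
proof -
  interpret F: monotone_algebra "eigenspace 1" by (rule monotone_algebra_fixed)
  obtain p where p: "p \<in> eigenspace 1" "projection_op p" "p o\<^sub>L a = a o\<^sub>L p"
    "\<And>v. 0 \<le> inner v (blinfun_apply (a o\<^sub>L p) v)"
    "\<And>v. inner v (blinfun_apply (a o\<^sub>L (id_blinfun - p)) v) \<le> 0"
    using F.positive_part_projection[OF a] by blast
  have pN: "p \<in> N" using fixed_projection_in_N p by blast
  have psa: "self_adjoint p" using projection_op_sa p by blast
  define d where "d = (C / 2) *\<^sub>R (p - (id_blinfun - p))"
  have dN: "d \<in> N" unfolding d_def using pN by (intro N.scaleR_closed N.diff_closed N.id_closed)
  have dsa: "self_adjoint d" unfolding d_def using psa by (intro sa_scaleR sa_diff sa_id)
  have "\<bar>inner v (blinfun_apply (a - d) v)\<bar> \<le> (C / 2) * (norm v)\<^sup>2" for v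
  proof -
    let ?x = "blinfun_apply p v" and ?y = "v - blinfun_apply p v"
    have ap: "blinfun_apply a ?x = blinfun_apply p (blinfun_apply a v)"
      using arg_cong[OF p(3), of "\<lambda>f. blinfun_apply f v"] by simp
    have vx: "inner v (blinfun_apply a ?x) = inner ?x (blinfun_apply a ?x)"
      using sa_inner[OF psa, of v] ap projection_op_idem[OF p(2)] by metis
    have xy: "inner ?x (blinfun_apply a ?y) = 0"
      using vx sa_inner[OF a(2), of ?x v] sa_inner[OF a(2), of ?x ?x]
      by (simp add: op_linear inner_diff_right inner_commute)
    have vy: "inner v (blinfun_apply a ?y) = inner ?y (blinfun_apply a ?y)"
      using xy by (simp add: inner_diff_left)
    have 0: "0 \<le> inner ?x (blinfun_apply a ?x)" "inner ?y (blinfun_apply a ?y) \<le> 0"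
      using p(4)[of v] p(5)[of v] unfolding vx[symmetric] vy[symmetric] by (simp_all add: op_apply)
    have bd: "inner ?x (blinfun_apply a ?x) \<le> C * (norm ?x)\<^sup>2" "- (C * (norm ?y)\<^sup>2) \<le> inner ?y (blinfun_apply a ?y)"
      using C[of ?x] C[of ?y] by linarith+
    have xv: "inner v ?x = (norm ?x)\<^sup>2" by (rule projection_op_inner[OF p(2)])
    have "inner v ?y = (norm (blinfun_apply (id_blinfun - p) v))\<^sup>2"
      using projection_op_inner[OF projection_op_compl[OF p(2)], of v] by (simp add: op_apply)
    then have yv: "inner v ?y = (norm ?y)\<^sup>2" by (simp add: op_apply)
    have nv: "(norm v)\<^sup>2 = (norm ?x)\<^sup>2 + (norm ?y)\<^sup>2"
      unfolding xv[symmetric] yv[symmetric] by (simp add: inner_diff_right power2_norm_eq_inner)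
    have "inner v (blinfun_apply (a - d) v) =
        inner v (blinfun_apply a ?x) + inner v (blinfun_apply a ?y) - (C / 2) * (inner v ?x - inner v ?y)"
      by (simp add: d_def op_apply op_linear inner_diff_right inner_simps)
    also have "\<dots> = inner ?x (blinfun_apply a ?x) + inner ?y (blinfun_apply a ?y) - (C / 2) * ((norm ?x)\<^sup>2 - (norm ?y)\<^sup>2)"
      by (simp only: vx vy xv yv)
    finally have eq: "inner v (blinfun_apply (a - d) v) =
      inner ?x (blinfun_apply a ?x) + inner ?y (blinfun_apply a ?y) - (C / 2) * ((norm ?x)\<^sup>2 - (norm ?y)\<^sup>2)" .
    show ?thesis unfolding eq nv using 0 bd by (simp add: abs_le_iff algebra_simps)
  qed
  with dN dsa show ?thesis by blast
qed

text \<open>Irreducibility captures projections only. Iterated halving, a binary expansion with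
  coefficients in \<open>N\<close>, approximates \<open>a\<close> by sums of such projections, and
  \<open>N\<close> is strongly closed.\<close>

lemma fixed_sa_in_N:
  assumes a: "a \<in> eigenspace 1" "self_adjoint a"
  shows "a \<in> N"
proof -
  interpret F: monotone_algebra "eigenspace 1" by (rule monotone_algebra_fixed)
  define C where "C = norm a + 1"
  have C: "C > 0" by (simp add: C_def add_nonneg_pos)
  have "\<exists>d\<in>N. self_adjoint d \<and> (\<forall>v. \<bar>inner v (blinfun_apply (a - d) v)\<bar> \<le> (C / 2 ^ n) * (norm v)\<^sup>2)" for n
  proof (induction n)
    case 0
    have "\<bar>inner v (blinfun_apply a v)\<bar> \<le> C * (norm v)\<^sup>2" for v
      using inner_le_norm[of v a] inner_le_norm[of v "-a"]
      by (simp add: C_def op_apply distrib_right abs_le_iff add_increasing2)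
    then show ?case using N.zero_closed by (intro bexI[of _ 0]) auto
  next
    case (Suc n)
    then obtain d where d: "d \<in> N" "self_adjoint d"
      "\<And>v. \<bar>inner v (blinfun_apply (a - d) v)\<bar> \<le> (C / 2 ^ n) * (norm v)\<^sup>2" by blast
    have "a - d \<in> eigenspace 1" "self_adjoint (a - d)"
      using a d N_subset_eigenspace F.diff_closed sa_diff by auto
    from fixed_halving[OF this d(3)] obtain e where e: "e \<in> N" "self_adjoint e"
      "\<And>v. \<bar>inner v (blinfun_apply (a - d - e) v)\<bar> \<le> (C / 2 ^ n / 2) * (norm v)\<^sup>2" by blast
    show ?case
      using d e by (intro bexI[of _ "d + e"]) (auto simp: N.add_closed sa_add diff_diff_eq mult.commute)
  qed
  then obtain d where d: "\<And>n. d n \<in> N" "\<And>n. self_adjoint (d n)"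
    "\<And>n v. \<bar>inner v (blinfun_apply (a - d n) v)\<bar> \<le> (C / 2 ^ n) * (norm v)\<^sup>2" by metis
  have "strong_lim d a"
    unfolding strong_lim_def
  proof
    fix v
    have le: "norm (blinfun_apply (a - d n) v) \<le> (C / 2 ^ n) * norm v" for n
    proof (rule sa_norm_le[OF sa_diff[OF a(2) d(2)]])
      fix w
      from d(3)[where n=n and v=w] show "- (C / 2 ^ n) * (norm w)\<^sup>2 \<le> inner w (blinfun_apply (a - d n) w)"
        "inner w (blinfun_apply (a - d n) w) \<le> (C / 2 ^ n) * (norm w)\<^sup>2" by (simp_all add: abs_le_iff)
    qed (use C in simp)
    have "(\<lambda>n. (C * norm v) * (1/2) ^ n) \<longlonglongrightarrow> (C * norm v) * 0"
      by (intro tendsto_mult tendsto_const LIMSEQ_power_zero) simp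
    then have "(\<lambda>n. (C / 2 ^ n) * norm v) \<longlonglongrightarrow> 0" by (simp add: power_divide)
    then have "(\<lambda>n. blinfun_apply (a - d n) v) \<longlonglongrightarrow> 0"
      by (rule Lim_null_comparison[OF always_eventually, rotated]) (use le in blast)
    from tendsto_diff[OF tendsto_const this, of "blinfun_apply a v"]
    show "(\<lambda>n. blinfun_apply (d n) v) \<longlonglongrightarrow> blinfun_apply a v" by (simp add: op_apply)
  qed
  then show ?thesis using N.strong_lim_closed[where T = d, OF d(1)] F.bounded[OF a(1)] by blast
qed

lemma eigenspace_1: "eigenspace 1 = N"
proof
  show "N \<subseteq> eigenspace 1" using N_subset_eigenspace by blast
  show "eigenspace 1 \<subseteq> N"
  proof
    fix x assume x: "x \<in> eigenspace 1"
    interpret F: monotone_algebra "eigenspace 1" by (rule monotone_algebra_fixed)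
    have xM: "x \<in> M" by (rule eigenspace_closed[OF x])
    have ax: "adj x \<in> eigenspace 1" using eigenspace_adj[OF x] by simp
    have 1: "x + adj x \<in> N"
      by (rule fixed_sa_in_N[OF F.add_closed[OF x ax] M.sa_add_adj[OF xM]])
    have 2: "\<i> *\<^sub>C (x - adj x) \<in> N"
      by (rule fixed_sa_in_N[OF eigenspace_scaleC[OF F.diff_closed[OF x ax]] M.sa_i_diff_adj[OF xM]])
    have "(1/2) *\<^sub>C ((x + adj x) - \<i> *\<^sub>C \<i> *\<^sub>C (x - adj x)) = x"
    proof -
      have "(x + adj x) - \<i> *\<^sub>C \<i> *\<^sub>C (x - adj x) = 2 *\<^sub>C x"
        using scaleC_add_left[of 1 1 x] by (simp add: scaleC_scaleC)
      then show ?thesis by (simp add: scaleC_scaleC)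
    qed
    moreover have "(1/2) *\<^sub>C ((x + adj x) - \<i> *\<^sub>C \<i> *\<^sub>C (x - adj x)) \<in> N"
      by (intro N.scaleC_closed N.diff_closed 1 2)
    ultimately show "x \<in> N" by simp
  qed
qed

lemma eigen_adj_comp_self_in_N: "x \<in> eigenspace \<alpha> \<Longrightarrow> cmod \<alpha> = 1 \<Longrightarrow> adj x o\<^sub>L x \<in> N"
  using eigenspace_comp[OF eigenspace_adj, of x \<alpha> x \<alpha>] eigenspace_1 by (simp add: cnj_mult_unit)

lemma eigen_comp_adj_self_in_N:
  assumes "y \<in> eigenspace \<alpha>" "cmod \<alpha> = 1"
  shows "y o\<^sub>L adj y \<in> N"
  using eigen_adj_comp_self_in_N[OF eigenspace_adj[OF assms(1)]] assms eigenspace_closed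
  by (simp add: M.adj_adj)

text \<open>The phases cancel in \<open>adj x o\<^sub>L x\<close> and
  \<open>y o\<^sub>L adj y\<close>. These are nonzero elements of \<open>N\<close>, so primeness of
  the factor separates them by some \<open>d\<close>, which then also separates \<open>x\<close> and
  \<open>y\<close>.\<close>

lemma eigen_prime:
  assumes x: "x \<in> eigenspace \<alpha>" "x \<noteq> 0" "cmod \<alpha> = 1" and y: "y \<in> eigenspace \<beta>" "y \<noteq> 0" "cmod \<beta> = 1"
  obtains d where "d \<in> N" "x o\<^sub>L d o\<^sub>L y \<noteq> 0"
proof -
  note xM = eigenspace_closed[OF x(1)] and yM = eigenspace_closed[OF y(1)]
  have 1: "adj x o\<^sub>L x \<in> N" using eigen_adj_comp_self_in_N x by blast
  have 2: "y o\<^sub>L adj y \<in> N" using eigen_comp_adj_self_in_N y by blast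
  have "adj x o\<^sub>L x \<noteq> 0" using M.adj_comp_self_eq_0 xM x by blast
  moreover have "y o\<^sub>L adj y \<noteq> 0" using M.comp_adj_self_eq_0 yM y by blast
  ultimately obtain d where d: "d \<in> N" "adj x o\<^sub>L x o\<^sub>L d o\<^sub>L (y o\<^sub>L adj y) \<noteq> 0"
    using factor_prime[OF fac 1 2] by blast
  have "x o\<^sub>L d o\<^sub>L y \<noteq> 0"
  proof
    assume 0: "x o\<^sub>L d o\<^sub>L y = 0"
    have "adj x o\<^sub>L x o\<^sub>L d o\<^sub>L (y o\<^sub>L adj y) = adj x o\<^sub>L (x o\<^sub>L d o\<^sub>L y) o\<^sub>L adj y"
      by (simp add: blinfun_assoc)
    with d 0 show False by (simp add: blinfun_comp_linear)
  qed
  with d that show ?thesis by blast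
qed

end

section \<open>Averages of almost periodic sums\<close>

text \<open>For z \<noteq> 1 the geometric sums are bounded by 2 / |z - 1|, so their means
  vanish.\<close>

lemma mean_power_tendsto:
  assumes "cmod z = 1"
  shows "(\<lambda>K. (\<Sum>m<K. z ^ m) / of_nat K) \<longlonglongrightarrow> (if z = 1 then 1 else 0)"
proof (cases "z = 1")
  case True
  have "\<forall>\<^sub>F K in sequentially. (\<Sum>m<K. z ^ m) / of_nat K = 1"
    using eventually_gt_at_top[of 0] by eventually_elim (simp add: True)
  then show ?thesis using True by (simp add: tendsto_eventually)
next
  case False
  have "(\<lambda>K. (2 / cmod (z - 1)) * (1 / real K)) \<longlonglongrightarrow> (2 / cmod (z - 1)) * 0"
    by (intro tendsto_mult tendsto_const lim_1_over_n)
  then have lim: "(\<lambda>K. (2 / cmod (z - 1)) * (1 / real K)) \<longlonglongrightarrow> 0" by simp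
  have "norm ((\<Sum>m<K. z ^ m) / of_nat K) \<le> (2 / cmod (z - 1)) * (1 / real K)" for K
  proof -
    have "cmod (z ^ K - 1) \<le> 2"
      using norm_triangle_ineq4[of "z ^ K" 1] assms by (simp add: norm_power)
    then have "cmod (\<Sum>m<K. z ^ m) \<le> 2 / cmod (z - 1)"
      using False by (simp add: geometric_sum norm_divide divide_right_mono)
    from divide_right_mono[OF this, of "real K"] show ?thesis by (simp add: norm_divide)
  qed
  then have "(\<lambda>K. (\<Sum>m<K. z ^ m) / of_nat K) \<longlonglongrightarrow> 0"
    by (intro Lim_null_comparison[OF always_eventually lim] allI)
  then show ?thesis using False by simp
qed

lemma mean_double_sum_tendsto:
  fixes c :: "'i \<Rightarrow> 'i \<Rightarrow> complex"
  assumes "finite I" "inj_on \<beta> I" "\<And>i. i \<in> I \<Longrightarrow> cmod (\<beta> i) = 1"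
  shows "(\<lambda>K. (\<Sum>m<K. \<Sum>i\<in>I. \<Sum>j\<in>I. (cnj (\<beta> i) * \<beta> j) ^ m * c i j) / of_nat K) \<longlonglongrightarrow> (\<Sum>i\<in>I. c i i)"
proof -
  have eq: "(\<Sum>m<K. \<Sum>i\<in>I. \<Sum>j\<in>I. (cnj (\<beta> i) * \<beta> j) ^ m * c i j) / of_nat K
      = (\<Sum>i\<in>I. \<Sum>j\<in>I. ((\<Sum>m<K. (cnj (\<beta> i) * \<beta> j) ^ m) / of_nat K) * c i j)" for K
  proof -
    have "(\<Sum>m<K. \<Sum>i\<in>I. \<Sum>j\<in>I. (cnj (\<beta> i) * \<beta> j) ^ m * c i j)
        = (\<Sum>i\<in>I. \<Sum>j\<in>I. \<Sum>m<K. (cnj (\<beta> i) * \<beta> j) ^ m * c i j)"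
      by (subst sum.swap, intro sum.cong refl, subst sum.swap) simp
    then show ?thesis by (simp add: sum_divide_distrib sum_distrib_right)
  qed
  have unit: "(cnj (\<beta> i) * \<beta> j = 1) = (i = j)" if "i \<in> I" "j \<in> I" for i j
  proof
    assume 1: "cnj (\<beta> i) * \<beta> j = 1"
    have "\<beta> i * (cnj (\<beta> i) * \<beta> j) = (\<beta> i * cnj (\<beta> i)) * \<beta> j" by simp
    also have "\<beta> i * cnj (\<beta> i) = 1" using assms(3)[OF that(1)] by (simp add: complex_norm_square[symmetric])
    finally have "\<beta> i = \<beta> j" using 1 by simp
    then show "i = j" using assms(2) that by (simp add: inj_on_def)
  next
    assume "i = j" then show "cnj (\<beta> i) * \<beta> j = 1"
      using assms(3)[OF that(1)] complex_norm_square[of "\<beta> i"] by (simp add: mult.commute)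
  qed
  have "(\<lambda>K. \<Sum>i\<in>I. \<Sum>j\<in>I. ((\<Sum>m<K. (cnj (\<beta> i) * \<beta> j) ^ m) / of_nat K) * c i j)
      \<longlonglongrightarrow> (\<Sum>i\<in>I. \<Sum>j\<in>I. (if cnj (\<beta> i) * \<beta> j = 1 then 1 else 0) * c i j)"
    by (intro tendsto_sum tendsto_mult tendsto_const mean_power_tendsto) (simp add: norm_mult assms(3))
  also have "(\<Sum>i\<in>I. \<Sum>j\<in>I. (if cnj (\<beta> i) * \<beta> j = 1 then 1 else 0) * c i j) = (\<Sum>i\<in>I. c i i)"
  proof (intro sum.cong refl)
    fix i assume i: "i \<in> I"
    have "(\<Sum>j\<in>I. (if cnj (\<beta> i) * \<beta> j = 1 then 1 else 0) * c i j) = (\<Sum>j\<in>I. if j = i then c i j else 0)"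
      by (intro sum.cong refl) (use unit[OF i] in auto)
    then show "(\<Sum>j\<in>I. (if cnj (\<beta> i) * \<beta> j = 1 then 1 else 0) * c i j) = c i i"
      using assms(1) i by simp
  qed
  finally show ?thesis unfolding eq .
qed

text \<open>A lower bound valid for every m survives averaging over m, and the mean retains only the
  diagonal because distinct phases are orthogonal.\<close>

lemma mean_double_sum_ge:
  fixes c :: "'i \<Rightarrow> 'i \<Rightarrow> complex"
  assumes I: "finite I" "inj_on \<beta> I" "\<And>i. i \<in> I \<Longrightarrow> cmod (\<beta> i) = 1"
    and le: "\<And>m. r \<le> Re (\<Sum>i\<in>I. \<Sum>j\<in>I. (cnj (\<beta> i) * \<beta> j) ^ m * c i j)"
  shows "r \<le> Re (\<Sum>i\<in>I. c i i)"
proof (rule LIMSEQ_le_const)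
  show "(\<lambda>K. Re ((\<Sum>m<K. \<Sum>i\<in>I. \<Sum>j\<in>I. (cnj (\<beta> i) * \<beta> j) ^ m * c i j) / of_nat K)) \<longlonglongrightarrow> Re (\<Sum>i\<in>I. c i i)"
    by (intro tendsto_Re mean_double_sum_tendsto I)
  show "\<exists>K0. \<forall>K\<ge>K0. r \<le> Re ((\<Sum>m<K. \<Sum>i\<in>I. \<Sum>j\<in>I. (cnj (\<beta> i) * \<beta> j) ^ m * c i j) / of_nat K)"
  proof (intro exI[of _ 1] allI impI)
    fix K :: nat assume K: "1 \<le> K"
    have "r * K \<le> (\<Sum>m<K. Re (\<Sum>i\<in>I. \<Sum>j\<in>I. (cnj (\<beta> i) * \<beta> j) ^ m * c i j))"
      using sum_mono[of "{..<K}" "\<lambda>_. r"] le by (simp add: mult.commute)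
    then show "r \<le> Re ((\<Sum>m<K. \<Sum>i\<in>I. \<Sum>j\<in>I. (cnj (\<beta> i) * \<beta> j) ^ m * c i j) / of_nat K)"
      using K by (simp add: Re_divide_of_nat le_divide_eq)
  qed
qed

context irreducible_channel
begin

section \<open>The Pimsner--Popa inequality on the span of the eigenspaces\<close>

text \<open>
  The twisted sums \<open>A m\<close> are moved by \<open>\<Phi>\<close> to \<open>A (m - 1)\<close>, so the Pimsner--Popa bound of \<open>A m\<close>
  is inherited by \<open>A 0\<close>; averaging over \<open>m\<close> kills the off-diagonal terms.
\<close>

lemma eigen_sum_norm_le:
  assumes I: "finite I" "inj_on \<alpha> I" "\<And>i. i \<in> I \<Longrightarrow> cmod (\<alpha> i) = 1"
    and y: "\<And>i. i \<in> I \<Longrightarrow> y i \<in> eigenspace (\<alpha> i)"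
  shows "\<delta> * (norm (\<Sum>i\<in>I. blinfun_apply (y i) v))\<^sup>2 \<le> (\<Sum>i\<in>I. (norm (blinfun_apply (y i) v))\<^sup>2)"
proof -
  have yM: "y i \<in> M" if "i \<in> I" for i using y[OF that] eigenspace_closed by blast
  \<comment> \<open>The conjugate powers are chosen so that the factor \<open>\<alpha> i\<close>
    produced by \<open>\<Phi>\<close> lowers the exponent by one.\<close>
  define A where "A m = (\<Sum>i\<in>I. cnj (\<alpha> i) ^ m *\<^sub>C y i)" for m
  have sM: "cnj (\<alpha> i) ^ m *\<^sub>C y i \<in> M" if "i \<in> I" for i m using M.scaleC_closed yM that by blast
  have AM: "A m \<in> M" for m unfolding A_def by (intro M.sum_closed sM)
  have \<Phi>A: "\<Phi> (A (Suc m)) = A m" for m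
  proof -
    have "\<Phi> (A (Suc m)) = (\<Sum>i\<in>I. \<Phi> (cnj (\<alpha> i) ^ Suc m *\<^sub>C y i))"
      unfolding A_def by (rule Phi.map_sum[OF sM])
    also have "\<dots> = A m"
      unfolding A_def
    proof (intro sum.cong refl)
      fix i assume i: "i \<in> I"
      have "cnj (\<alpha> i) ^ Suc m * \<alpha> i = cnj (\<alpha> i) ^ m" using cnj_mult_unit[OF I(3)[OF i]] by (simp add: mult_ac)
      then show "\<Phi> (cnj (\<alpha> i) ^ Suc m *\<^sub>C y i) = cnj (\<alpha> i) ^ m *\<^sub>C y i"
        by (simp only: Phi.map_scaleC[OF yM[OF i]] eigenspace_eq[OF y[OF i]] scaleC_scaleC)
    qed
    finally show ?thesis .
  qed
  \<comment> \<open>In \<open>Phi_comp_eigen\<close> the left factor is arbitrary, so the product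
    rule is additive in the right factor and extends to sums of eigenoperators.\<close>
  have \<Phi>mult: "\<Phi> (z o\<^sub>L A m) = \<Phi> z o\<^sub>L \<Phi> (A m)" if z: "z \<in> M" for z m
  proof -
    have sum_comp: "z o\<^sub>L (\<Sum>i\<in>I. f i) = (\<Sum>i\<in>I. z o\<^sub>L f i)" for z :: "'h \<Rightarrow>\<^sub>L 'h" and f
      by (rule blinfun_eqI) (simp add: op_apply op_linear)
    have zs: "z o\<^sub>L (cnj (\<alpha> i) ^ m *\<^sub>C y i) \<in> M" if "i \<in> I" for i using M.comp_closed z sM that by blast
    have "\<Phi> (z o\<^sub>L A m) = (\<Sum>i\<in>I. \<Phi> (z o\<^sub>L (cnj (\<alpha> i) ^ m *\<^sub>C y i)))"
      unfolding A_def sum_comp by (rule Phi.map_sum[OF zs])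
    also have "\<dots> = (\<Sum>i\<in>I. \<Phi> z o\<^sub>L \<Phi> (cnj (\<alpha> i) ^ m *\<^sub>C y i))"
      by (intro sum.cong refl Phi_comp_eigen[OF eigenspace_scaleC[OF y]] I z)
    also have "\<dots> = \<Phi> z o\<^sub>L \<Phi> (A m)"
      unfolding sum_comp[symmetric] A_def by (simp add: Phi.map_sum[OF sM])
    finally show ?thesis .
  qed
  define B where "B m = adj (A m) o\<^sub>L A m" for m
  have B: "B m \<in> M" "self_adjoint (B m)" for m
    using AM M.adj_comp_self_closed M.adj_comp_self_sa by (auto simp: B_def)
  have Bv: "inner v (blinfun_apply (B m) v) = (norm (blinfun_apply (A m) v))\<^sup>2" for m v
    unfolding B_def by (rule M.inner_adj_comp_self[OF AM])
  have \<Phi>B: "\<Phi> (B (Suc m)) = B m" for m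
    unfolding B_def by (simp add: \<Phi>mult AM M.adj_closed Phi.map_adj \<Phi>A)
  have powB: "(\<Phi> ^^ k) (B (k + m)) = B m" for k m
    by (induction k arbitrary: m) (auto simp: funpow_swap1 \<Phi>B simp del: funpow.simps(2) simp: funpow_Suc_right)
  \<comment> \<open>Apply \<open>\<Phi> ^^ m\<close> to the inequality for \<open>B m\<close>: it
    carries \<open>B m\<close> to \<open>B 0\<close> but fixes \<open>E (B m)\<close>, which lies in
    \<open>N\<close>.\<close>
  have main: "\<delta> * (norm (blinfun_apply (A 0) v))\<^sup>2 \<le> inner v (blinfun_apply (E (B m)) v)" for m
  proof -
    have Ex: "E (B m) \<in> N" "E (B m) \<in> M" using E.map_closed B sub by auto
    have dB: "\<delta> *\<^sub>R B m \<in> M" "self_adjoint (\<delta> *\<^sub>R B m)" using B by (auto intro: M.scaleR_closed sa_scaleR)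
    have "inner v (blinfun_apply ((\<Phi> ^^ m) (\<delta> *\<^sub>R B m)) v) \<le> inner v (blinfun_apply ((\<Phi> ^^ m) (E (B m))) v)"
    proof (rule pow_mono[OF dB Ex(2) E.map_sa[OF B]])
      show "inner v (blinfun_apply (\<delta> *\<^sub>R B m) v) \<le> inner v (blinfun_apply (E (B m)) v)" for v
        using pimsner_popa_inner[OF B, of m v] by (simp add: Bv blinfun.scaleR_left)
    qed
    then show ?thesis
      using powB[of m 0] by (simp add: pow_scaleR B pow_fixed Phi_N Ex Bv blinfun.scaleR_left)
  qed
  have EB: "cinner v (blinfun_apply (E (B m)) v) =
      (\<Sum>i\<in>I. \<Sum>j\<in>I. (cnj (cnj (\<alpha> i)) * cnj (\<alpha> j)) ^ m * cinner v (blinfun_apply (E (adj (y i) o\<^sub>L y j)) v))" for m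
  proof -
    have "B m = (\<Sum>i\<in>I. \<Sum>j\<in>I. (cnj (cnj (\<alpha> i)) * cnj (\<alpha> j)) ^ m *\<^sub>C (adj (y i) o\<^sub>L y j))"
    proof (rule blinfun_eqI)
      fix w
      have adjA: "adj (A m) = (\<Sum>i\<in>I. cnj (cnj (\<alpha> i)) ^ m *\<^sub>C adj (y i))"
        unfolding A_def by (subst M.adj_sum[OF sM]) (simp_all add: M.adj_scaleC yM cong: sum.cong)
      show "blinfun_apply (B m) w = blinfun_apply (\<Sum>i\<in>I. \<Sum>j\<in>I. (cnj (cnj (\<alpha> i)) * cnj (\<alpha> j)) ^ m *\<^sub>C (adj (y i) o\<^sub>L y j)) w"
        unfolding B_def adjA
        by (simp add: A_def op_apply op_linear scaleC_sum_right op_scaleC[OF M.bounded[OF M.adj_closed[OF yM]]] scaleC_scaleC power_mult_distrib cong: sum.cong)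
           (rule sum.swap)
    qed
    moreover have cl: "(cnj (cnj (\<alpha> i)) * cnj (\<alpha> j)) ^ m *\<^sub>C (adj (y i) o\<^sub>L y j) \<in> M" if "i \<in> I" "j \<in> I" for i j
      using that by (intro M.scaleC_closed M.comp_closed M.adj_closed yM)
    ultimately have "E (B m) = (\<Sum>i\<in>I. \<Sum>j\<in>I. E ((cnj (cnj (\<alpha> i)) * cnj (\<alpha> j)) ^ m *\<^sub>C (adj (y i) o\<^sub>L y j)))"
      by (simp only:) (subst E.map_sum, force intro: M.sum_closed, intro sum.cong refl E.map_sum, force)
    also have "\<dots> = (\<Sum>i\<in>I. \<Sum>j\<in>I. (cnj (cnj (\<alpha> i)) * cnj (\<alpha> j)) ^ m *\<^sub>C E (adj (y i) o\<^sub>L y j))"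
      by (intro sum.cong refl E.map_scaleC M.comp_closed M.adj_closed yM)
    finally show ?thesis by (simp add: blinfun.sum_left scaleC_blinfun.rep_eq cinner_sum_right cinner_scaleC_right)
  qed
  have "\<delta> * (norm (blinfun_apply (A 0) v))\<^sup>2 \<le> Re (\<Sum>i\<in>I. cinner v (blinfun_apply (E (adj (y i) o\<^sub>L y i)) v))"
  proof (rule mean_double_sum_ge[where \<beta> = "\<lambda>i. cnj (\<alpha> i)"
        and c = "\<lambda>i j. cinner v (blinfun_apply (E (adj (y i) o\<^sub>L y j)) v)"])
    show "inj_on (\<lambda>i. cnj (\<alpha> i)) I" using I(2) by (auto simp: inj_on_def)
    show "\<delta> * (norm (blinfun_apply (A 0) v))\<^sup>2 \<le> Re (\<Sum>i\<in>I. \<Sum>j\<in>I. (cnj (cnj (\<alpha> i)) * cnj (\<alpha> j)) ^ m * cinner v (blinfun_apply (E (adj (y i) o\<^sub>L y j)) v))" for m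
      using main[of m] unfolding EB[symmetric] Re_cinner .
  qed (use I in auto)
  \<comment> \<open>The diagonal products have phase 1, hence lie in \<open>N\<close> and are fixed
    by \<open>E\<close>.\<close>
  also have "\<dots> = (\<Sum>i\<in>I. (norm (blinfun_apply (y i) v))\<^sup>2)"
    unfolding Re_sum Re_cinner
  proof (intro sum.cong refl)
    fix i assume i: "i \<in> I"
    show "inner v (blinfun_apply (E (adj (y i) o\<^sub>L y i)) v) = (norm (blinfun_apply (y i) v))\<^sup>2"
      unfolding E_N[OF eigen_adj_comp_self_in_N[OF y[OF i] I(3)[OF i]]] by (rule M.inner_adj_comp_self[OF yM[OF i]])
  qed
  finally show ?thesis by (simp add: A_def blinfun.sum_left)
qed

section \<open>Finiteness of the set of phases\<close>

definition phases :: "complex set" where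
  "phases = {\<alpha>. cmod \<alpha> = 1 \<and> (\<exists>x\<in>eigenspace \<alpha>. x \<noteq> 0)}"

lemma eigenspace_comp_N:
  assumes "x \<in> eigenspace \<alpha>" "d \<in> N"
  shows "x o\<^sub>L d \<in> eigenspace \<alpha>"
  using eigenspace_comp[OF assms(1) N_subset_eigenspace[OF assms(2)]] by simp

lemma eigenspace_N_comp:
  assumes "x \<in> eigenspace \<alpha>" "d \<in> N" "cmod \<alpha> = 1"
  shows "d o\<^sub>L x \<in> eigenspace \<alpha>"
  using eigenspace_comp[OF N_subset_eigenspace[OF assms(2)] assms(1,3)] by simp

lemma projection_comp_flip:
  assumes "projection_op p" "projection_op q" "p o\<^sub>L q = q"
  shows "q o\<^sub>L p = q"
proof -
  have "is_adjoint (q o\<^sub>L p) (p o\<^sub>L q)" "is_adjoint q q"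
    using assms(1,2) is_adjoint_comp unfolding projection_op_def self_adjoint_def by auto
  with assms(3) show ?thesis using is_adjoint_unique by metis
qed

text \<open>
  Without minimal projections there are eigenoperators \<open>y i\<close> of any finitely many phases with
  orthogonal supports and nested ranges, hence a vector on which they all take the same value;
  this contradicts \<open>eigen_sum_norm_le\<close>.
\<close>

lemma finite_phases_nonatomic:
  assumes nonatomic: "\<And>q. q \<in> N \<Longrightarrow> projection_op q \<Longrightarrow> q \<noteq> 0 \<Longrightarrow>
      \<exists>r\<in>N. projection_op r \<and> q o\<^sub>L r = r \<and> r \<noteq> 0 \<and> r \<noteq> q"
    and nz: "id_blinfun \<noteq> (0 :: 'h \<Rightarrow>\<^sub>L 'h)"
  shows "finite phases"
proof (rule ccontr)
  assume "infinite phases"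
  then obtain \<alpha> :: "nat \<Rightarrow> complex" where inj: "inj \<alpha>" and \<alpha>: "range \<alpha> \<subseteq> phases"
    using infinite_countable_subset by blast
  have unit: "cmod (\<alpha> i) = 1" for i using \<alpha> by (auto simp: phases_def)
  have "\<forall>i. \<exists>x\<in>eigenspace (\<alpha> i). x \<noteq> 0" using \<alpha> by (auto simp: phases_def)
  then obtain x where x: "\<And>i. x i \<in> eigenspace (\<alpha> i)" "\<And>i. x i \<noteq> 0" by metis
  have "\<exists>q. \<forall>n. (q n \<in> N \<and> projection_op (q n) \<and> q n \<noteq> 0) \<and> (q n o\<^sub>L q (Suc n) = q (Suc n) \<and> q (Suc n) \<noteq> q n)"
  proof (rule dependent_nat_choice)
    show "\<exists>q. q \<in> N \<and> projection_op q \<and> q \<noteq> 0"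
      using nz N.id_closed by (intro exI[of _ id_blinfun]) (auto simp: projection_op_def blinfun_comp_linear)
    show "\<exists>r. (r \<in> N \<and> projection_op r \<and> r \<noteq> 0) \<and> (q o\<^sub>L r = r \<and> r \<noteq> q)"
      if "q \<in> N \<and> projection_op q \<and> q \<noteq> 0" for q using nonatomic that by blast
  qed
  then obtain q where q: "\<And>n. q n \<in> N" "\<And>n. projection_op (q n)"
    "\<And>n. q n o\<^sub>L q (Suc n) = q (Suc n)" "\<And>n. q (Suc n) \<noteq> q n" by blast
  have qq: "q i o\<^sub>L q j = q j" if "i \<le> j" for i j
    using that
  proof (induction j rule: dec_induct)
    case base show ?case using q(2) by (simp add: projection_op_def)
  next
    case (step n) then show ?case using q(3)[of n] by (metis blinfun_assoc)
  qed
  have qq': "q j o\<^sub>L q i = q j" if "i \<le> j" for i j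
    using projection_comp_flip[OF q(2) q(2) qq[OF that]] .
  \<comment> \<open>The gaps of a strictly decreasing chain: nonzero, mutually orthogonal
    projections, one for each phase.\<close>
  define p where "p n = q n - q (Suc n)" for n
  have pN: "p n \<in> N" for n unfolding p_def by (intro N.diff_closed q)
  have p0: "p n \<noteq> 0" for n using q(4)[of n] by (simp add: p_def)
  have pp: "p i o\<^sub>L p j = (if i = j then p i else 0)" for i j
  proof (cases i j rule: linorder_cases)
    case less then show ?thesis by (simp add: p_def blinfun_comp_linear qq)
  next
    case equal then show ?thesis by (simp add: p_def blinfun_comp_linear qq qq')
  next
    case greater then show ?thesis by (simp add: p_def blinfun_comp_linear qq')
  qed
  have "\<exists>y. \<forall>n. (y n \<in> eigenspace (\<alpha> n) \<and> y n \<noteq> 0 \<and> y n o\<^sub>L p n = y n) \<and> (\<exists>g. y (Suc n) = y n o\<^sub>L g)"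
  proof (rule dependent_nat_choice)
    obtain d where d: "d \<in> N" "x 0 o\<^sub>L d o\<^sub>L p 0 \<noteq> 0"
      using eigen_prime[OF x unit N_subset_eigenspace[OF pN] p0] by auto
    show "\<exists>y. y \<in> eigenspace (\<alpha> 0) \<and> y \<noteq> 0 \<and> y o\<^sub>L p 0 = y"
      using d by (intro exI[of _ "x 0 o\<^sub>L d o\<^sub>L p 0"])
        (auto simp: blinfun_assoc pp intro!: eigenspace_comp_N x N.comp_closed pN)
  next
    fix y n assume y: "y \<in> eigenspace (\<alpha> n) \<and> y \<noteq> 0 \<and> y o\<^sub>L p n = y"
    have yM: "y \<in> M" using y eigenspace_closed by blast
    \<comment> \<open>Multiplying by \<open>y\<close> alone on the left would change the phase.
      \<open>y o\<^sub>L adj y\<close> has phase 1, yet its range is inside that of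
      \<open>y\<close>, which keeps the ranges nested.\<close>
    have ayy: "y o\<^sub>L adj y \<in> N" using eigen_comp_adj_self_in_N y unit by blast
    have ay0: "y o\<^sub>L adj y \<noteq> 0" using M.comp_adj_self_eq_0 yM y by blast
    obtain d where d: "d \<in> N" "y o\<^sub>L adj y o\<^sub>L d o\<^sub>L x (Suc n) \<noteq> 0"
      using eigen_prime[OF N_subset_eigenspace[OF ayy] ay0 _ x unit] by auto
    have e: "y o\<^sub>L adj y o\<^sub>L d o\<^sub>L x (Suc n) \<in> eigenspace (\<alpha> (Suc n))"
      by (intro eigenspace_N_comp x unit N.comp_closed[OF ayy d(1)])
    obtain d' where d': "d' \<in> N" "y o\<^sub>L adj y o\<^sub>L d o\<^sub>L x (Suc n) o\<^sub>L d' o\<^sub>L p (Suc n) \<noteq> 0"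
      using eigen_prime[OF e d(2) unit N_subset_eigenspace[OF pN] p0] by auto
    let ?y = "y o\<^sub>L adj y o\<^sub>L d o\<^sub>L x (Suc n) o\<^sub>L d' o\<^sub>L p (Suc n)"
    have "?y \<in> eigenspace (\<alpha> (Suc n))" by (intro eigenspace_comp_N e d' pN)
    moreover have "?y o\<^sub>L p (Suc n) = ?y" by (simp add: blinfun_assoc pp)
    moreover have "?y = y o\<^sub>L (adj y o\<^sub>L d o\<^sub>L x (Suc n) o\<^sub>L d' o\<^sub>L p (Suc n))" by (simp add: blinfun_assoc)
    ultimately show "\<exists>y'. (y' \<in> eigenspace (\<alpha> (Suc n)) \<and> y' \<noteq> 0 \<and> y' o\<^sub>L p (Suc n) = y') \<and> (\<exists>g. y' = y o\<^sub>L g)"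
      using d'(2) by blast
  qed
  then obtain y g where y: "\<And>n. y n \<in> eigenspace (\<alpha> n)" "\<And>n. y n \<noteq> 0" "\<And>n. y n o\<^sub>L p n = y n"
    and g: "\<And>n. y (Suc n) = y n o\<^sub>L g n" by metis
  have nested: "\<exists>h. y j = y i o\<^sub>L h" if "i \<le> j" for i j
    using that
  proof (induction j rule: dec_induct)
    case base show ?case by (intro exI[of _ id_blinfun]) (simp add: blinfun_comp_linear)
  next
    case (step n) then show ?case using g[of n] by (metis blinfun_assoc)
  qed
  obtain n :: nat where n: "1 / \<delta> < n" using reals_Archimedean2 by blast
  obtain v where v: "blinfun_apply (y n) v \<noteq> 0" using y(2)[of n] by (metis blinfun_eqI blinfun.zero_left)
  \<comment> \<open>A nonzero vector in the smallest of the nested ranges, hence a value of every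
    \<open>y i\<close> with i \<le> n.\<close>
  define w where "w = blinfun_apply (y n) v"
  have "\<forall>i\<in>{..n}. \<exists>u. blinfun_apply (y i) u = w"
  proof
    fix i assume "i \<in> {..n}"
    then obtain h where "y n = y i o\<^sub>L h" using nested[of i n] by auto
    then have "blinfun_apply (y i) (blinfun_apply h v) = w" by (simp add: w_def)
    then show "\<exists>u. blinfun_apply (y i) u = w" ..
  qed
  then obtain u where u: "\<And>i. i \<in> {..n} \<Longrightarrow> blinfun_apply (y i) (u i) = w" by metis
  \<comment> \<open>Orthogonality of the supports glues the separate preimages \<open>u j\<close>
    into a common one.\<close>
  define \<xi> where "\<xi> = (\<Sum>j\<le>n. blinfun_apply (p j) (u j))"
  have y\<xi>: "blinfun_apply (y i) \<xi> = w" if i: "i \<in> {..n}" for i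
  proof -
    have yp: "blinfun_apply (y i) z = blinfun_apply (y i) (blinfun_apply (p i) z)" for z
      by (subst y(3)[of i, symmetric]) simp
    have ppz: "blinfun_apply (p i) (blinfun_apply (p j) z) = (if i = j then blinfun_apply (p i) z else 0)" for j z
      using arg_cong[OF pp[of i j], of "\<lambda>f. blinfun_apply f z"] by (simp split: if_splits)
    have "blinfun_apply (p i) \<xi> = (\<Sum>j\<le>n. if i = j then blinfun_apply (p i) (u j) else 0)"
      by (simp add: \<xi>_def op_linear ppz)
    also have "\<dots> = blinfun_apply (p i) (u i)" using i by simp
    finally show ?thesis using yp[of \<xi>] yp[of "u i"] u[OF i] by simp
  qed
  have "\<delta> * (norm (\<Sum>i\<le>n. blinfun_apply (y i) \<xi>))\<^sup>2 \<le> (\<Sum>i\<le>n. (norm (blinfun_apply (y i) \<xi>))\<^sup>2)"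
    by (rule eigen_sum_norm_le[where \<alpha> = \<alpha>]) (use inj unit y in \<open>auto intro: inj_on_subset\<close>)
  also have "(\<Sum>i\<le>n. blinfun_apply (y i) \<xi>) = real (Suc n) *\<^sub>R w"
    using y\<xi> by (simp add: sum_constant_scaleR)
  also have "(\<Sum>i\<le>n. (norm (blinfun_apply (y i) \<xi>))\<^sup>2) = real (Suc n) * (norm w)\<^sup>2"
    using y\<xi> by simp
  \<comment> \<open>The left side of the inequality is quadratic in the number of phases and the
    right side linear, so \<delta> times this number is at most 1.\<close>
  finally have "real (Suc n) * ((norm w)\<^sup>2 * (\<delta> * real (Suc n))) \<le> real (Suc n) * ((norm w)\<^sup>2 * 1)"
    by (simp add: power_mult_distrib power2_eq_square mult_ac)
  then have "\<delta> * real (Suc n) \<le> 1" using v by (simp add: w_def)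
  moreover have "1 < \<delta> * real n" using n \<delta> by (simp add: field_simps)
  moreover have "\<delta> * real n \<le> \<delta> * real (Suc n)" using \<delta> by simp
  ultimately show False by linarith
qed

text \<open>For each real r the positive spectral projection of \<open>a - r *\<^sub>R q\<close>,
  cut down by \<open>q\<close>, is 0 or \<open>q\<close>; so \<open>a\<close> is comparable with
  every multiple of \<open>q\<close>. The supremum \<open>t\<close> of the multiples below
  \<open>a\<close> is then also a multiple above it.\<close>

lemma minimal_projection_corner:
  assumes q: "q \<in> N" "projection_op q" "q \<noteq> 0"
    and min: "\<And>r. r \<in> N \<Longrightarrow> projection_op r \<Longrightarrow> q o\<^sub>L r = r \<Longrightarrow> r = 0 \<or> r = q"
    and a: "a \<in> N" "self_adjoint a" "q o\<^sub>L a = a"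
  obtains t :: real where "a = t *\<^sub>R q"
proof -
  have qsa: "self_adjoint q" using projection_op_sa q(2) .
  have qidem: "q o\<^sub>L q = q" using q(2) by (simp add: projection_op_def)
  have aq: "a o\<^sub>L q = a"
    using is_adjoint_comp[of q q a a] is_adjoint_unique[of "a o\<^sub>L q" a a] a qsa
    by (simp add: self_adjoint_def)
  \<comment> \<open>Spectral projections taken in this algebra commute with \<open>q\<close>, so
    their products with \<open>q\<close> are projections to which minimality applies.\<close>
  interpret W: monotone_algebra "N \<inter> commutant {q}"
    by (rule monotone_algebra_Int[OF N.monotone_algebra_axioms monotone_algebra_commutant])
  have qv: "inner v (blinfun_apply q v) = (norm (blinfun_apply q v))\<^sup>2" for v
    by (rule projection_op_inner[OF q(2)])
  have dich: "(\<forall>v. r * inner v (blinfun_apply q v) \<le> inner v (blinfun_apply a v)) \<or>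
      (\<forall>v. inner v (blinfun_apply a v) \<le> r * inner v (blinfun_apply q v))" for r
  proof -
    define b where "b = a - r *\<^sub>R q"
    have bN: "b \<in> N" unfolding b_def using a q by (intro N.diff_closed N.scaleR_closed)
    have bq: "b o\<^sub>L q = b" "q o\<^sub>L b = b" by (simp_all add: b_def blinfun_comp_linear aq a qidem)
    have "b \<in> commutant {q}" using bq N.bounded[OF bN]
      by (auto intro!: commutantI) (metis blinfun_apply_blinfun_compose)
    moreover have "self_adjoint b" unfolding b_def using a qsa by (intro sa_diff sa_scaleR)
    ultimately obtain p where p: "p \<in> N \<inter> commutant {q}" "projection_op p" "p o\<^sub>L b = b o\<^sub>L p"
        "\<And>v. 0 \<le> inner v (blinfun_apply (b o\<^sub>L p) v)"
        "\<And>v. inner v (blinfun_apply (b o\<^sub>L (id_blinfun - p)) v) \<le> 0"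
      using W.positive_part_projection[of b] bN by blast
    have pq: "p o\<^sub>L q = q o\<^sub>L p" using p(1) by (auto simp: commutant_def)
    have "projection_op (q o\<^sub>L p)"
      unfolding projection_op_def
    proof
      show "self_adjoint (q o\<^sub>L p)" using sa_comp[OF qsa projection_op_sa[OF p(2)]] pq by simp
      show "q o\<^sub>L p o\<^sub>L (q o\<^sub>L p) = q o\<^sub>L p"
        using pq qidem p(2) unfolding projection_op_def by (metis blinfun_assoc)
    qed
    moreover have "q o\<^sub>L (q o\<^sub>L p) = q o\<^sub>L p" using qidem by (metis blinfun_assoc)
    moreover have "q o\<^sub>L p \<in> N" using N.comp_closed q p by blast
    ultimately consider "q o\<^sub>L p = 0" | "q o\<^sub>L p = q" using min by blast
    then show ?thesis
    proof cases
      case 1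
      have "b o\<^sub>L p = b o\<^sub>L (q o\<^sub>L p)" by (metis bq(1) blinfun_assoc)
      then have "b o\<^sub>L (id_blinfun - p) = b" using 1 by (simp add: blinfun_comp_linear)
      then have "inner v (blinfun_apply b v) \<le> 0" for v using p(5)[of v] by simp
      then show ?thesis by (simp add: b_def op_apply inner_diff_right)
    next
      case 2
      have "b o\<^sub>L p = b o\<^sub>L (q o\<^sub>L p)" by (metis bq(1) blinfun_assoc)
      then have "b o\<^sub>L p = b" using 2 bq by simp
      then have "0 \<le> inner v (blinfun_apply b v)" for v using p(4)[of v] by simp
      then show ?thesis by (simp add: b_def op_apply inner_diff_right)
    qed
  qed
  define L where "L = {r. \<forall>v. r * inner v (blinfun_apply q v) \<le> inner v (blinfun_apply a v)}"
  have av: "inner v (blinfun_apply a v) = inner (blinfun_apply q v) (blinfun_apply a (blinfun_apply q v))" for v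
    using sa_inner[OF qsa, of v "blinfun_apply a (blinfun_apply q v)"] aq a(3)
    by (metis blinfun_apply_blinfun_compose)
  have "- norm a \<in> L"
    unfolding L_def
  proof (intro CollectI allI)
    fix v
    show "- norm a * inner v (blinfun_apply q v) \<le> inner v (blinfun_apply a v)"
      unfolding av[of v] qv using inner_le_norm[of "blinfun_apply q v" "- a"] by (simp add: op_apply)
  qed
  obtain v0 where v0: "blinfun_apply q v0 \<noteq> 0" using q(3) by (metis blinfun_eqI blinfun.zero_left)
  have "r \<le> norm a" if "r \<in> L" for r
  proof -
    have "r * (norm (blinfun_apply q v0))\<^sup>2 \<le> inner v0 (blinfun_apply a v0)" using that by (simp add: L_def qv)
    also have "\<dots> \<le> norm a * (norm (blinfun_apply q v0))\<^sup>2" unfolding av[of v0] by (rule inner_le_norm)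
    finally show ?thesis using v0 by simp
  qed
  then have bdd: "bdd_above L" by (auto simp: bdd_above_def)
  define t where "t = Sup L"
  have lower: "t * inner v (blinfun_apply q v) \<le> inner v (blinfun_apply a v)" for v
  proof (cases "blinfun_apply q v = 0")
    case True then show ?thesis using av[of v] by simp
  next
    case False
    have "t \<le> inner v (blinfun_apply a v) / (norm (blinfun_apply q v))\<^sup>2"
      unfolding t_def
    proof (rule cSup_least)
      show "L \<noteq> {}" using \<open>- norm a \<in> L\<close> by blast
      show "r \<le> inner v (blinfun_apply a v) / (norm (blinfun_apply q v))\<^sup>2" if "r \<in> L" for r
        using that False by (simp add: L_def qv le_divide_eq)
    qed
    then show ?thesis using False by (simp add: qv le_divide_eq)
  qed
  have upper: "inner v (blinfun_apply a v) \<le> t * inner v (blinfun_apply q v)" for v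
  proof -
    have r: "inner v (blinfun_apply a v) \<le> r * (norm (blinfun_apply q v))\<^sup>2" if "t < r" for r
    proof -
      have "r \<notin> L" using that cSup_upper[OF _ bdd] unfolding t_def by force
      then show ?thesis using dich[of r] by (auto simp: L_def qv)
    qed
    have "(\<lambda>n. (t + 1 / real (Suc n)) * (norm (blinfun_apply q v))\<^sup>2) \<longlonglongrightarrow> (t + 0) * (norm (blinfun_apply q v))\<^sup>2"
      by (intro tendsto_mult tendsto_add tendsto_const) (use LIMSEQ_inverse_real_of_nat in \<open>simp add: inverse_eq_divide\<close>)
    then have "inner v (blinfun_apply a v) \<le> (t + 0) * (norm (blinfun_apply q v))\<^sup>2"
      by (rule LIMSEQ_le_const) (use r in auto)
    then show ?thesis by (simp add: qv)
  qed
  have "a = t *\<^sub>R q"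
    by (rule sa_eqI[OF a(2) sa_scaleR[OF qsa]]) (use lower upper in \<open>auto simp: op_apply intro: antisym\<close>)
  then show ?thesis by (rule that)
qed

lemma op_power_eigenspace:
  assumes "u \<in> eigenspace \<alpha>" "cmod \<alpha> = 1"
  shows "op_power u k \<in> eigenspace (\<alpha> ^ k)"
proof (induction k)
  case 0 then show ?case using N_subset_eigenspace N.id_closed by simp
next
  case (Suc k)
  then show ?case using eigenspace_comp[OF assms(1) Suc] assms by (simp add: norm_power)
qed

text \<open>Only the order of each single phase is bounded, by one \<open>n\<close> for all of them;
  finiteness follows because there are finitely many roots of unity of bounded order.\<close>

lemma finite_phases_atomic:
  assumes q: "q \<in> N" "projection_op q" "q \<noteq> 0"
    and min: "\<And>r. r \<in> N \<Longrightarrow> projection_op r \<Longrightarrow> q o\<^sub>L r = r \<Longrightarrow> r = 0 \<or> r = q"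
  shows "finite phases"
proof -
  \<comment> \<open>The threshold opposes the bound n \<le> 2 / \<delta>^2 reached at the
    end.\<close>
  obtain n :: nat where n: "2 / \<delta>\<^sup>2 < n" using reals_Archimedean2 by blast
  have n0: "n > 0" using n \<delta> by (metis divide_pos_pos gr0I less_asym of_nat_0 zero_less_numeral zero_less_power)
  have "\<exists>k\<in>{1..<2*n}. \<alpha> ^ k = 1" if \<alpha>: "\<alpha> \<in> phases" for \<alpha>
  proof (rule ccontr)
    assume no: "\<not> (\<exists>k\<in>{1..<2*n}. \<alpha> ^ k = 1)"
    have unit: "cmod \<alpha> = 1" using \<alpha> by (simp add: phases_def)
    then have \<alpha>0: "\<alpha> \<noteq> 0" by auto
    \<comment> \<open>The range has to cover all exponents i + j with i, j < n, which occur in the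
      square of the sum.\<close>
    have inj: "inj_on (\<lambda>k. \<alpha> ^ k) {..<2*n}"
    proof (rule linorder_inj_onI')
      fix i j assume ij: "i \<in> {..<2*n}" "j \<in> {..<2*n}" "i < j"
      have "\<alpha> ^ j = \<alpha> ^ i * \<alpha> ^ (j - i)" using ij by (simp flip: power_add)
      moreover have "j - i \<in> {1..<2*n}" using ij by auto
      with no have "\<alpha> ^ (j - i) \<noteq> 1" by blast
      ultimately show "\<alpha> ^ i \<noteq> \<alpha> ^ j" using \<alpha>0 by simp
    qed
    obtain x where x: "x \<in> eigenspace \<alpha>" "x \<noteq> 0" using \<alpha> by (auto simp: phases_def)
    obtain d where d: "d \<in> N" "q o\<^sub>L d o\<^sub>L x \<noteq> 0"
      using eigen_prime[OF N_subset_eigenspace[OF q(1)] q(3) _ x unit] by auto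
    have e: "q o\<^sub>L d o\<^sub>L x \<in> eigenspace \<alpha>" by (intro eigenspace_N_comp x unit N.comp_closed q d)
    obtain d' where d': "d' \<in> N" "q o\<^sub>L d o\<^sub>L x o\<^sub>L d' o\<^sub>L q \<noteq> 0"
      using eigen_prime[OF e d(2) unit N_subset_eigenspace[OF q(1)] q(3)] by auto
    define y where "y = q o\<^sub>L d o\<^sub>L x o\<^sub>L d' o\<^sub>L q"
    have qidem: "q o\<^sub>L q = q" using q(2) by (simp add: projection_op_def)
    have y: "y \<in> eigenspace \<alpha>" "y \<noteq> 0" unfolding y_def by (intro eigenspace_comp_N e d' q) (rule d'(2))
    have yM: "y \<in> M" using eigenspace_closed y by blast
    have yq: "y o\<^sub>L q = y" unfolding y_def by (simp only: blinfun_assoc qidem)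
    have qy: "q o\<^sub>L y = y" unfolding y_def by (metis blinfun_assoc qidem)
    have "q o\<^sub>L adj y = adj y"
      using M.adj_comp[OF yM, of q] q sub yq sa_adj[OF projection_op_sa[OF q(2)]] by auto
    then have "q o\<^sub>L (adj y o\<^sub>L y) = adj y o\<^sub>L y" by (metis blinfun_assoc)
    then obtain t where t: "adj y o\<^sub>L y = t *\<^sub>R q"
      using minimal_projection_corner[OF q min eigen_adj_comp_self_in_N[OF y(1) unit] M.adj_comp_self_sa[OF yM]] by blast
    have yv: "(norm (blinfun_apply y v))\<^sup>2 = t * (norm (blinfun_apply q v))\<^sup>2" for v
      using M.inner_adj_comp_self[OF yM, of v] projection_op_inner[OF q(2), of v] by (simp add: t op_apply)
    have tpos: "t > 0"
    proof -
      obtain v where "blinfun_apply y v \<noteq> 0" using y(2) by (metis blinfun_eqI blinfun.zero_left)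
      then have "0 < t * (norm (blinfun_apply q v))\<^sup>2" unfolding yv[symmetric] by simp
      then show ?thesis by (simp add: zero_less_mult_iff)
    qed
    \<comment> \<open>As \<open>adj y o\<^sub>L y\<close> is \<open>t *\<^sub>R q\<close>, this
      rescaling is isometric on the range of \<open>q\<close> and maps that range into itself, so
      its powers are isometric there too.\<close>
    define u where "u = complex_of_real (1 / sqrt t) *\<^sub>C y"
    have u: "u \<in> eigenspace \<alpha>" unfolding u_def by (rule eigenspace_scaleC[OF y(1)])
    have uM: "u \<in> M" using eigenspace_closed u by blast
    have qu: "blinfun_apply q (blinfun_apply u v) = blinfun_apply u v" for v
      using arg_cong[OF qy, of "\<lambda>f. blinfun_apply f v"] op_scaleC[OF N.bounded[OF q(1)]] by (simp add: u_def op_apply)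
    have nu: "norm (blinfun_apply u v) = norm v" if "blinfun_apply q v = v" for v
    proof -
      have "(norm (blinfun_apply u v))\<^sup>2 = (norm v)\<^sup>2"
        using yv[of v] that tpos by (simp add: u_def op_apply norm_scaleC norm_divide power_mult_distrib power_divide)
      then show ?thesis by (simp add: power2_eq_iff_nonneg)
    qed
    define U where "U k v = blinfun_apply (op_power u k) v" for k v
    have qU: "blinfun_apply q (U k v) = U k v" if "blinfun_apply q v = v" for k v
      using that by (cases k) (auto simp: U_def op_apply qu)
    have nU: "norm (U k v) = norm v" if "blinfun_apply q v = v" for k v
    proof (induction k)
      case (Suc k)
      have "U (Suc k) v = blinfun_apply u (U k v)" by (simp add: U_def op_apply)
      then show ?case using nu[OF qU[OF that]] Suc by simp
    qed (simp add: U_def op_apply)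
    have U_add: "U i (U j v) = U (i + j) v" for i j v by (simp add: U_def op_power_add op_apply)
    have U_linear: "U k (\<Sum>i\<in>J. f i) = (\<Sum>i\<in>J. U k (f i))" "U k (c *\<^sub>C v) = c *\<^sub>C U k v" for k J c v and f :: "nat \<Rightarrow> 'h"
      by (simp_all add: U_def op_linear op_scaleC[OF M.bounded[OF M.power_closed[OF uM]]])
    define S where "S m v = (\<Sum>i<n. (\<alpha> ^ i) ^ m *\<^sub>C U i v)" for m v
    have qS: "blinfun_apply q (S m v) = S m v" if "blinfun_apply q v = v" for m v
      by (simp add: S_def op_linear op_scaleC[OF N.bounded[OF q(1)]] qU[OF that])
    \<comment> \<open>The powers of \<open>u\<close> are eigenoperators for the distinct phases
      \<open>\<alpha> ^ i\<close>, and twisting by unit scalars changes neither this nor the norms.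
      The result stays in the range of \<open>q\<close>, so the bound can be used twice.\<close>
    have nS: "\<delta> * (norm (S m v))\<^sup>2 \<le> n * (norm v)\<^sup>2" if v: "blinfun_apply q v = v" for m v
    proof -
      have "\<delta> * (norm (\<Sum>i<n. blinfun_apply ((\<alpha> ^ i) ^ m *\<^sub>C op_power u i) v))\<^sup>2
          \<le> (\<Sum>i<n. (norm (blinfun_apply ((\<alpha> ^ i) ^ m *\<^sub>C op_power u i) v))\<^sup>2)"
        by (rule eigen_sum_norm_le[where \<alpha> = "\<lambda>i. \<alpha> ^ i"])
           (auto simp: unit norm_power intro!: eigenspace_scaleC op_power_eigenspace u inj_on_subset[OF inj])
      then show ?thesis
        using nU[OF v] by (simp add: S_def U_def op_apply norm_scaleC norm_power unit)
    qed
    obtain \<eta> where \<eta>: "blinfun_apply q \<eta> = \<eta>" "\<eta> \<noteq> 0"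
      using q(3) projection_op_idem[OF q(2)] by (metis blinfun_eqI blinfun.zero_left)
    define P where "P = {..<n} \<times> {..<n}"
    \<comment> \<open>The number of ways to write \<open>k\<close> as i + j: the coefficient of the
      k-th power in the squared sum.\<close>
    define c where "c k = card {p \<in> P. fst p + snd p = k}" for k
    define w where "w k = real (c k) *\<^sub>R U k \<eta>" for k
    have group: "(\<Sum>k<2*n. real (c k) *\<^sub>R f k) = (\<Sum>p\<in>P. f (fst p + snd p))" for f :: "nat \<Rightarrow> 'z::real_vector"
    proof -
      have "(\<Sum>p\<in>P. f (fst p + snd p)) = (\<Sum>k<2*n. \<Sum>p\<in>{p\<in>P. fst p + snd p = k}. f (fst p + snd p))"
        by (rule sum.group[symmetric]) (auto simp: P_def)
      also have "\<dots> = (\<Sum>k<2*n. real (c k) *\<^sub>R f k)"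
        by (intro sum.cong refl) (simp add: c_def sum_constant_scaleR)
      finally show ?thesis by simp
    qed
    have SS: "S m (S m \<eta>) = (\<Sum>k<2*n. (\<alpha> ^ k) ^ m *\<^sub>C w k)" for m
    proof -
      have "S m (S m \<eta>) = (\<Sum>i<n. \<Sum>j<n. (\<alpha> ^ (i + j)) ^ m *\<^sub>C U (i + j) \<eta>)"
        by (simp add: S_def U_linear U_add scaleC_sum_right scaleC_scaleC power_add power_mult_distrib)
      also have "\<dots> = (\<Sum>p\<in>P. (\<alpha> ^ (fst p + snd p)) ^ m *\<^sub>C U (fst p + snd p) \<eta>)"
        unfolding P_def by (simp add: sum.cartesian_product case_prod_beta)
      also have "\<dots> = (\<Sum>k<2*n. real (c k) *\<^sub>R (\<alpha> ^ k) ^ m *\<^sub>C U k \<eta>)"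
        by (rule group[symmetric])
      finally show ?thesis by (simp add: w_def scaleR_scaleC_commute)
    qed
    have bound: "\<delta>\<^sup>2 * (norm (S m (S m \<eta>)))\<^sup>2 \<le> (real n)\<^sup>2 * (norm \<eta>)\<^sup>2" for m
    proof -
      have "\<delta> * (\<delta> * (norm (S m (S m \<eta>)))\<^sup>2) \<le> \<delta> * (n * (norm (S m \<eta>))\<^sup>2)"
        using nS[OF qS[OF \<eta>(1)]] \<delta> by (intro mult_left_mono) auto
      also have "\<dots> = n * (\<delta> * (norm (S m \<eta>))\<^sup>2)" by simp
      also have "\<dots> \<le> n * (n * (norm \<eta>)\<^sup>2)" using nS[OF \<eta>(1)] by (intro mult_left_mono) auto
      finally show ?thesis by (simp add: power2_eq_square)
    qed
    have expand: "complex_of_real ((norm (S m (S m \<eta>)))\<^sup>2) =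
        (\<Sum>i<2*n. \<Sum>j<2*n. (cnj (\<alpha> ^ i) * \<alpha> ^ j) ^ m * cinner (w i) (w j))" for m
      unfolding cinner_self[symmetric] SS
      by (simp add: cinner_sum_right cinner_sum_left cinner_scaleC_left cinner_scaleC_right power_mult_distrib sum_distrib_left mult.assoc)
         (subst sum.swap, simp add: mult_ac)
    \<comment> \<open>The averaging lemma transports lower bounds; negated coefficients make it
      yield an upper bound for the diagonal.\<close>
    have "- ((real n)\<^sup>2 * (norm \<eta>)\<^sup>2 / \<delta>\<^sup>2) \<le> Re (\<Sum>i<2*n. - cinner (w i) (w i))"
    proof (rule mean_double_sum_ge[where \<beta> = "\<lambda>i. \<alpha> ^ i" and c = "\<lambda>i j. - cinner (w i) (w j)"])
      fix m
      have "(norm (S m (S m \<eta>)))\<^sup>2 \<le> (real n)\<^sup>2 * (norm \<eta>)\<^sup>2 / \<delta>\<^sup>2"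
        using bound[of m] \<delta> by (simp add: field_simps)
      moreover have "(norm (S m (S m \<eta>)))\<^sup>2 = Re (\<Sum>i<2*n. \<Sum>j<2*n. (cnj (\<alpha> ^ i) * \<alpha> ^ j) ^ m * cinner (w i) (w j))"
        by (simp only: expand[symmetric] Re_complex_of_real)
      ultimately show "- ((real n)\<^sup>2 * (norm \<eta>)\<^sup>2 / \<delta>\<^sup>2) \<le> Re (\<Sum>i<2*n. \<Sum>j<2*n. (cnj (\<alpha> ^ i) * \<alpha> ^ j) ^ m * - cinner (w i) (w j))"
        by (simp add: sum_negf)
    qed (use inj unit in \<open>auto simp: norm_power\<close>)
    then have "(\<Sum>i<2*n. (norm (w i))\<^sup>2) \<le> (real n)\<^sup>2 * (norm \<eta>)\<^sup>2 / \<delta>\<^sup>2"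
      by (simp add: sum_negf cinner_self del: of_real_power)
    moreover have "(norm (w i))\<^sup>2 = (real (c i))\<^sup>2 * (norm \<eta>)\<^sup>2" for i
      by (simp add: w_def nU[OF \<eta>(1)] power_mult_distrib)
    ultimately have "(\<Sum>i<2*n. (real (c i))\<^sup>2) * (norm \<eta>)\<^sup>2 \<le> ((real n)\<^sup>2 / \<delta>\<^sup>2) * (norm \<eta>)\<^sup>2"
      by (simp add: sum_distrib_right)
    then have upper: "(\<Sum>i<2*n. (real (c i))\<^sup>2) \<le> (real n)\<^sup>2 / \<delta>\<^sup>2"
      by (rule mult_right_le_imp_le) (use \<eta>(2) in simp)
    have "(\<Sum>i<2*n. real (c i)) = (real n)\<^sup>2"
      using group[of "\<lambda>_. 1::real"] by (simp add: P_def power2_eq_square)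
    \<comment> \<open>Cauchy-Schwarz over the \<open>2 * n\<close> exponents: the coefficients sum
      to n^2, so their squares sum to at least n^3 / 2.\<close>
    then have "((real n)\<^sup>2)\<^sup>2 \<le> (\<Sum>i<2*n. (real (c i))\<^sup>2) * (2 * n)"
      using Cauchy_Schwarz_ineq_sum[of "\<lambda>i. real (c i)" "\<lambda>_. 1" "{..<2*n}"] by simp
    also have "\<dots> \<le> ((real n)\<^sup>2 / \<delta>\<^sup>2) * (2 * n)" using upper by (intro mult_right_mono) auto
    finally have "((real n)\<^sup>2 * real n) * real n \<le> ((real n)\<^sup>2 * real n) * (2 / \<delta>\<^sup>2)"
      by (simp add: power2_eq_square mult_ac)
    then have "real n \<le> 2 / \<delta>\<^sup>2" by (rule mult_left_le_imp_le) (use n0 in simp)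
    with n show False by simp
  qed
  then have "phases \<subseteq> (\<Union>k\<in>{1..<2*n}. {z. z ^ k = 1})" by blast
  moreover have "finite (\<Union>k\<in>{1..<2*n}. {z::complex. z ^ k = 1})" by (intro finite_UN_I finite_roots_unity) auto
  ultimately show ?thesis by (rule finite_subset)
qed

lemma finite_phases: "finite phases"
proof (cases "\<exists>q. q \<in> N \<and> projection_op q \<and> q \<noteq> 0 \<and> (\<forall>r\<in>N. projection_op r \<and> q o\<^sub>L r = r \<longrightarrow> r = 0 \<or> r = q)")
  case True then show ?thesis using finite_phases_atomic by blast
next
  case False
  have "id_blinfun \<noteq> (0 :: 'h \<Rightarrow>\<^sub>L 'h)" using fac by (simp add: factor_def)
  with False finite_phases_nonatomic show ?thesis by blast
qed

section \<open>The group of phases and its cyclicity\<close>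

lemma phases_one: "1 \<in> phases"
proof -
  have "id_blinfun \<noteq> (0 :: 'h \<Rightarrow>\<^sub>L 'h)" using fac by (simp add: factor_def)
  then show ?thesis using N_subset_eigenspace[OF N.id_closed] by (auto simp: phases_def)
qed

lemma phases_mult:
  assumes "\<alpha> \<in> phases" "\<beta> \<in> phases"
  shows "\<alpha> * \<beta> \<in> phases"
proof -
  obtain x y where x: "x \<in> eigenspace \<alpha>" "x \<noteq> 0" "cmod \<alpha> = 1" and y: "y \<in> eigenspace \<beta>" "y \<noteq> 0" "cmod \<beta> = 1"
    using assms by (auto simp: phases_def)
  obtain d where d: "d \<in> N" "x o\<^sub>L d o\<^sub>L y \<noteq> 0" using eigen_prime[OF x y] .
  have "x o\<^sub>L d o\<^sub>L y \<in> eigenspace (\<alpha> * \<beta>)" by (rule eigenspace_comp[OF eigenspace_comp_N[OF x(1) d(1)] y(1,3)])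
  with d x y show ?thesis by (auto simp: phases_def norm_mult)
qed

lemma phases_cnj:
  assumes "\<alpha> \<in> phases"
  shows "cnj \<alpha> \<in> phases"
  using assms eigenspace_adj eigenspace_closed M.adj_eq_0 by (fastforce simp: phases_def)

lemma carrier_phase_group: "carrier (phase_group M \<Phi>) = phases"
  by (auto simp: phase_group_def phases_def eigenvalue_on_def eigenspace_def)

lemma group_phase_group: "Group.group (phase_group M \<Phi>)"
proof (rule groupI; unfold carrier_phase_group)
  fix x assume x: "x \<in> phases"
  then have "cnj x * x = 1" using cnj_mult_unit by (simp add: phases_def)
  then show "\<exists>y\<in>phases. y \<otimes>\<^bsub>phase_group M \<Phi>\<^esub> x = \<one>\<^bsub>phase_group M \<Phi>\<^esub>"
    using phases_cnj[OF x] by (auto simp: phase_group_def)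
qed (auto simp: phase_group_def phases_one phases_mult mult.assoc)

end

text \<open>With \<open>n\<close> the order of the group, every element is an n-th root of unity;
  there are exactly \<open>n\<close> of those, so the group consists of all of them and a primitive
  one generates it.\<close>

lemma cyclic_finite_subgroup_of_units:
  fixes G :: "complex monoid"
  assumes G: "Group.group G" and fin: "finite (carrier G)" and mult: "monoid.mult G = (*)" and one: "one G = 1"
  shows "cyclic_group G"
proof -
  interpret group G by fact
  define n where "n = order G"
  have n: "n > 0" using fin by (simp add: n_def order_gt_0_iff_finite)
  have pow: "x [^]\<^bsub>G\<^esub> (k::nat) = x ^ k" for x k
    by (induction k) (simp_all add: mult one mult.commute)
  have sub: "carrier G \<subseteq> {z. z ^ n = 1}"
    using pow_order_eq_1 by (auto simp: pow n_def one)
  have "carrier G = {z. z ^ n = 1}"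
    by (rule card_subset_eq[OF finite_roots_unity sub]) (use n card_roots_unity_eq[OF n] in \<open>auto simp: n_def order_def\<close>)
  then have eq: "carrier G = (\<lambda>k. cis (2 * pi * real k / real n)) ` {..<n}"
    using Complex.bij_betw_roots_unity[OF n] by (simp add: bij_betw_def)
  define z where "z = cis (2 * pi / real n)"
  have powz: "z ^ k = cis (2 * pi * real k / real n)" for k
    unfolding z_def Complex.DeMoivre by (simp add: mult_ac)
  have "z ^ n = 1" using n by (simp add: powz)
  then have zG: "z \<in> carrier G" using \<open>carrier G = {z. z ^ n = 1}\<close> by simp
  have "carrier G \<subseteq> range (\<lambda>k::int. z [^]\<^bsub>G\<^esub> k)"
  proof
    fix x assume "x \<in> carrier G"
    then obtain k where "x = z ^ k" unfolding eq by (auto simp: powz)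
    then have "x = z [^]\<^bsub>G\<^esub> int k" by (simp add: int_pow_int pow)
    then show "x \<in> range (\<lambda>k::int. z [^]\<^bsub>G\<^esub> k)" by blast
  qed
  then have "carrier G = range (\<lambda>k::int. z [^]\<^bsub>G\<^esub> k)" using zG by auto
  then show ?thesis using cyclic_group zG by blast
qed

theorem theorem1p1:
  fixes N M :: "('h::chilbert_space \<Rightarrow>\<^sub>L 'h) set"
    and \<Phi> :: "('h \<Rightarrow>\<^sub>L 'h) \<Rightarrow> ('h \<Rightarrow>\<^sub>L 'h)"
  assumes "von_neumann_algebra M" and "von_neumann_algebra N" and "N \<subseteq> M"
    and "finite_index N M"
    and "factor N"
    and "bimodule_quantum_channel N M \<Phi>"
    and "relatively_irreducible N M \<Phi>"
  shows "Group.group (phase_group M \<Phi>) \<and> finite (carrier (phase_group M \<Phi>)) \<and>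
    cyclic_group (phase_group M \<Phi>)"
proof -
  obtain E \<delta> where E: "conditional_expectation M N E" "normal_map_on M N E" "\<delta> > 0"
      "\<forall>x\<in>M. positive_op x \<longrightarrow> \<delta> *\<^sub>R x \<le>\<^sub>o\<^sub>p E x"
    using assms(4) unfolding finite_index_def by blast
  interpret M: von_neumann M by (rule von_neumann_algebra_locale[OF assms(1)])
  interpret N: von_neumann N by (rule von_neumann_algebra_locale[OF assms(2)])
  interpret irreducible_channel M N \<Phi> E \<delta>
    by unfold_locales (use assms E in auto)
  have fin: "finite (carrier (phase_group M \<Phi>))" by (simp add: carrier_phase_group finite_phases)
  have "cyclic_group (phase_group M \<Phi>)"
    by (rule cyclic_finite_subgroup_of_units[OF group_phase_group fin]) (simp_all add: phase_group_def)
  then show ?thesis using group_phase_group fin by blast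
qed

end
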